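(* Fix $r\in\mathbb N$ and a compact interval $[t_0,t_1]\subset\mathbb R$. Let $f_0\sim\mathcal{GP}(\mu,C_\theta)$ be a Gaussian process on $[t_0,t_1]$ with $\mu\in C^r([t_0,t_1])$ and $C_\theta\in C^{r,r}([t_0,t_1]^2)$, and let $\boldsymbol\kappa=(\kappa_1,\dots,\kappa_r)^\top\sim N(\boldsymbol\mu_\kappa,\boldsymbol\Sigma_\kappa)$ be independent of $f_0$. For $p=-r,\ldots,-1$, let $f_p$ be the $(-p)$th mean-square derivative process of $f_0$. For $p=1,\ldots,r$ and $t\in[t_0,t_1]$ define $$f_p(t):=\frac{1}{(p-1)!}\int_{t_0}^t (t-u)^{p-1}f_0(u)\,du+\sum_{j=1}^{p}\frac{(t-t_0)^{p-j}}{(p-j)!}\kappa_j,$$ where the integral is understood as an $L^2$-random variable. Then: (1) For each $p=-r+1,\ldots,r$ and $t\in(t_0,t_1)$, $\lim_{h\to0}\mathbb E\big[\big(\tfrac{f_p(t+h)-f_p(t)}{h}-f_{p-1}(t)\big)^2\big]=0$, and $f_p(t_0)=\kappa_p$ for $p=1,\ldots,r$. (2) If, in addition, $\mu=0$ and $\boldsymbol\mu_\kappa=\mathbf 0$, then $(f_{-r},\ldots,f_r)$ is a centered $r$-order differential ensemble. (3) For every finite collection $(p_i,\tau_i)_{i=1}^m$ with $p_i\in\{-r,\ldots,r\}$ and $\tau_i\in[t_0,t_1]$, the vector $(f_{p_1}(\tau_1),\ldots,f_{p_m}(\tau_m))^\top$ is multivariate Gaussian. Equivalently, $\mathbf f(t)=(f_{-r}(t),\ldots,f_r(t))^\top$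 is an $\mathbb R^{2r+1}$-valued Gaussian process, whose finite-dimensional distributions are determined by the mean functions $$\mu_p(t)=(\mathcal A_{t_0}^{[p]}\mu)(t)+\mathbf 1_{\{p>0\}}\sum_{j=1}^{p}\frac{(t-t_0)^{p-j}}{(p-j)!}(\boldsymbol\mu_\kappa)_j$$ and the covariance entries $\operatorname{Cov}(f_p(s),f_q(t))=C_{pq}(s,t)=C^{\mathrm{anc}}_{pq}(s,t)+C^{\kappa}_{pq}(s,t)$, where for $p,q\in\{-r,\ldots,r\}$ $$C^{\mathrm{anc}}_{pq}(s,t)=(\mathcal A_{1,t_0}^{[p]}\mathcal A_{2,t_0}^{[q]}C_\theta)(s,t),$$ $$C^{\kappa}_{pq}(s,t)=\mathbf 1_{\{p>0\}}\mathbf 1_{\{q>0\}}\sum_{j=1}^{p}\sum_{m=1}^{q}\frac{(s-t_0)^{p-j}}{(p-j)!}\frac{(t-t_0)^{q-m}}{(q-m)!}(\boldsymbol\Sigma_\kappa)_{jm}.$$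
   Context: $\mathcal{GP}(\mu,C)$ denotes a Gaussian process with mean function $\mu$ and covariance function $C$, characterized by Gaussian finite-dimensional distributions. $C^{a,b}(I^2)$ is the set of functions on $I^2$ with continuous mixed derivatives $D_1^uD_2^v$ for $0\le u\le a$, $0\le v\le b$, where $D_1,D_2$ differentiate in the first/second argument. Derivatives at endpoints of the interval are one-sided. Derivatives and integrals of processes are taken in the $L^2(\mathbb P)$ (mean-square) sense. For an integer $q\ge0$, $\mathcal I_{t_0}^0=\mathrm{Id}$ and, for $q>0$, $(\mathcal I_{t_0}^q f)(t)=\frac{1}{(q-1)!}\int_{t_0}^t(t-u)^{q-1}f(u)\,du$. The signed-order operator is $\mathcal A_{t_0}^{[k]}=D_t^{-k}$ for $k<0$, $\mathrm{Id}$ for $k=0$, and $\mathcal I_{t_0}^k$ for $k>0$. For bivariate functions, $\mathcal A_{1,t_0}^{[k]}$ and $\mathcal A_{2,t_0}^{[k]}$ apply this operator in the first and second argument respectively. A centered $r$-order differential ensemble on $[t_0,t_1]$ is a $(2r+1)$-tuple $(f_{-r},\ldots,f_r)$ of real-valued processes on $[t_0,t_1]$ with $\mathbb E[f_p(t)]=0$ and $\mathbb E[f_p(t)^2]<\infty$ for all $p\in\{-r,\dots,r\}$ and $t\in[t_0,t_1]$, such that for each $p=-r+1,\ldots,r$ and $t\in(t_0,t_1)$, $\lim_{h\to0}\mathbb E[(\frac{f_p(t+h)-f_p(t)}{h}-f_{p-1}(t))^2]=0$; its integration constants are the boundary values $\kappa_p:=f_p(t_0)$, $p=1,\ldots,r$.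 *)

theory Defs
  imports "HOL-Probability.Probability"
begin

definition square_integrable :: "'a measure \<Rightarrow> ('a \<Rightarrow> real) \<Rightarrow> bool" where
  "square_integrable M X \<longleftrightarrow> X \<in> borel_measurable M \<and> integrable M (\<lambda>\<omega>. (X \<omega>)\<^sup>2)"

definition covariance :: "'a measure \<Rightarrow> ('a \<Rightarrow> real) \<Rightarrow> ('a \<Rightarrow> real) \<Rightarrow> real" where
  "covariance M X Y =
     (\<integral>\<omega>. (X \<omega> - (\<integral>x. X x \<partial>M)) * (Y \<omega> - (\<integral>x. Y x \<partial>M)) \<partial>M)"

text \<open>Gaussian laws may be degenerate: variance \<open>0\<close> means almost surely constant. The second
  argument of \<^const>\<open>normal_density\<close> is the standard deviation.\<close>

definition normal_rv :: "'a measure \<Rightarrow> ('a \<Rightarrow> real) \<Rightarrow> real \<Rightarrow> real \<Rightarrow> bool" where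
  "normal_rv M X m v \<longleftrightarrow> X \<in> borel_measurable M \<and>
     ((v = 0 \<and> (AE \<omega> in M. X \<omega> = m)) \<or>
      (v > 0 \<and> distributed M lborel X (\<lambda>x. ennreal (normal_density m (sqrt v) x))))"

definition gaussian_vector :: "'a measure \<Rightarrow> 'i set \<Rightarrow> ('i \<Rightarrow> 'a \<Rightarrow> real) \<Rightarrow> bool" where
  "gaussian_vector M J X \<longleftrightarrow> finite J \<and> (\<forall>j\<in>J. X j \<in> borel_measurable M) \<and>
     (\<forall>a :: 'i \<Rightarrow> real. \<exists>m v. normal_rv M (\<lambda>\<omega>. \<Sum>j\<in>J. a j * X j \<omega>) m v)"

definition multivariate_normal ::
  "'a measure \<Rightarrow> 'i set \<Rightarrow> ('i \<Rightarrow> 'a \<Rightarrow> real) \<Rightarrow> ('i \<Rightarrow> real) \<Rightarrow> ('i \<Rightarrow> 'i \<Rightarrow> real) \<Rightarrow> bool" where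
  "multivariate_normal M J X m S \<longleftrightarrow> gaussian_vector M J X \<and>
     (\<forall>i\<in>J. (\<integral>\<omega>. X i \<omega> \<partial>M) = m i) \<and> (\<forall>i\<in>J. \<forall>j\<in>J. covariance M (X i) (X j) = S i j)"

definition gaussian_process ::
  "'a measure \<Rightarrow> 't set \<Rightarrow> ('t \<Rightarrow> 'a \<Rightarrow> real) \<Rightarrow> ('t \<Rightarrow> real) \<Rightarrow> ('t \<Rightarrow> 't \<Rightarrow> real) \<Rightarrow> bool" where
  "gaussian_process M T X m K \<longleftrightarrow>
     (\<forall>J. finite J \<and> J \<subseteq> T \<longrightarrow> multivariate_normal M J X m K)"

text \<open>A process with values in \<open>\<real>\<^sup>P\<close> (finite \<open>P\<close>); \<open>K p q s t\<close> is the covariance of component \<open>p\<close>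
  at \<open>s\<close> and component \<open>q\<close> at \<open>t\<close>.\<close>

definition vector_gaussian_process ::
  "'a measure \<Rightarrow> 'p set \<Rightarrow> 't set \<Rightarrow> ('p \<Rightarrow> 't \<Rightarrow> 'a \<Rightarrow> real) \<Rightarrow>
   ('p \<Rightarrow> 't \<Rightarrow> real) \<Rightarrow> ('p \<Rightarrow> 'p \<Rightarrow> 't \<Rightarrow> 't \<Rightarrow> real) \<Rightarrow> bool" where
  "vector_gaussian_process M P T X m K \<longleftrightarrow>
     (\<forall>J. finite J \<and> J \<subseteq> T \<longrightarrow>
        multivariate_normal M (P \<times> J) (\<lambda>(p, t). X p t) (\<lambda>(p, t). m p t)
          (\<lambda>(p, s) (q, t). K p q s t))"

text \<open>\<^const>\<open>prob_space.indep_var\<close> needs both variables to have the same type, so independence is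
  expressed through the generated sigma-algebras.\<close>

definition indep_processes ::
  "'a measure \<Rightarrow> 's set \<Rightarrow> ('s \<Rightarrow> 'a \<Rightarrow> real) \<Rightarrow> 't set \<Rightarrow> ('t \<Rightarrow> 'a \<Rightarrow> real) \<Rightarrow> bool" where
  "indep_processes M S X T Y \<longleftrightarrow> prob_space.indep_set M
     (sets (vimage_algebra (space M) (\<lambda>\<omega>. \<lambda>s\<in>S. X s \<omega>) (\<Pi>\<^sub>M s\<in>S. borel)))
     (sets (vimage_algebra (space M) (\<lambda>\<omega>. \<lambda>t\<in>T. Y t \<omega>) (\<Pi>\<^sub>M t\<in>T. borel)))"

text \<open>Bochner integrals of non-integrable functions are \<open>0\<close>; the square-integrability conditions
  below keep the mean-square limits meaningful.\<close>

definition has_ms_derivative ::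
  "'a measure \<Rightarrow> real set \<Rightarrow> (real \<Rightarrow> 'a \<Rightarrow> real) \<Rightarrow> ('a \<Rightarrow> real) \<Rightarrow> real \<Rightarrow> bool" where
  "has_ms_derivative M I X Y t \<longleftrightarrow>
     (\<forall>s\<in>I. square_integrable M (X s)) \<and> square_integrable M Y \<and>
     ((\<lambda>h. \<integral>\<omega>. ((X (t + h) \<omega> - X t \<omega>) / h - Y \<omega>)\<^sup>2 \<partial>M) \<longlongrightarrow> 0) (at 0 within {h. t + h \<in> I})"

text \<open>\<open>Y\<close> is a version of the mean-square Riemann integral of \<open>X\<close> over \<open>[a, b]\<close>: a constant gauge
  \<open>d\<close> bounds the mesh of the tagged division.\<close>

definition has_ms_integral ::
  "'a measure \<Rightarrow> real \<Rightarrow> real \<Rightarrow> (real \<Rightarrow> 'a \<Rightarrow> real) \<Rightarrow> ('a \<Rightarrow> real) \<Rightarrow> bool" where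
  "has_ms_integral M a b X Y \<longleftrightarrow>
     (\<forall>s\<in>{a..b}. square_integrable M (X s)) \<and> square_integrable M Y \<and>
     (\<forall>e>0. \<exists>d>0. \<forall>D. D tagged_division_of {a..b} \<and> (\<lambda>x. ball x d) fine D \<longrightarrow>
        (\<integral>\<omega>. ((\<Sum>(x, k)\<in>D. measure lborel k * X x \<omega>) - Y \<omega>)\<^sup>2 \<partial>M) < e)"

text \<open>One-sided at the endpoints of \<open>I\<close>; only meaningful at points of \<open>I\<close>.\<close>

definition deriv_on :: "real set \<Rightarrow> (real \<Rightarrow> real) \<Rightarrow> real \<Rightarrow> real" where
  "deriv_on I g t = vector_derivative g (at t within I)"

definition in_first :: "((real \<Rightarrow> real) \<Rightarrow> real \<Rightarrow> real) \<Rightarrow>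
    (real \<Rightarrow> real \<Rightarrow> real) \<Rightarrow> real \<Rightarrow> real \<Rightarrow> real" where
  "in_first T G s t = T (\<lambda>x. G x t) s"

definition in_second :: "((real \<Rightarrow> real) \<Rightarrow> real \<Rightarrow> real) \<Rightarrow>
    (real \<Rightarrow> real \<Rightarrow> real) \<Rightarrow> real \<Rightarrow> real \<Rightarrow> real" where
  "in_second T G s t = T (\<lambda>y. G s y) t"

definition C_on :: "nat \<Rightarrow> real set \<Rightarrow> (real \<Rightarrow> real) \<Rightarrow> bool" where
  "C_on n I g \<longleftrightarrow>
     (\<forall>k<n. \<forall>t\<in>I. (deriv_on I ^^ k) g differentiable (at t within I)) \<and>
     (\<forall>k\<le>n. continuous_on I ((deriv_on I ^^ k) g))"

definition mixed_deriv ::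
  "real set \<Rightarrow> nat \<Rightarrow> nat \<Rightarrow> (real \<Rightarrow> real \<Rightarrow> real) \<Rightarrow> real \<Rightarrow> real \<Rightarrow> real" where
  "mixed_deriv I u v G = in_first (deriv_on I ^^ u) (in_second (deriv_on I ^^ v) G)"

definition C2_on :: "nat \<Rightarrow> nat \<Rightarrow> real set \<Rightarrow> (real \<Rightarrow> real \<Rightarrow> real) \<Rightarrow> bool" where
  "C2_on a b I G \<longleftrightarrow>
     (\<forall>v<b. \<forall>s\<in>I. \<forall>t\<in>I. (\<lambda>y. mixed_deriv I 0 v G s y) differentiable (at t within I)) \<and>
     (\<forall>u<a. \<forall>v\<le>b. \<forall>s\<in>I. \<forall>t\<in>I.
        (\<lambda>x. mixed_deriv I u v G x t) differentiable (at s within I)) \<and>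
     (\<forall>u\<le>a. \<forall>v\<le>b. continuous_on (I \<times> I) (\<lambda>(s, t). mixed_deriv I u v G s t))"

definition cauchy_integral :: "real \<Rightarrow> nat \<Rightarrow> (real \<Rightarrow> real) \<Rightarrow> real \<Rightarrow> real" where
  "cauchy_integral t0 q g t =
     (if q = 0 then g t else integral {t0..t} (\<lambda>u. (t - u) ^ (q - 1) * g u) / fact (q - 1))"

definition signed_op :: "real \<Rightarrow> real \<Rightarrow> int \<Rightarrow> (real \<Rightarrow> real) \<Rightarrow> real \<Rightarrow> real" where
  "signed_op t0 t1 k g =
     (if k < 0 then (deriv_on {t0..t1} ^^ nat (- k)) g else cauchy_integral t0 (nat k) g)"

definition centered_ensemble ::
  "'a measure \<Rightarrow> nat \<Rightarrow> real \<Rightarrow> real \<Rightarrow> (int \<Rightarrow> real \<Rightarrow> 'a \<Rightarrow> real) \<Rightarrow> bool" where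
  "centered_ensemble M r t0 t1 f \<longleftrightarrow>
     (\<forall>p\<in>{- int r..int r}. \<forall>t\<in>{t0..t1}.
        square_integrable M (f p t) \<and> (\<integral>\<omega>. f p t \<omega> \<partial>M) = 0) \<and>
     (\<forall>p\<in>{- int r + 1..int r}. \<forall>t\<in>{t0<..<t1}.
        ((\<lambda>h. \<integral>\<omega>. ((f p (t + h) \<omega> - f p t \<omega>) / h - f (p - 1) t \<omega>)\<^sup>2 \<partial>M) \<longlongrightarrow> 0) (at 0))"

text \<open>The tuple generated by \<open>f0\<close> and \<open>\<kappa>\<close>. Mean-square derivatives and integrals are determined
  only almost surely, so this is a relation satisfied by every choice of versions.\<close>

definition generated_by ::
  "'a measure \<Rightarrow> nat \<Rightarrow> real \<Rightarrow> real \<Rightarrow> (real \<Rightarrow> 'a \<Rightarrow> real) \<Rightarrow> (nat \<Rightarrow> 'a \<Rightarrow> real) \<Rightarrow>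
   (int \<Rightarrow> real \<Rightarrow> 'a \<Rightarrow> real) \<Rightarrow> bool" where
  "generated_by M r t0 t1 f0 \<kappa> f \<longleftrightarrow>
     (\<forall>t\<in>{t0..t1}. \<forall>\<omega>\<in>space M. f 0 t \<omega> = f0 t \<omega>) \<and>
     (\<forall>p\<in>{- int r..- 1}. \<forall>t\<in>{t0..t1}. has_ms_derivative M {t0..t1} (f (p + 1)) (f p t) t) \<and>
     (\<forall>p\<in>{1..r}. \<forall>t\<in>{t0..t1}. \<exists>Y.
        has_ms_integral M t0 t (\<lambda>u \<omega>. (t - u) ^ (p - 1) * f0 u \<omega>) Y \<and>
        (\<forall>\<omega>\<in>space M. f (int p) t \<omega> =
           Y \<omega> / fact (p - 1) + (\<Sum>j = 1..p. (t - t0) ^ (p - j) / fact (p - j) * \<kappa> j \<omega>)))"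

definition ensemble_mean ::
  "real \<Rightarrow> real \<Rightarrow> (real \<Rightarrow> real) \<Rightarrow> (nat \<Rightarrow> real) \<Rightarrow> int \<Rightarrow> real \<Rightarrow> real" where
  "ensemble_mean t0 t1 \<mu> m\<^sub>\<kappa> p t = signed_op t0 t1 p \<mu> t +
     (if p > 0 then \<Sum>j = 1..nat p. (t - t0) ^ (nat p - j) / fact (nat p - j) * m\<^sub>\<kappa> j else 0)"

definition cov_anc ::
  "real \<Rightarrow> real \<Rightarrow> (real \<Rightarrow> real \<Rightarrow> real) \<Rightarrow> int \<Rightarrow> int \<Rightarrow> real \<Rightarrow> real \<Rightarrow> real" where
  "cov_anc t0 t1 C p q = in_first (signed_op t0 t1 p) (in_second (signed_op t0 t1 q) C)"

definition cov_const ::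
  "real \<Rightarrow> (nat \<Rightarrow> nat \<Rightarrow> real) \<Rightarrow> int \<Rightarrow> int \<Rightarrow> real \<Rightarrow> real \<Rightarrow> real" where
  "cov_const t0 S\<^sub>\<kappa> p q s t =
     (if p > 0 \<and> q > 0 then
        \<Sum>j = 1..nat p. \<Sum>m = 1..nat q.
          (s - t0) ^ (nat p - j) / fact (nat p - j) *
          ((t - t0) ^ (nat q - m) / fact (nat q - m)) * S\<^sub>\<kappa> j m
      else 0)"

definition ensemble_cov ::
  "real \<Rightarrow> real \<Rightarrow> (real \<Rightarrow> real \<Rightarrow> real) \<Rightarrow> (nat \<Rightarrow> nat \<Rightarrow> real) \<Rightarrow>
   int \<Rightarrow> int \<Rightarrow> real \<Rightarrow> real \<Rightarrow> real" where
  "ensemble_cov t0 t1 C S\<^sub>\<kappa> p q s t = cov_anc t0 t1 C p q s t + cov_const t0 S\<^sub>\<kappa> p q s t"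

end

(* All processes in question are curves in the Hilbert space of square-integrable random variables.
   Elements of the closed linear span of the f0(s) and kappa_j are Gaussian, because L2-limits of
   normal variables are normal (characteristic functions) and f0 and kappa are independent; every
   f_p(t) lies in this span. Pairing with a fixed square-integrable Z commutes with mean-square
   derivatives and integrals, so E[f_p(s) Z] is obtained from E[f0(x) Z] and E[kappa_j Z] by scalar
   calculus; taking Z = 1 and Z = f_q(t) - E f_q(t) gives means and covariances. Strong statements
   follow from weak ones by duality: the mean value theorem, or an estimate of Riemann sums, is applied
   to the scalar function E[X(x) Z] with Z the very error to be bounded. Mean-square derivatives exist
   by Loeve's criterion, whose second differences are controlled by the continuous mixed partials.
   Uniqueness of the law reduces to characteristic functions of linear combinations. *)

theory Submission
  imports Defs
begin

section \<open>Square-integrable random variables\<close>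

text \<open>The obstacle in the duality argument is uniformity: the test variable Z is the error
  itself, so it changes with the increment or the division, and a mean value point changes with it.
  Convergence for each fixed Z would not suffice; the estimates rest on moduli of continuity in L2,
  which are uniform over all Z of a given norm. Hence a weak derivative is made strong only at
  points where the derivative process is L2-continuous, and the positive orders are climbed one at a
  time: continuity of order q gives differentiability of order q + 1, which gives continuity of
  order q + 1. The start is f0, whose second moments are continuous. A closed linear space makes
  joint normality automatic: linear combinations of members are members, so only scalar normal laws
  pass to limits. Loeve's criterion needs the derivative in the second argument of a function
  already differentiated in the first, an order that \<open>C2_on\<close> does not postulate; an
  exchange of mixed partials supplies it. Random variables are functions, not classes, and
  non-integrable functions have integral 0; so square integrability is carried along in every
  estimate.\<close>

definition l2norm :: "'a measure \<Rightarrow> ('a \<Rightarrow> real) \<Rightarrow> real" where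
  "l2norm M X = sqrt (\<integral>w. (X w)\<^sup>2 \<partial>M)"

lemma l2norm_nonneg [simp]: "0 \<le> l2norm M X"
  by (simp add: l2norm_def)

lemma l2norm_power2: "(l2norm M X)\<^sup>2 = (\<integral>w. (X w)\<^sup>2 \<partial>M)"
  by (simp add: l2norm_def)

lemma l2norm_minus_commute: "l2norm M (\<lambda>w. X w - Y w) = l2norm M (\<lambda>w. Y w - X w)"
  by (simp add: l2norm_def power2_commute)

lemma l2norm_less_iff: "e > 0 \<Longrightarrow> l2norm M X < e \<longleftrightarrow> (\<integral>w. (X w)\<^sup>2 \<partial>M) < e\<^sup>2"
  unfolding l2norm_def using real_sqrt_less_iff[of "\<integral>w. (X w)\<^sup>2 \<partial>M" "e\<^sup>2"] by simp

lemma square_integrableD: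
  assumes "square_integrable M X"
  shows "X \<in> borel_measurable M" "integrable M (\<lambda>w. (X w)\<^sup>2)"
  using assms by (auto simp: square_integrable_def)

lemma square_integrable_cong:
  assumes "\<And>w. w \<in> space M \<Longrightarrow> X w = Y w"
  shows "square_integrable M X \<longleftrightarrow> square_integrable M Y"
proof -
  have "X \<in> borel_measurable M \<longleftrightarrow> Y \<in> borel_measurable M"
    by (rule measurable_cong) (rule assms)
  moreover have "integrable M (\<lambda>w. (X w)\<^sup>2) \<longleftrightarrow> integrable M (\<lambda>w. (Y w)\<^sup>2)"
    by (rule Bochner_Integration.integrable_cong) (auto simp: assms)
  ultimately show ?thesis
    by (simp add: square_integrable_def)
qed

lemma square_integrable_mult_integrable:
  assumes "square_integrable M X" "square_integrable M Y"
  shows "integrable M (\<lambda>w. X w * Y w)"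
proof (rule Bochner_Integration.integrable_bound)
  note [measurable] = assms[THEN square_integrableD(1)]
  show "integrable M (\<lambda>w. (X w)\<^sup>2 + (Y w)\<^sup>2)"
    using assms by (intro Bochner_Integration.integrable_add square_integrableD(2))
  show "(\<lambda>w. X w * Y w) \<in> borel_measurable M"
    by measurable
  have "\<bar>x * y\<bar> \<le> x\<^sup>2 + y\<^sup>2" for x y :: real
  proof -
    have "2 * (\<bar>x\<bar> * \<bar>y\<bar>) \<le> x\<^sup>2 + y\<^sup>2"
      using sum_squares_bound[of "\<bar>x\<bar>" "\<bar>y\<bar>"] by simp
    moreover have "0 \<le> \<bar>x\<bar> * \<bar>y\<bar>"
      by simp
    ultimately show ?thesis
      unfolding abs_mult by linarith
  qed
  then show "AE w in M. norm (X w * Y w) \<le> norm ((X w)\<^sup>2 + (Y w)\<^sup>2)"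
    by auto
qed

lemma square_integrable_scale:
  assumes "square_integrable M X"
  shows "square_integrable M (\<lambda>w. c * X w)"
  using assms by (auto simp: square_integrable_def power_mult_distrib)

lemma square_integrable_add:
  assumes "square_integrable M X" "square_integrable M Y"
  shows "square_integrable M (\<lambda>w. X w + Y w)"
proof -
  note [measurable] = assms[THEN square_integrableD(1)]
  have "integrable M (\<lambda>w. (X w)\<^sup>2 + (Y w)\<^sup>2 + 2 * (X w * Y w))"
    using assms
    by (intro Bochner_Integration.integrable_add square_integrableD(2)
        integrable_mult_right square_integrable_mult_integrable)
  then show ?thesis
    by (auto simp: square_integrable_def power2_sum mult.assoc)
qed

lemma square_integrable_diff:
  assumes "square_integrable M X" "square_integrable M Y"
  shows "square_integrable M (\<lambda>w. X w - Y w)"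
  using square_integrable_add[OF assms(1) square_integrable_scale[OF assms(2), of "-1"]] by simp

lemma square_integrable_divide:
  assumes "square_integrable M X"
  shows "square_integrable M (\<lambda>w. X w / c)"
  using square_integrable_scale[OF assms, of "1 / c"] by simp

lemma square_integrable_sum:
  assumes "\<And>i. i \<in> I \<Longrightarrow> square_integrable M (X i)"
  shows "square_integrable M (\<lambda>w. \<Sum>i\<in>I. X i w)"
  using assms
proof (induction I rule: infinite_finite_induct)
  case (insert i I)
  then show ?case
    using square_integrable_add[of M "X i" "\<lambda>w. \<Sum>i\<in>I. X i w"] by simp
qed (auto simp: square_integrable_def)

lemma l2norm_scale: "l2norm M (\<lambda>w. c * X w) = \<bar>c\<bar> * l2norm M X"
  by (simp add: l2norm_def power_mult_distrib real_sqrt_mult)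

text \<open>The quadratic E[(X - x Y)^2] in x is nonnegative; its value at the minimiser
  \<open>b / c\<close> is the claim. Only \<open>c = 0\<close> has no minimiser.\<close>

lemma Cauchy_Schwarz_l2norm:
  assumes "square_integrable M X" "square_integrable M Y"
  shows "\<bar>\<integral>w. X w * Y w \<partial>M\<bar> \<le> l2norm M X * l2norm M Y"
proof -
  define a b c where "a = (\<integral>w. (X w)\<^sup>2 \<partial>M)" "b = (\<integral>w. X w * Y w \<partial>M)" "c = (\<integral>w. (Y w)\<^sup>2 \<partial>M)"
  have ac: "0 \<le> a" "0 \<le> c"
    by (simp_all add: a_b_c_def)
  have q: "0 \<le> a - 2 * x * b + x\<^sup>2 * c" for x
  proof -
    have "0 \<le> (\<integral>w. (X w - x * Y w)\<^sup>2 \<partial>M)"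
      by simp
    also have "\<dots> = (\<integral>w. (X w)\<^sup>2 - (2 * x) * (X w * Y w) + x\<^sup>2 * (Y w)\<^sup>2 \<partial>M)"
      by (intro Bochner_Integration.integral_cong) (auto simp: power2_eq_square algebra_simps)
    also have "\<dots> = a - 2 * x * b + x\<^sup>2 * c"
      using assms square_integrable_mult_integrable[OF assms]
      by (simp add: a_b_c_def square_integrable_def)
    finally show ?thesis .
  qed
  have "b\<^sup>2 \<le> a * c"
  proof (cases "c = 0")
    case True
    have "b = 0"
    proof (rule ccontr)
      assume "b \<noteq> 0"
      \<comment> \<open>For \<open>c = 0\<close> the quadratic is affine in x, and this x gives it
        the value -1.\<close>
      then show False
        using q[of "(a + 1) / (2 * b)"] True by (simp add: field_simps)
    qed
    then show ?thesis
      using True by simp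
  next
    case False
    then show ?thesis
      using q[of "b / c"] ac by (simp add: field_simps power2_eq_square)
  qed
  then have "sqrt (b\<^sup>2) \<le> sqrt (a * c)"
    by (rule real_sqrt_le_mono)
  then show ?thesis
    by (simp add: l2norm_def a_b_c_def real_sqrt_mult)
qed

lemma l2norm_triangle:
  assumes "square_integrable M X" "square_integrable M Y"
  shows "l2norm M (\<lambda>w. X w + Y w) \<le> l2norm M X + l2norm M Y"
proof (rule power2_le_imp_le)
  have "(l2norm M (\<lambda>w. X w + Y w))\<^sup>2 = (\<integral>w. (X w)\<^sup>2 + (Y w)\<^sup>2 + 2 * (X w * Y w) \<partial>M)"
    unfolding l2norm_power2
    by (intro Bochner_Integration.integral_cong) (auto simp: power2_eq_square algebra_simps)
  also have "\<dots> = (l2norm M X)\<^sup>2 + (l2norm M Y)\<^sup>2 + 2 * (\<integral>w. X w * Y w \<partial>M)"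
    using assms square_integrable_mult_integrable[OF assms]
    by (simp add: l2norm_power2 square_integrable_def)
  also have "\<dots> \<le> (l2norm M X + l2norm M Y)\<^sup>2"
    using Cauchy_Schwarz_l2norm[OF assms] by (simp add: power2_sum)
  finally show "(l2norm M (\<lambda>w. X w + Y w))\<^sup>2 \<le> (l2norm M X + l2norm M Y)\<^sup>2" .
qed simp

lemma l2norm_triangle_diff:
  assumes "square_integrable M X" "square_integrable M Y" "square_integrable M Z"
  shows "l2norm M (\<lambda>w. X w - Z w) \<le> l2norm M (\<lambda>w. X w - Y w) + l2norm M (\<lambda>w. Y w - Z w)"
  using l2norm_triangle[OF square_integrable_diff[OF assms(1,2)] square_integrable_diff[OF assms(2,3)]]
  by simp

lemma l2norm_diff_ineq:
  assumes "square_integrable M X" "square_integrable M Y"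
  shows "\<bar>l2norm M X - l2norm M Y\<bar> \<le> l2norm M (\<lambda>w. X w - Y w)"
  using l2norm_triangle[OF square_integrable_diff[OF assms] assms(2)]
    l2norm_triangle[OF square_integrable_diff[OF assms(2,1)] assms(1)]
    l2norm_minus_commute[of M X Y]
  by simp

text \<open>The pairing of W with itself is the square of its norm, so one factor cancels. This
  converts a bound that is linear in the test variable into a norm bound, by choosing the error as
  its own test variable.\<close>

lemma l2norm_le_by_duality:
  assumes "\<bar>\<integral>w. W w * W w \<partial>M\<bar> \<le> c * l2norm M W" "0 \<le> c"
  shows "l2norm M W \<le> c"
proof (cases "l2norm M W = 0")
  case False
  then have pos: "0 < l2norm M W"
    using l2norm_nonneg[of M W] by linarith
  have "l2norm M W * l2norm M W \<le> c * l2norm M W"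
    using assms(1) l2norm_power2[of M W] by (simp add: power2_eq_square)
  then show ?thesis
    using pos by simp
qed (use assms in simp)

lemma l2norm_tendsto_iff:
  "((\<lambda>h. l2norm M (X h)) \<longlongrightarrow> 0) F \<longleftrightarrow> ((\<lambda>h. \<integral>w. (X h w)\<^sup>2 \<partial>M) \<longlongrightarrow> 0) F"
proof
  assume "((\<lambda>h. l2norm M (X h)) \<longlongrightarrow> 0) F"
  then have "((\<lambda>h. (l2norm M (X h))\<^sup>2) \<longlongrightarrow> 0\<^sup>2) F"
    by (rule tendsto_power)
  then show "((\<lambda>h. \<integral>w. (X h w)\<^sup>2 \<partial>M) \<longlongrightarrow> 0) F"
    by (simp add: l2norm_power2)
next
  assume "((\<lambda>h. \<integral>w. (X h w)\<^sup>2 \<partial>M) \<longlongrightarrow> 0) F"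
  then show "((\<lambda>h. l2norm M (X h)) \<longlongrightarrow> 0) F"
    unfolding l2norm_def using tendsto_real_sqrt by fastforce
qed

lemma l2norm_eq_0_imp_AE:
  assumes "square_integrable M X" "l2norm M X = 0"
  shows "AE w in M. X w = 0"
proof -
  have "AE w in M. (X w)\<^sup>2 = 0"
    using integral_nonneg_eq_0_iff_AE[of M "\<lambda>w. (X w)\<^sup>2"] assms
    by (simp add: square_integrable_def l2norm_def)
  then show ?thesis
    by simp
qed

section \<open>Square-integrable variables on a probability space: completeness\<close>

context prob_space
begin

lemma square_integrable_const: "square_integrable M (\<lambda>_. c)"
  by (simp add: square_integrable_def)

lemma square_integrable_integrable:
  assumes "square_integrable M X"
  shows "integrable M X"
  using square_integrable_mult_integrable[OF assms square_integrable_const[of 1]] by simp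

lemma expectation_le_l2norm:
  assumes "square_integrable M X"
  shows "expectation (\<lambda>w. \<bar>X w\<bar>) \<le> l2norm M X"
proof -
  have "square_integrable M (\<lambda>w. \<bar>X w\<bar>)"
    using assms by (auto simp: square_integrable_def)
  from Cauchy_Schwarz_l2norm[OF this square_integrable_const[of 1]] show ?thesis
    by (simp add: l2norm_def prob_space)
qed

lemma abs_expectation_le_l2norm:
  assumes "square_integrable M X"
  shows "\<bar>expectation X\<bar> \<le> l2norm M X"
  using expectation_le_l2norm[OF assms] integral_abs_bound[of M X] by linarith

text \<open>Riesz-Fischer: total mass 1 makes an L2-Cauchy sequence L1-Cauchy, so a subsequence
  converges almost everywhere, and Fatou's lemma along that subsequence bounds the L2 distance to
  its pointwise limit.\<close>

lemma l2_Cauchy_sequence_converges: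
  assumes X: "\<And>n. square_integrable M (X n)"
    and C: "\<And>e. e > 0 \<Longrightarrow> \<exists>N. \<forall>i\<ge>N. \<forall>j\<ge>N. l2norm M (\<lambda>w. X i w - X j w) < e"
  obtains Y where "square_integrable M Y" "(\<lambda>n. l2norm M (\<lambda>w. X n w - Y w)) \<longlonglongrightarrow> 0"
proof -
  have [measurable]: "X n \<in> borel_measurable M" for n
    using X square_integrableD by blast
  have "\<exists>N. \<forall>i\<ge>N. \<forall>j\<ge>N. LINT x|M. norm (X i x - X j x) < e" if e: "e > 0" for e
  proof -
    have "LINT x|M. norm (X i x - X j x) \<le> l2norm M (\<lambda>w. X i w - X j w)" for i j
      using expectation_le_l2norm[OF square_integrable_diff[OF X X]] by simp
    then show ?thesis
      using C[OF e] by (meson le_less_trans)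
  qed
  with square_integrable_integrable[OF X] obtain r where r: "strict_mono r"
    and AE_C: "AE x in M. Cauchy (\<lambda>i. X (r i) x)"
    by (rule cauchy_L1_AE_cauchy_subseq)
  define Y where "Y w = lim (\<lambda>i. X (r i) w)" for w
  have [measurable]: "Y \<in> borel_measurable M"
    unfolding Y_def by measurable
  have AE_Y: "AE w in M. (\<lambda>i. X (r i) w) \<longlonglongrightarrow> Y w"
    using AE_C unfolding Y_def Cauchy_convergent_iff by eventually_elim (simp add: convergent_LIMSEQ_iff)
  \<comment> \<open>Phrased with \<open>nn_integral\<close>, because integrability of the squared
    difference is not yet known; it is read off from this bound in \<open>diff\<close>.\<close>
  have Fatou: "(\<integral>\<^sup>+ w. ennreal ((X n w - Y w)\<^sup>2) \<partial>M) \<le> ennreal (e\<^sup>2)"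
    if e: "e > 0" and N: "\<forall>i\<ge>N. \<forall>j\<ge>N. l2norm M (\<lambda>w. X i w - X j w) < e" and "n \<ge> N" for n N e
  proof -
    have "(\<integral>\<^sup>+ w. ennreal ((X n w - Y w)\<^sup>2) \<partial>M) = (\<integral>\<^sup>+ w. liminf (\<lambda>i. ennreal ((X n w - X (r i) w)\<^sup>2)) \<partial>M)"
    proof (rule nn_integral_cong_AE)
      show "AE w in M. ennreal ((X n w - Y w)\<^sup>2) = liminf (\<lambda>i. ennreal ((X n w - X (r i) w)\<^sup>2))"
        using AE_Y
      proof eventually_elim
        case (elim w)
        then have "(\<lambda>i. ennreal ((X n w - X (r i) w)\<^sup>2)) \<longlonglongrightarrow> ennreal ((X n w - Y w)\<^sup>2)"
          by (intro tendsto_intros)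
        from lim_imp_Liminf[OF _ this] show ?case
          by simp
      qed
    qed
    also have "\<dots> \<le> liminf (\<lambda>i. \<integral>\<^sup>+ w. ennreal ((X n w - X (r i) w)\<^sup>2) \<partial>M)"
      by (rule nn_integral_liminf) measurable
    also have "\<dots> \<le> limsup (\<lambda>i. \<integral>\<^sup>+ w. ennreal ((X n w - X (r i) w)\<^sup>2) \<partial>M)"
      by (rule Liminf_le_Limsup) simp
    also have "\<dots> \<le> ennreal (e\<^sup>2)"
    proof (rule Limsup_bounded)
      show "\<forall>\<^sub>F i in sequentially. (\<integral>\<^sup>+ w. ennreal ((X n w - X (r i) w)\<^sup>2) \<partial>M) \<le> ennreal (e\<^sup>2)"
        using eventually_ge_at_top[of N]
      proof eventually_elim
        case (elim i)
        then have "r i \<ge> N"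
          using seq_suble[OF r, of i] by linarith
        then have "l2norm M (\<lambda>w. X n w - X (r i) w) < e"
          using N \<open>n \<ge> N\<close> by blast
        then have "expectation (\<lambda>w. (X n w - X (r i) w)\<^sup>2) < e\<^sup>2"
          by (simp add: l2norm_less_iff[OF e])
        moreover have "(\<integral>\<^sup>+ w. ennreal ((X n w - X (r i) w)\<^sup>2) \<partial>M) = ennreal (expectation (\<lambda>w. (X n w - X (r i) w)\<^sup>2))"
          using square_integrableD(2)[OF square_integrable_diff[OF X X]]
          by (intro nn_integral_eq_integral) auto
        ultimately show ?case
          by (simp add: ennreal_leI)
      qed
    qed
    finally show ?thesis .
  qed
  have diff: "square_integrable M (\<lambda>w. X n w - Y w)"
    if "e > 0" and "\<forall>i\<ge>N. \<forall>j\<ge>N. l2norm M (\<lambda>w. X i w - X j w) < e" and "n \<ge> N" for n N e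
  proof -
    have "integrable M (\<lambda>w. (X n w - Y w)\<^sup>2)"
      using Fatou[OF that] by (intro integrableI_bounded) (auto simp: le_less_trans)
    then show ?thesis
      by (auto simp: square_integrable_def)
  qed
  obtain N where "\<forall>i\<ge>N. \<forall>j\<ge>N. l2norm M (\<lambda>w. X i w - X j w) < 1"
    using C[of 1] by auto
  from square_integrable_diff[OF X[of N] diff[OF _ this, of N]] have Y: "square_integrable M Y"
    by simp
  have "(\<lambda>n. l2norm M (\<lambda>w. X n w - Y w)) \<longlonglongrightarrow> 0"
  proof (rule LIMSEQ_I)
    fix e :: real
    assume e: "e > 0"
    \<comment> \<open>Fatou's lemma returns only a weak inequality; \<open>e / 2\<close> restores
      the strict one.\<close>
    obtain N where N: "\<forall>i\<ge>N. \<forall>j\<ge>N. l2norm M (\<lambda>w. X i w - X j w) < e / 2"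
      using C[of "e / 2"] e by auto
    have "l2norm M (\<lambda>w. X n w - Y w) < e" if n: "n \<ge> N" for n
    proof -
      have "ennreal (expectation (\<lambda>w. (X n w - Y w)\<^sup>2)) = (\<integral>\<^sup>+ w. ennreal ((X n w - Y w)\<^sup>2) \<partial>M)"
        using square_integrableD(2)[OF square_integrable_diff[OF X Y]]
        by (intro nn_integral_eq_integral[symmetric]) auto
      also have "\<dots> \<le> ennreal ((e / 2)\<^sup>2)"
        using Fatou[OF _ N n] e by simp
      finally have "expectation (\<lambda>w. (X n w - Y w)\<^sup>2) \<le> (e / 2)\<^sup>2"
        by simp
      also have "\<dots> < e\<^sup>2"
        using e by (intro power_strict_mono) auto
      finally show ?thesis
        by (simp add: l2norm_less_iff[OF e])
    qed
    then show "\<exists>N. \<forall>n\<ge>N. norm (l2norm M (\<lambda>w. X n w - Y w) - 0) < e"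
      by auto
  qed
  with Y show thesis
    by (rule that)
qed

text \<open>The predicate \<open>P d\<close> plays the role of a base of a filter on the index type: it serves both for
  difference quotients with small increment and for tagged divisions with small mesh.\<close>

lemma l2_Cauchy_net_converges:
  fixes P :: "real \<Rightarrow> 'i \<Rightarrow> bool"
  assumes X: "\<And>d i. P d i \<Longrightarrow> square_integrable M (X i)"
    and mono: "\<And>d d' i. d \<le> d' \<Longrightarrow> P d i \<Longrightarrow> P d' i"
    and ne: "\<And>d. d > 0 \<Longrightarrow> \<exists>i. P d i"
    and C: "\<And>e. e > 0 \<Longrightarrow> \<exists>d>0. \<forall>i j. P d i \<longrightarrow> P d j \<longrightarrow> l2norm M (\<lambda>w. X i w - X j w) < e"
  shows "\<exists>Y. square_integrable M Y \<and> (\<forall>e>0. \<exists>d>0. \<forall>i. P d i \<longrightarrow> l2norm M (\<lambda>w. X i w - Y w) < e)"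
proof -
  have "\<exists>i. P (1 / real (Suc n)) i" for n
    by (intro ne) simp
  then obtain s where s: "\<And>n. P (1 / real (Suc n)) (s n)"
    by metis
  have small: "\<exists>N. \<forall>n\<ge>N. P d (s n)" if d: "d > 0" for d
  proof -
    obtain N where N: "1 / real (Suc N) < d"
      using reals_Archimedean[OF d] by (auto simp: inverse_eq_divide)
    have "P d (s n)" if "n \<ge> N" for n
    proof -
      have "1 / real (Suc n) \<le> 1 / real (Suc N)"
        using that by (simp add: frac_le)
      then show ?thesis
        using mono[OF _ s[of n]] N by simp
    qed
    then show ?thesis
      by blast
  qed
  have Xs: "square_integrable M (X (s n))" for n
    using X s by blast
  have "\<exists>N. \<forall>i\<ge>N. \<forall>j\<ge>N. l2norm M (\<lambda>w. X (s i) w - X (s j) w) < e" if e: "e > 0" for e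
  proof -
    obtain d where d: "d > 0" and dC: "\<forall>i j. P d i \<longrightarrow> P d j \<longrightarrow> l2norm M (\<lambda>w. X i w - X j w) < e"
      using C[OF e] by blast
    show ?thesis
      using small[OF d] dC by blast
  qed
  from l2_Cauchy_sequence_converges[of "\<lambda>n. X (s n)", OF Xs this] obtain Y
    where Y: "square_integrable M Y" and lim: "(\<lambda>n. l2norm M (\<lambda>w. X (s n) w - Y w)) \<longlonglongrightarrow> 0"
    by blast
  have "\<exists>d>0. \<forall>i. P d i \<longrightarrow> l2norm M (\<lambda>w. X i w - Y w) < e" if e: "e > 0" for e
  proof -
    obtain d where d: "d > 0" and dC: "\<forall>i j. P d i \<longrightarrow> P d j \<longrightarrow> l2norm M (\<lambda>w. X i w - X j w) < e / 2"
      using C[of "e / 2"] e by auto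
    obtain N1 where N1: "\<forall>n\<ge>N1. P d (s n)"
      using small[OF d] by blast
    obtain N2 where N2: "\<forall>n\<ge>N2. l2norm M (\<lambda>w. X (s n) w - Y w) < e / 2"
      using LIMSEQ_D[OF lim, of "e / 2"] e by auto
    define n where "n = max N1 N2"
    have "l2norm M (\<lambda>w. X i w - Y w) < e" if "P d i" for i
    proof -
      have "l2norm M (\<lambda>w. X i w - X (s n) w) < e / 2" "l2norm M (\<lambda>w. X (s n) w - Y w) < e / 2"
        using dC N1 N2 that by (auto simp: n_def)
      then show ?thesis
        using l2norm_triangle_diff[OF X[OF that] Xs[of n] Y] by linarith
    qed
    then show ?thesis
      using d by blast
  qed
  with Y show ?thesis
    by blast
qed

end

section \<open>Normal random variables and their mean-square limits\<close>

text \<open>The characteristic function of the normal law with mean \<open>m\<close> and variance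
  \<open>v\<close> (not standard deviation). For \<open>v = 0\<close> it is that of the point mass
  at \<open>m\<close>, so degenerate laws fit the same formula.\<close>

definition normal_char :: "real \<Rightarrow> real \<Rightarrow> real \<Rightarrow> complex" where
  "normal_char m v a = iexp (a * m) * complex_of_real (exp (- (v * a\<^sup>2) / 2))"

context prob_space
begin

lemma normal_rv_moments:
  assumes "normal_rv M X m v"
  shows "0 \<le> v" "square_integrable M X" "expectation X = m" "variance X = v"
proof -
  have [measurable]: "X \<in> borel_measurable M"
    using assms by (simp add: normal_rv_def)
  have "0 \<le> v \<and> square_integrable M X \<and> expectation X = m \<and> variance X = v"
  proof (cases "v = 0")
    case True
    with assms have AE: "AE w in M. X w = m"
      by (simp add: normal_rv_def)
    have "integrable M (\<lambda>w. (X w)\<^sup>2) \<longleftrightarrow> integrable M (\<lambda>_. m\<^sup>2)"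
      by (rule integrable_cong_AE) (use AE in auto)
    then have 1: "square_integrable M X"
      by (simp add: square_integrable_def)
    have "expectation X = expectation (\<lambda>_. m)"
      by (rule integral_cong_AE) (use AE in auto)
    then have 2: "expectation X = m"
      by (simp add: prob_space)
    have "variance X = expectation (\<lambda>_. 0)"
      by (rule integral_cong_AE) (use AE in \<open>auto simp: 2\<close>)
    with 1 2 True show ?thesis
      by simp
  next
    case False
    with assms have v: "0 < v" and D: "distributed M lborel X (\<lambda>x. ennreal (normal_density m (sqrt v) x))"
      by (auto simp: normal_rv_def)
    then have s: "0 < sqrt v"
      by simp
    have "integrable M (\<lambda>w. (X w - m)\<^sup>2)"
      using distributed_integrable[OF D, of "\<lambda>x. (x - m)\<^sup>2"] integrable_normal_moment[OF s, of m 2] by simp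
    then have "square_integrable M (\<lambda>w. (X w - m) + m)"
      by (intro square_integrable_add square_integrable_const) (simp add: square_integrable_def)
    then show ?thesis
      using v normal_distributed_expectation[OF s D] normal_distributed_variance[OF s D] by simp
  qed
  then show "0 \<le> v" "square_integrable M X" "expectation X = m" "variance X = v"
    by auto
qed

lemma normal_rv_char:
  assumes "normal_rv M X m v"
  shows "char (distr M borel X) a = normal_char m v a"
proof -
  have [measurable]: "X \<in> borel_measurable M"
    using assms by (simp add: normal_rv_def)
  show ?thesis
  proof (cases "v = 0")
    case True
    with assms have AE: "AE w in M. X w = m"
      by (simp add: normal_rv_def)
    have "char (distr M borel X) a = (CLINT w|M. iexp (a * X w))"
      by (simp add: char_def integral_distr)
    also have "\<dots> = (CLINT w|M. iexp (a * m))"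
      by (rule integral_cong_AE) (use AE in auto)
    finally show ?thesis
      using True by (simp add: normal_char_def prob_space)
  next
    case False
    with assms have v: "0 < v" and D: "distributed M lborel X (\<lambda>x. ennreal (normal_density m (sqrt v) x))"
      by (auto simp: normal_rv_def)
    then have s: "0 < sqrt v"
      by simp
    define U where "U = (\<lambda>w. (X w - m) / sqrt v)"
    have [measurable]: "U \<in> borel_measurable M"
      unfolding U_def by measurable
    have X: "X w = m + sqrt v * U w" for w
      using s by (simp add: U_def)
    have "distributed M lborel U (\<lambda>x. ennreal (std_normal_density x))"
      using D normal_standard_normal_convert[OF s, of X m] by (simp add: U_def)
    then have "distr M lborel U = std_normal_distribution"
      by (simp add: distributed_def)
    moreover have "distr M lborel U = distr M borel U"
      by (rule distr_cong) auto
    ultimately have U: "char (distr M borel U) b = complex_of_real (exp (- b\<^sup>2 / 2))" for b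
      using char_std_normal_distribution by metis
    have "char (distr M borel X) a = (CLINT w|M. iexp (a * m) * iexp ((a * sqrt v) * U w))"
      by (simp add: char_def integral_distr X exp_add[symmetric] algebra_simps)
    also have "\<dots> = iexp (a * m) * char (distr M borel U) (a * sqrt v)"
      by (simp add: char_def integral_distr)
    finally show ?thesis
      using v by (simp add: U normal_char_def power_mult_distrib mult.commute)
  qed
qed

text \<open>By Levy uniqueness it is enough to exhibit one law with this characteristic function:
  the point mass for \<open>v = 0\<close>, the density measure for \<open>v > 0\<close>. In both
  models the identity map is a \<open>normal_rv\<close>, so the previous lemma computes its
  characteristic function.\<close>

lemma normal_rv_if_char:
  assumes [measurable]: "X \<in> borel_measurable M" and v: "0 \<le> v"
    and char: "\<And>a. char (distr M borel X) a = normal_char m v a"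
  shows "normal_rv M X m v"
proof (cases "v = 0")
  case True
  interpret R: prob_space "return borel m"
    by (rule prob_space_return) simp
  have "normal_rv (return borel m) (\<lambda>x. x) m 0"
    by (simp add: normal_rv_def AE_return)
  from R.normal_rv_char[OF this] have "char (return borel m) = char (distr M borel X)"
    using char True by (simp add: distr_return fun_eq_iff)
  then have eq: "distr M borel X = return borel m"
    by (intro Levy_uniqueness real_distribution_distr) (auto intro!: real_distribution.intro R.prob_space_axioms simp: real_distribution_axioms_def)
  have "AE x in distr M borel X. x = m"
    unfolding eq by (simp add: AE_return)
  then have "AE w in M. X w = m"
    by (simp add: AE_distr_iff)
  with True show ?thesis
    by (simp add: normal_rv_def)
next
  case False
  with v have v: "0 < v" "0 < sqrt v"
    by simp_all
  define D where "D = density lborel (\<lambda>x. ennreal (normal_density m (sqrt v) x))"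
  interpret D: prob_space D
    unfolding D_def by (rule prob_space_normal_density) (rule v)
  have lborelD: "distr D lborel (\<lambda>x. x) = D"
    unfolding D_def by (rule distr_id2) simp
  have borelD: "distr D borel (\<lambda>x. x) = D"
    unfolding D_def by (rule distr_id2) simp
  have "distributed D lborel (\<lambda>x. x) (\<lambda>x. ennreal (normal_density m (sqrt v) x))"
    unfolding distributed_def lborelD by (auto simp: D_def)
  then have "normal_rv D (\<lambda>x. x) m v"
    using v by (auto simp: normal_rv_def D_def)
  have "real_distribution D"
    by (intro real_distribution.intro D.prob_space_axioms) (simp add: real_distribution_axioms_def D_def)
  from D.normal_rv_char[OF \<open>normal_rv D (\<lambda>x. x) m v\<close>] have "char D = char (distr M borel X)"
    using char by (simp add: borelD fun_eq_iff)
  then have eq: "distr M borel X = D"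
    using \<open>real_distribution D\<close> by (intro Levy_uniqueness real_distribution_distr) auto
  have "distr M lborel X = distr M borel X"
    by (rule distr_cong) auto
  then have "distributed M lborel X (\<lambda>x. ennreal (normal_density m (sqrt v) x))"
    unfolding distributed_def using eq by (auto simp: D_def)
  with v show ?thesis
    by (simp add: normal_rv_def)
qed

text \<open>The map \<open>iexp\<close> is 1-Lipschitz on the reals, and on a probability space the
  first absolute moment is at most the L2 norm.\<close>

lemma char_diff_le_l2norm:
  assumes "square_integrable M X" "square_integrable M Y"
  shows "cmod (char (distr M borel X) a - char (distr M borel Y) a) \<le> \<bar>a\<bar> * l2norm M (\<lambda>w. X w - Y w)"
proof -
  note [measurable] = assms[THEN square_integrableD(1)]
  have int: "integrable M (\<lambda>w. iexp (a * X w))" if "X \<in> borel_measurable M" for X :: "'a \<Rightarrow> real"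
    using that by (intro integrable_const_bound[where B = 1]) auto
  have lip: "cmod (iexp x - iexp y) \<le> \<bar>x - y\<bar>" for x y :: real
  proof -
    have "iexp x - iexp y = iexp y * (iexp (x - y) - 1)"
      by (simp add: algebra_simps exp_add[symmetric])
    then have "cmod (iexp x - iexp y) = cmod (iexp (x - y) - 1)"
      by (simp add: norm_mult)
    then show ?thesis
      using iexp_approx1[of "x - y" 0] by simp
  qed
  have "cmod (char (distr M borel X) a - char (distr M borel Y) a)
      = cmod (CLINT w|M. iexp (a * X w) - iexp (a * Y w))"
    unfolding Bochner_Integration.integral_diff[OF int[OF assms(1)[THEN square_integrableD(1)]] int[OF assms(2)[THEN square_integrableD(1)]]]
    by (simp add: char_def integral_distr)
  also have "\<dots> \<le> (LINT w|M. cmod (iexp (a * X w) - iexp (a * Y w)))"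
    by (rule integral_norm_bound)
  also have "\<dots> \<le> (LINT w|M. \<bar>a\<bar> * \<bar>X w - Y w\<bar>)"
  proof (rule integral_mono)
    show "integrable M (\<lambda>w. cmod (iexp (a * X w) - iexp (a * Y w)))"
      by (intro integrable_norm Bochner_Integration.integrable_diff int) measurable
    show "integrable M (\<lambda>w. \<bar>a\<bar> * \<bar>X w - Y w\<bar>)"
      by (intro integrable_mult_right integrable_abs square_integrable_integrable square_integrable_diff assms)
    show "cmod (iexp (a * X w) - iexp (a * Y w)) \<le> \<bar>a\<bar> * \<bar>X w - Y w\<bar>" for w
      using lip[of "a * X w" "a * Y w"] by (simp add: abs_mult[symmetric] algebra_simps)
  qed
  also have "\<dots> = \<bar>a\<bar> * (LINT w|M. \<bar>X w - Y w\<bar>)"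
    by simp
  also have "\<dots> \<le> \<bar>a\<bar> * l2norm M (\<lambda>w. X w - Y w)"
    by (intro mult_left_mono expectation_le_l2norm square_integrable_diff assms) simp
  finally show ?thesis .
qed

text \<open>Means and second moments are continuous under L2 convergence, hence so are the two
  parameters of the approximating normal laws. Their characteristic functions then converge both to
  that of Z and to \<open>normal_char\<close> with the limiting parameters.\<close>

lemma normal_rv_l2_limit:
  assumes Z: "square_integrable M Z"
    and approx: "\<And>e. e > 0 \<Longrightarrow> \<exists>W m v. normal_rv M W m v \<and> l2norm M (\<lambda>w. Z w - W w) < e"
  shows "normal_rv M Z (expectation Z) (variance Z)"
proof -
  have "\<exists>W m v. normal_rv M W m v \<and> l2norm M (\<lambda>w. Z w - W w) < 1 / real (Suc n)" for n
    by (rule approx) simp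
  then obtain W m v where N: "\<And>n. normal_rv M (W n) (m n) (v n)"
    and lt: "\<And>n. l2norm M (\<lambda>w. Z w - W n w) < 1 / real (Suc n)"
    by metis
  have W: "square_integrable M (W n)" for n
    using normal_rv_moments(2)[OF N] .
  have lim: "(\<lambda>n. l2norm M (\<lambda>w. Z w - W n w)) \<longlonglongrightarrow> 0"
  proof (rule Lim_null_comparison)
    show "\<forall>\<^sub>F n in sequentially. norm (l2norm M (\<lambda>w. Z w - W n w)) \<le> 1 / real (Suc n)"
      using less_imp_le[OF lt] by (intro always_eventually) simp
    show "(\<lambda>n. 1 / real (Suc n)) \<longlonglongrightarrow> 0"
      by (rule LIMSEQ_Suc[OF lim_1_over_n])
  qed
  have "(\<lambda>n. m n - expectation Z) \<longlonglongrightarrow> 0"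
  proof (rule Lim_null_comparison[OF _ lim], rule always_eventually, rule allI)
    fix n
    have "m n - expectation Z = expectation (\<lambda>w. W n w - Z w)"
      using normal_rv_moments(3)[OF N] square_integrable_integrable[OF Z] square_integrable_integrable[OF W]
      by simp
    then show "norm (m n - expectation Z) \<le> l2norm M (\<lambda>w. Z w - W n w)"
      using abs_expectation_le_l2norm[OF square_integrable_diff[OF W Z]] l2norm_minus_commute[of M Z]
      by simp
  qed
  then have m: "m \<longlonglongrightarrow> expectation Z"
    by (simp add: LIM_zero_iff)
  have "(\<lambda>n. l2norm M (W n) - l2norm M Z) \<longlonglongrightarrow> 0"
    using l2norm_diff_ineq[OF Z W] by (intro Lim_null_comparison[OF _ lim]) (auto intro!: always_eventually simp: abs_minus_commute)
  then have "(\<lambda>n. l2norm M (W n)) \<longlonglongrightarrow> l2norm M Z"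
    by (simp add: LIM_zero_iff)
  then have sq: "(\<lambda>n. expectation (\<lambda>w. (W n w)\<^sup>2)) \<longlonglongrightarrow> expectation (\<lambda>w. (Z w)\<^sup>2)"
    unfolding l2norm_power2[symmetric] by (rule tendsto_power)
  have var: "variance X = expectation (\<lambda>w. (X w)\<^sup>2) - (expectation X)\<^sup>2" if "square_integrable M X" for X
    using that by (intro variance_eq square_integrable_integrable square_integrableD)
  have v: "v \<longlonglongrightarrow> variance Z"
  proof -
    have "v n = expectation (\<lambda>w. (W n w)\<^sup>2) - (m n)\<^sup>2" for n
      using normal_rv_moments(3,4)[OF N, of n] var[OF W, of n] by simp
    then have "v = (\<lambda>n. expectation (\<lambda>w. (W n w)\<^sup>2) - (m n)\<^sup>2)"
      by blast
    then show ?thesis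
      unfolding var[OF Z] using sq m by (auto intro!: tendsto_intros)
  qed
  show ?thesis
  proof (rule normal_rv_if_char)
    fix a
    have "(\<lambda>n. char (distr M borel (W n)) a - char (distr M borel Z) a) \<longlonglongrightarrow> 0"
    proof (rule Lim_null_comparison)
      show "\<forall>\<^sub>F n in sequentially. norm (char (distr M borel (W n)) a - char (distr M borel Z) a)
          \<le> \<bar>a\<bar> * l2norm M (\<lambda>w. Z w - W n w)"
        using char_diff_le_l2norm[OF Z W] by (intro always_eventually) (simp add: norm_minus_commute)
      show "(\<lambda>n. \<bar>a\<bar> * l2norm M (\<lambda>w. Z w - W n w)) \<longlonglongrightarrow> 0"
        using lim by (rule tendsto_mult_right_zero)
    qed
    then have "(\<lambda>n. char (distr M borel (W n)) a) \<longlonglongrightarrow> char (distr M borel Z) a"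
      by (simp add: LIM_zero_iff)
    moreover have "(\<lambda>n. char (distr M borel (W n)) a) \<longlonglongrightarrow> normal_char (expectation Z) (variance Z) a"
      unfolding normal_rv_char[OF N] unfolding normal_char_def
      by (intro tendsto_intros m v) auto
    ultimately show "char (distr M borel Z) a = normal_char (expectation Z) (variance Z) a"
      by (rule LIMSEQ_unique)
  qed (use square_integrableD(1)[OF Z] in auto)
qed

lemma normal_rv_add_indep:
  assumes ind: "indep_var borel X borel Y" and X: "normal_rv M X m v" and Y: "normal_rv M Y m' v'"
  shows "normal_rv M (\<lambda>w. X w + Y w) (m + m') (v + v')"
proof (rule normal_rv_if_char)
  show "(\<lambda>w. X w + Y w) \<in> borel_measurable M"
    using X Y by (auto simp: normal_rv_def)
  show "0 \<le> v + v'"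
    using normal_rv_moments(1)[OF X] normal_rv_moments(1)[OF Y] by simp
  fix a
  have "exp (- ((v + v') * a\<^sup>2) / 2) = exp (- (v * a\<^sup>2) / 2) * exp (- (v' * a\<^sup>2) / 2)"
    unfolding exp_add[symmetric] by (simp add: field_simps)
  moreover have "iexp (a * (m + m')) = iexp (a * m) * iexp (a * m')"
    unfolding exp_add[symmetric] by (simp add: field_simps)
  ultimately show "char (distr M borel (\<lambda>w. X w + Y w)) a = normal_char (m + m') (v + v') a"
    unfolding char_distr_add[OF ind] normal_rv_char[OF X] normal_rv_char[OF Y] normal_char_def
    by (simp only: of_real_mult mult_ac)
qed

text \<open>The approximants \<open>W\<close> must be square integrable: otherwise the integral in
  \<open>l2norm\<close> could be the default 0 and a function far from Z would count as close. As
  \<open>l2norm\<close> is a seminorm, almost sure modifications of a limit belong to the closure as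
  well.\<close>

definition l2_closure :: "('a \<Rightarrow> real) set \<Rightarrow> ('a \<Rightarrow> real) set" where
  "l2_closure V = {Z. square_integrable M Z \<and> (\<forall>e>0. \<exists>W\<in>V. square_integrable M W \<and> l2norm M (\<lambda>w. Z w - W w) < e)}"

lemma l2_closureI:
  assumes "square_integrable M Z"
    and "\<And>e. e > 0 \<Longrightarrow> \<exists>W\<in>V. square_integrable M W \<and> l2norm M (\<lambda>w. Z w - W w) < e"
  shows "Z \<in> l2_closure V"
  using assms by (simp add: l2_closure_def)

lemma l2_closureD:
  assumes "Z \<in> l2_closure V"
  shows "square_integrable M Z"
    and "e > 0 \<Longrightarrow> \<exists>W\<in>V. square_integrable M W \<and> l2norm M (\<lambda>w. Z w - W w) < e"
  using assms by (auto simp: l2_closure_def)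

lemma l2_closure_subset:
  assumes "Z \<in> V" "square_integrable M Z"
  shows "Z \<in> l2_closure V"
  using assms by (intro l2_closureI) (auto simp: l2norm_def intro!: bexI[of _ Z])

lemma l2_closure_closed:
  assumes "Z \<in> l2_closure (l2_closure V)"
  shows "Z \<in> l2_closure V"
proof (rule l2_closureI)
  show Z: "square_integrable M Z"
    using assms by (rule l2_closureD)
  fix e :: real
  assume "e > 0"
  then have e: "e / 2 > 0"
    by simp
  obtain W where W: "W \<in> l2_closure V" "l2norm M (\<lambda>w. Z w - W w) < e / 2"
    using l2_closureD(2)[OF assms e] by blast
  obtain U where U: "U \<in> V" "square_integrable M U" "l2norm M (\<lambda>w. W w - U w) < e / 2"
    using l2_closureD(2)[OF W(1) e] by blast
  have "l2norm M (\<lambda>w. Z w - U w) < e"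
    using l2norm_triangle_diff[OF Z l2_closureD(1)[OF W(1)] U(2)] W(2) U(3) by linarith
  with U show "\<exists>W\<in>V. square_integrable M W \<and> l2norm M (\<lambda>w. Z w - W w) < e"
    by blast
qed

lemma l2_closure_scale:
  assumes V: "\<And>W c. W \<in> V \<Longrightarrow> (\<lambda>w. c * W w) \<in> V" and Z: "Z \<in> l2_closure V"
  shows "(\<lambda>w. c * Z w) \<in> l2_closure V"
proof (rule l2_closureI)
  show "square_integrable M (\<lambda>w. c * Z w)"
    by (intro square_integrable_scale l2_closureD(1)[OF Z])
  fix e :: real
  assume "e > 0"
  \<comment> \<open>The added 1 avoids a case distinction for \<open>c = 0\<close>.\<close>
  then have "e / (\<bar>c\<bar> + 1) > 0"
    by simp
  from l2_closureD(2)[OF Z this] obtain W where W: "W \<in> V" "square_integrable M W"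
    "l2norm M (\<lambda>w. Z w - W w) < e / (\<bar>c\<bar> + 1)"
    by blast
  have "l2norm M (\<lambda>w. c * Z w - c * W w) = \<bar>c\<bar> * l2norm M (\<lambda>w. Z w - W w)"
    by (simp add: l2norm_scale[symmetric] algebra_simps)
  also have "\<dots> \<le> (\<bar>c\<bar> + 1) * l2norm M (\<lambda>w. Z w - W w)"
    by (rule mult_right_mono) auto
  also have "\<dots> < e"
    using W(3) by (simp add: pos_less_divide_eq mult.commute)
  finally show "\<exists>W\<in>V. square_integrable M W \<and> l2norm M (\<lambda>w. c * Z w - W w) < e"
    using V[OF W(1)] square_integrable_scale[OF W(2)] by blast
qed

lemma l2_closure_add:
  assumes V: "\<And>U W. U \<in> V \<Longrightarrow> W \<in> V \<Longrightarrow> (\<lambda>w. U w + W w) \<in> V"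
    and Y: "Y \<in> l2_closure V" and Z: "Z \<in> l2_closure V"
  shows "(\<lambda>w. Y w + Z w) \<in> l2_closure V"
proof (rule l2_closureI)
  show "square_integrable M (\<lambda>w. Y w + Z w)"
    by (intro square_integrable_add l2_closureD(1)[OF Y] l2_closureD(1)[OF Z])
  fix e :: real
  assume "e > 0"
  then have e: "e / 2 > 0"
    by simp
  obtain U where U: "U \<in> V" "square_integrable M U" "l2norm M (\<lambda>w. Y w - U w) < e / 2"
    using l2_closureD(2)[OF Y e] by blast
  obtain W where W: "W \<in> V" "square_integrable M W" "l2norm M (\<lambda>w. Z w - W w) < e / 2"
    using l2_closureD(2)[OF Z e] by blast
  have "(\<lambda>w. Y w + Z w - (U w + W w)) = (\<lambda>w. (Y w - U w) + (Z w - W w))"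
    by (simp add: algebra_simps)
  then have "l2norm M (\<lambda>w. Y w + Z w - (U w + W w)) < e"
    using l2norm_triangle[OF square_integrable_diff[OF l2_closureD(1)[OF Y] U(2)]
        square_integrable_diff[OF l2_closureD(1)[OF Z] W(2)]] U(3) W(3) by simp
  then show "\<exists>W\<in>V. square_integrable M W \<and> l2norm M (\<lambda>w. Y w + Z w - W w) < e"
    using V[OF U(1) W(1)] square_integrable_add[OF U(2) W(2)] by blast
qed

lemma l2_closure_normal:
  assumes "\<And>W. W \<in> V \<Longrightarrow> \<exists>m v. normal_rv M W m v" and Z: "Z \<in> l2_closure V"
  shows "normal_rv M Z (expectation Z) (variance Z)"
  using assms(1) l2_closureD[OF Z] by (intro normal_rv_l2_limit) blast+

end

section \<open>Characteristic functions determine finite-dimensional laws\<close>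

text \<open>The shift is 2 and not 1 so that the total mass \<open>2 + expectation U\<close> is at
  least 1 as well: with 1 it would be 0 for U = -1, and no normalisation would be possible.
  Characteristic function and measure of the normalised law are then affine expressions in the
  unweighted and the weighted expectations.\<close>

lemma (in prob_space) weighted_distribution:
  fixes X U :: "'a \<Rightarrow> real"
  assumes [measurable]: "X \<in> borel_measurable M" "U \<in> borel_measurable M"
    and U: "\<And>w. \<bar>U w\<bar> \<le> 1"
  defines "D \<equiv> distr (density M (\<lambda>w. ennreal ((2 + U w) / (2 + expectation U)))) borel X"
  shows "real_distribution D"
    and "char D b = (2 * (CLINT w|M. iexp (b * X w)) + (CLINT w|M. U w * iexp (b * X w)))
          / complex_of_real (2 + expectation U)"
    and "B \<in> sets borel \<Longrightarrow> measure D B =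
          (2 * expectation (\<lambda>w. indicator B (X w)) + expectation (\<lambda>w. U w * indicator B (X w))) / (2 + expectation U)"
    and "1 \<le> 2 + expectation U"
proof -
  have intU: "integrable M U"
    using U by (intro integrable_const_bound[where B = 1]) auto
  define c where "c = 2 + expectation U"
  define g where "g = (\<lambda>w. (2 + U w) / c)"
  have g_meas [measurable]: "g \<in> borel_measurable M"
    unfolding g_def by measurable
  have "\<bar>expectation U\<bar> \<le> expectation (\<lambda>w. \<bar>U w\<bar>)"
    by (rule integral_abs_bound)
  also have "\<dots> \<le> 1"
    using integral_mono[of M "\<lambda>w. \<bar>U w\<bar>" "\<lambda>_. 1"] U intU by (simp add: prob_space)
  finally show c1: "1 \<le> 2 + expectation U"
    by simp
  then have c: "1 \<le> c"
    by (simp add: c_def)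
  have pos: "0 \<le> 2 + U w" for w
    using U[of w] by linarith
  have g0: "0 \<le> g w" for w
    using pos[of w] c by (simp add: g_def)
  define E where "E = density M (\<lambda>w. ennreal (g w))"
  have intg: "integrable M g"
    unfolding g_def by (intro integrable_divide Bochner_Integration.integrable_add intU) simp
  have "expectation g = 1"
    using intU c by (simp add: g_def c_def prob_space)
  then have "(\<integral>\<^sup>+w. ennreal (g w) \<partial>M) = 1"
    using intg g0 by (simp add: nn_integral_eq_integral)
  then interpret E: prob_space E
    unfolding E_def by (intro prob_spaceI) (simp add: emeasure_density cong: nn_integral_cong)
  have D: "D = distr E borel X"
    by (simp add: D_def E_def g_def c_def)
  have [measurable]: "X \<in> borel_measurable E"
    by (simp add: E_def)
  show "real_distribution D"
    unfolding D by (rule E.real_distribution_distr) measurable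
  have int1: "integrable M (\<lambda>w. iexp (b * X w))"
    by (intro integrable_const_bound[where B = 1]) auto
  have int2: "integrable M (\<lambda>w. U w * iexp (b * X w))"
    using U by (intro integrable_const_bound[where B = 1]) (auto simp: norm_mult)
  have "char D b = (CLINT w|E. iexp (b * X w))"
    by (simp add: D char_def integral_distr)
  also have "\<dots> = (CLINT w|M. g w *\<^sub>R iexp (b * X w))"
    unfolding E_def by (subst integral_density) (auto simp: g0)
  also have "\<dots> = (CLINT w|M. (2 * iexp (b * X w) + U w * iexp (b * X w)) / complex_of_real c)"
    by (intro Bochner_Integration.integral_cong) (auto simp: g_def scaleR_conv_of_real field_simps)
  also have "\<dots> = (CLINT w|M. 2 * iexp (b * X w) + U w * iexp (b * X w)) / complex_of_real c"
    by simp
  also have "(CLINT w|M. 2 * iexp (b * X w) + U w * iexp (b * X w))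
      = 2 * (CLINT w|M. iexp (b * X w)) + (CLINT w|M. U w * iexp (b * X w))"
    unfolding Bochner_Integration.integral_add[OF integrable_mult_right[OF int1] int2] by simp
  finally show "char D b = (2 * (CLINT w|M. iexp (b * X w)) + (CLINT w|M. U w * iexp (b * X w)))
      / complex_of_real (2 + expectation U)"
    by (simp add: c_def)
  assume [measurable]: "B \<in> sets borel"
  have int3: "integrable M (\<lambda>w. indicator B (X w) :: real)"
    by (intro integrable_const_bound[where B = 1]) (auto simp: indicator_def)
  have int4: "integrable M (\<lambda>w. U w * indicator B (X w))"
    using U by (intro integrable_const_bound[where B = 1]) (auto simp: indicator_def)
  have "measure D B = measure D (B \<inter> space D)"
    by (simp add: D)
  also have "\<dots> = (LINT x|D. indicator B x)"
    by simp
  also have "\<dots> = (LINT w|E. indicator B (X w))"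
    unfolding D by (rule integral_distr) measurable
  also have "\<dots> = (LINT w|M. g w *\<^sub>R indicator B (X w))"
    unfolding E_def by (subst integral_density) (auto simp: g0)
  also have "\<dots> = (LINT w|M. (2 * indicator B (X w) + U w * indicator B (X w)) / c)"
    by (intro Bochner_Integration.integral_cong) (auto simp: g_def field_simps)
  also have "\<dots> = (LINT w|M. 2 * indicator B (X w) + U w * indicator B (X w)) / c"
    by simp
  also have "(LINT w|M. 2 * indicator B (X w) + U w * indicator B (X w))
      = 2 * expectation (\<lambda>w. indicator B (X w)) + expectation (\<lambda>w. U w * indicator B (X w))"
    unfolding Bochner_Integration.integral_add[OF integrable_mult_right[OF int3] int4] by simp
  finally show "measure D B = (2 * expectation (\<lambda>w. indicator B (X w)) + expectation (\<lambda>w. U w * indicator B (X w))) / (2 + expectation U)"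
    by (simp add: c_def)
qed

text \<open>Adding the constant \<open>2\<close> turns the signed weights into positive densities, so that Levy's
  uniqueness theorem for probability measures applies.\<close>

lemma weighted_char_uniqueness:
  fixes X U :: "'a \<Rightarrow> real" and Y V :: "'b \<Rightarrow> real"
  assumes M: "prob_space M" and N: "prob_space N"
    and X: "X \<in> borel_measurable M" "U \<in> borel_measurable M" "\<And>w. \<bar>U w\<bar> \<le> 1"
    and Y: "Y \<in> borel_measurable N" "V \<in> borel_measurable N" "\<And>w. \<bar>V w\<bar> \<le> 1"
    and char: "\<And>b. (CLINT w|M. iexp (b * X w)) = (CLINT w|N. iexp (b * Y w))"
    and wchar: "\<And>b. (CLINT w|M. U w * iexp (b * X w)) = (CLINT w|N. V w * iexp (b * Y w))"
    and B: "B \<in> sets borel"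
  shows "(LINT w|M. U w * indicator B (X w)) = (LINT w|N. V w * indicator B (Y w))"
proof -
  interpret M: prob_space M by (rule M)
  interpret N: prob_space N by (rule N)
  \<comment> \<open>At \<open>b = 0\<close> the weighted transforms are the expectations of the
    weights, so the two normalising constants agree.\<close>
  have c: "M.expectation U = N.expectation V"
    using wchar[of 0] by simp
  note MD = M.weighted_distribution[OF X]
  note ND = N.weighted_distribution[OF Y]
  have wgt: "2 * (LINT w|M. indicator B (X w)) + (LINT w|M. U w * indicator B (X w))
      = 2 * (LINT w|N. indicator B (Y w)) + (LINT w|N. V w * indicator B (Y w))"
  proof -
    have "distr (density M (\<lambda>w. ennreal ((2 + U w) / (2 + M.expectation U)))) borel X
        = distr (density N (\<lambda>w. ennreal ((2 + V w) / (2 + N.expectation V)))) borel Y"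
      using MD(1) ND(1) by (rule Levy_uniqueness, intro ext) (unfold MD(2) ND(2), simp only: char wchar c)
    from arg_cong[OF this, of "\<lambda>D. measure D B"] show ?thesis
      unfolding MD(3)[OF B] ND(3)[OF B] using MD(4) by (simp add: c)
  qed
  have [measurable]: "X \<in> borel_measurable M" "Y \<in> borel_measurable N" "B \<in> sets borel"
    using X Y B by auto
  \<comment> \<open>The unweighted laws agree too, which lets the contribution of the shift by 2
    cancel in \<open>wgt\<close>.\<close>
  have "distr M borel X = distr N borel Y"
    by (rule Levy_uniqueness) (auto intro!: M.real_distribution_distr N.real_distribution_distr
        simp: char_def integral_distr fun_eq_iff char[simplified])
  then have "(LINT x|distr M borel X. indicator B x :: real) = (LINT x|distr N borel Y. indicator B x)"
    by simp
  then have "(LINT w|M. indicator B (X w) :: real) = (LINT w|N. indicator B (Y w))"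
    by (simp only: integral_distr[OF _ borel_measurable_indicator] X Y B)
  with wgt show ?thesis
    by simp
qed

lemma (in prob_space) integrable_bounded_mult_iexp:
  fixes X W :: "'a \<Rightarrow> real"
  assumes "W \<in> borel_measurable M" "\<And>w. \<bar>W w\<bar> \<le> 1" "X \<in> borel_measurable M"
  shows "integrable M (\<lambda>w. W w * iexp (X w))"
  using assms by (intro integrable_const_bound[where B = 1]) (auto simp: norm_mult)

text \<open>Euler's formulas. A bounded real weight \<open>cos\<close> or \<open>sin\<close> of
  \<open>\<theta>\<close> can be tested against \<open>iexp (X w)\<close> once the transforms with
  \<open>\<theta>\<close> added and subtracted are known.\<close>

lemma (in prob_space) integral_cos_sin_weight:
  fixes X W \<theta> :: "'a \<Rightarrow> real"
  assumes [measurable]: "W \<in> borel_measurable M" "X \<in> borel_measurable M" "\<theta> \<in> borel_measurable M"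
    and W: "\<And>w. \<bar>W w\<bar> \<le> 1"
  defines "F \<equiv> \<lambda>s. CLINT w|M. W w * iexp (X w + s * \<theta> w)"
  shows "(CLINT w|M. (W w * cos (\<theta> w)) * iexp (X w)) = (F 1 + F (-1)) / 2"
    and "(CLINT w|M. (W w * sin (\<theta> w)) * iexp (X w)) = (F 1 - F (-1)) / (2 * \<i>)"
proof -
  have int: "integrable M (\<lambda>w. W w * iexp (X w + s * \<theta> w))" for s
    by (intro integrable_bounded_mult_iexp W) measurable
  have euler: "iexp t = cos t + \<i> * sin t" for t :: real
    by (simp add: cis_conv_exp[symmetric] complex_eq_iff)
  have "iexp (X w + s * \<theta> w) = iexp (X w) * iexp (s * \<theta> w)" for w s
    by (simp add: exp_add[symmetric] algebra_simps)
  then have split: "iexp (X w + 1 * \<theta> w) = iexp (X w) * (cos (\<theta> w) + \<i> * sin (\<theta> w))"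
    "iexp (X w + -1 * \<theta> w) = iexp (X w) * (cos (\<theta> w) - \<i> * sin (\<theta> w))" for w
    by (simp_all only: euler) simp_all
  have "(CLINT w|M. (W w * cos (\<theta> w)) * iexp (X w))
      = (CLINT w|M. (W w * iexp (X w + 1 * \<theta> w) + W w * iexp (X w + -1 * \<theta> w)) / 2)"
    unfolding split by (intro Bochner_Integration.integral_cong refl) (simp add: algebra_simps)
  also have "\<dots> = (F 1 + F (-1)) / 2"
    unfolding F_def using Bochner_Integration.integral_add[OF int[of 1] int[of "-1"]] by simp
  finally show "(CLINT w|M. (W w * cos (\<theta> w)) * iexp (X w)) = (F 1 + F (-1)) / 2" .
  have "(CLINT w|M. (W w * sin (\<theta> w)) * iexp (X w))
      = (CLINT w|M. (W w * iexp (X w + 1 * \<theta> w) - W w * iexp (X w + -1 * \<theta> w)) / (2 * \<i>))"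
    unfolding split by (intro Bochner_Integration.integral_cong refl) (simp add: field_simps)
  also have "\<dots> = (F 1 - F (-1)) / (2 * \<i>)"
    unfolding F_def using Bochner_Integration.integral_diff[OF int[of 1] int[of "-1"]] by simp
  finally show "(CLINT w|M. (W w * sin (\<theta> w)) * iexp (X w)) = (F 1 - F (-1)) / (2 * \<i>)" .
qed

text \<open>Converse direction of Euler's formulas: the results for the two real weights reassemble
  to one for the exponential.\<close>

lemma (in prob_space) integral_weight_indicator_iexp:
  fixes X W \<theta> :: "'a \<Rightarrow> real"
  assumes [measurable]: "W \<in> borel_measurable M" "X \<in> borel_measurable M" "\<theta> \<in> borel_measurable M" "B \<in> sets borel"
    and W: "\<And>w. \<bar>W w\<bar> \<le> 1"
  shows "(CLINT w|M. (W w * indicator B (X w)) * iexp (\<theta> w))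
      = complex_of_real (LINT w|M. (W w * cos (\<theta> w)) * indicator B (X w))
        + \<i> * complex_of_real (LINT w|M. (W w * sin (\<theta> w)) * indicator B (X w))"
proof -
  have le: "\<bar>W w * y * indicator B (X w)\<bar> \<le> 1" if "\<bar>y\<bar> \<le> 1" for y w
    using mult_mono[OF W[of w] that] by (auto simp: abs_mult indicator_def)
  have i1: "integrable M (\<lambda>w. (W w * cos (\<theta> w)) * indicator B (X w))"
    by (intro integrable_const_bound[where B = 1]) (auto intro!: le)
  have i2: "integrable M (\<lambda>w. (W w * sin (\<theta> w)) * indicator B (X w))"
    by (intro integrable_const_bound[where B = 1]) (auto intro!: le)
  have "(CLINT w|M. (W w * indicator B (X w)) * iexp (\<theta> w))
      = (CLINT w|M. complex_of_real ((W w * cos (\<theta> w)) * indicator B (X w))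
          + \<i> * complex_of_real ((W w * sin (\<theta> w)) * indicator B (X w)))"
    by (intro Bochner_Integration.integral_cong refl) (simp add: complex_eq_iff cis_conv_exp[symmetric])
  also have "\<dots> = (CLINT w|M. complex_of_real ((W w * cos (\<theta> w)) * indicator B (X w)))
      + (CLINT w|M. \<i> * complex_of_real ((W w * sin (\<theta> w)) * indicator B (X w)))"
    by (intro Bochner_Integration.integral_add integrable_mult_right integrable_of_real i1 i2)
  finally show ?thesis
    by (simp only: integral_complex_of_real integral_mult_right_zero)
qed

text \<open>The coordinates are converted one at a time from exponentials to indicators.\<close>

lemma mixed_char_indicator_eq:
  fixes X :: "'i \<Rightarrow> 'a \<Rightarrow> real" and Y :: "'i \<Rightarrow> 'b \<Rightarrow> real"
  assumes M: "prob_space M" and N: "prob_space N" and I: "finite I"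
    and X: "\<And>i. i \<in> I \<Longrightarrow> X i \<in> borel_measurable M"
    and Y: "\<And>i. i \<in> I \<Longrightarrow> Y i \<in> borel_measurable N"
    and char: "\<And>a. (CLINT w|M. iexp (\<Sum>i\<in>I. a i * X i w)) = (CLINT w|N. iexp (\<Sum>i\<in>I. a i * Y i w))"
    and "K \<subseteq> I" and "\<And>i. i \<in> K \<Longrightarrow> A i \<in> sets borel"
  shows "(CLINT w|M. (\<Prod>i\<in>K. indicator (A i) (X i w) :: real) * iexp (\<Sum>i\<in>I - K. a i * X i w))
       = (CLINT w|N. (\<Prod>i\<in>K. indicator (A i) (Y i w) :: real) * iexp (\<Sum>i\<in>I - K. a i * Y i w))"
  using finite_subset[OF \<open>K \<subseteq> I\<close> I] assms(7,8)
proof (induction K arbitrary: a rule: finite_induct)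
  case empty
  then show ?case
    using char[of a] by simp
next
  case (insert k K)
  interpret M: prob_space M by (rule M)
  interpret N: prob_space N by (rule N)
  from insert.prems have k: "k \<in> I" and K: "K \<subseteq> I" and A: "\<And>i. i \<in> K \<Longrightarrow> A i \<in> sets borel"
    and B: "A k \<in> sets borel"
    by auto
  define J where "J = I - insert k K"
  have J: "I - K = insert k J" "k \<notin> J" "finite J" "J \<subseteq> I"
    using k insert.hyps I by (auto simp: J_def)
  define W where "W = (\<lambda>w. \<Prod>i\<in>K. indicator (A i) (X i w) :: real)"
  define V where "V = (\<lambda>w. \<Prod>i\<in>K. indicator (A i) (Y i w) :: real)"
  define \<theta> where "\<theta> = (\<lambda>w. \<Sum>i\<in>J. a i * X i w)"
  define \<eta> where "\<eta> = (\<lambda>w. \<Sum>i\<in>J. a i * Y i w)"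
  have [measurable]: "W \<in> borel_measurable M" "\<theta> \<in> borel_measurable M"
    unfolding W_def \<theta>_def using X J K A
    by (auto intro!: borel_measurable_prod borel_measurable_sum borel_measurable_times
        measurable_compose[OF _ borel_measurable_indicator])
  have [measurable]: "V \<in> borel_measurable N" "\<eta> \<in> borel_measurable N"
    unfolding V_def \<eta>_def using Y J K A
    by (auto intro!: borel_measurable_prod borel_measurable_sum borel_measurable_times
        measurable_compose[OF _ borel_measurable_indicator])
  have [measurable]: "X k \<in> borel_measurable M" "Y k \<in> borel_measurable N"
    using X Y k by auto
  have W1: "\<bar>W w\<bar> \<le> 1" for w
    unfolding W_def abs_prod by (intro prod_le_1) (auto simp: indicator_def)
  have V1: "\<bar>V w\<bar> \<le> 1" for w
    unfolding V_def abs_prod by (intro prod_le_1) (auto simp: indicator_def)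
  \<comment> \<open>The induction hypothesis with an arbitrary coefficient \<open>b\<close> at
    \<open>k\<close> and all others multiplied by \<open>s\<close>; this is why \<open>a\<close> is
    generalised. Euler's formulas use \<open>s = 1\<close> and \<open>s = -1\<close>.\<close>
  have F: "(CLINT w|M. W w * iexp (b * X k w + s * \<theta> w)) = (CLINT w|N. V w * iexp (b * Y k w + s * \<eta> w))" for b s
  proof -
    have "(\<Sum>i\<in>I - K. ((\<lambda>i. s * a i)(k := b)) i * Z i) = b * Z k + s * (\<Sum>i\<in>J. a i * Z i)" for Z :: "'i \<Rightarrow> real"
    proof -
      have "(\<Sum>i\<in>J. ((\<lambda>i. s * a i)(k := b)) i * Z i) = (\<Sum>i\<in>J. s * (a i * Z i))"
        using J(2) by (intro sum.cong) auto
      then show ?thesis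
        using J by (simp add: sum_distrib_left)
    qed
    then show ?thesis
      using insert.IH[OF K A, of "(\<lambda>i. s * a i)(k := b)"] unfolding W_def V_def \<theta>_def \<eta>_def by simp
  qed
  have charX: "(CLINT w|M. iexp (b * X k w)) = (CLINT w|N. iexp (b * Y k w))" for b
  proof -
    have "(\<Sum>i\<in>I. ((\<lambda>_. 0)(k := b)) i * Z i) = b * Z k" for Z :: "'i \<Rightarrow> real"
    proof -
      have "(\<Sum>i\<in>I. ((\<lambda>_. 0)(k := b)) i * Z i) = (\<Sum>i\<in>I. if i = k then b * Z k else 0)"
        by (intro sum.cong) auto
      then show ?thesis
        using I k by simp
    qed
    then show ?thesis
      using char[of "(\<lambda>_. 0)(k := b)"] by simp
  qed
  have le: "\<bar>x * cos y\<bar> \<le> 1" "\<bar>x * sin y\<bar> \<le> 1" if "\<bar>x\<bar> \<le> 1" for x y :: real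
    using that mult_mono[OF that abs_cos_le_one[of y]] mult_mono[OF that abs_sin_le_one[of y]]
    by (auto simp: abs_mult)
  \<comment> \<open>\<open>weighted_char_uniqueness\<close> takes real weights bounded by 1, so the
    exponential of the remaining coordinates enters once as a cosine (here) and once as a sine
    (\<open>S\<close>).\<close>
  have C: "(LINT w|M. (W w * cos (\<theta> w)) * indicator (A k) (X k w)) = (LINT w|N. (V w * cos (\<eta> w)) * indicator (A k) (Y k w))"
  proof (rule weighted_char_uniqueness[OF M N _ _ _ _ _ _ charX _ B])
    fix b
    show "(CLINT w|M. (W w * cos (\<theta> w)) * iexp (b * X k w)) = (CLINT w|N. (V w * cos (\<eta> w)) * iexp (b * Y k w))"
      using M.integral_cos_sin_weight(1)[of W "\<lambda>w. b * X k w" \<theta>, OF _ _ _ W1]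
        N.integral_cos_sin_weight(1)[of V "\<lambda>w. b * Y k w" \<eta>, OF _ _ _ V1] F[of b]
      by (simp only: borel_measurable_times borel_measurable_const \<open>X k \<in> borel_measurable M\<close> \<open>Y k \<in> borel_measurable N\<close>
          \<open>W \<in> borel_measurable M\<close> \<open>\<theta> \<in> borel_measurable M\<close> \<open>V \<in> borel_measurable N\<close> \<open>\<eta> \<in> borel_measurable N\<close>)
  qed (use le W1 V1 in auto)
  have S: "(LINT w|M. (W w * sin (\<theta> w)) * indicator (A k) (X k w)) = (LINT w|N. (V w * sin (\<eta> w)) * indicator (A k) (Y k w))"
  proof (rule weighted_char_uniqueness[OF M N _ _ _ _ _ _ charX _ B])
    fix b
    show "(CLINT w|M. (W w * sin (\<theta> w)) * iexp (b * X k w)) = (CLINT w|N. (V w * sin (\<eta> w)) * iexp (b * Y k w))"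
      using M.integral_cos_sin_weight(2)[of W "\<lambda>w. b * X k w" \<theta>, OF _ _ _ W1]
        N.integral_cos_sin_weight(2)[of V "\<lambda>w. b * Y k w" \<eta>, OF _ _ _ V1] F[of b]
      by (simp only: borel_measurable_times borel_measurable_const \<open>X k \<in> borel_measurable M\<close> \<open>Y k \<in> borel_measurable N\<close>
          \<open>W \<in> borel_measurable M\<close> \<open>\<theta> \<in> borel_measurable M\<close> \<open>V \<in> borel_measurable N\<close> \<open>\<eta> \<in> borel_measurable N\<close>)
  qed (use le W1 V1 in auto)
  have "(CLINT w|M. (\<Prod>i\<in>insert k K. indicator (A i) (X i w) :: real) * iexp (\<Sum>i\<in>J. a i * X i w))
      = (CLINT w|M. (W w * indicator (A k) (X k w)) * iexp (\<theta> w))"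
    using insert.hyps by (simp add: W_def \<theta>_def mult_ac)
  also have "\<dots> = (CLINT w|N. (V w * indicator (A k) (Y k w)) * iexp (\<eta> w))"
    using M.integral_weight_indicator_iexp[of W "X k" \<theta> "A k", OF _ _ _ B W1]
      N.integral_weight_indicator_iexp[of V "Y k" \<eta> "A k", OF _ _ _ B V1] C S
    by (simp del: of_real_mult)
  also have "\<dots> = (CLINT w|N. (\<Prod>i\<in>insert k K. indicator (A i) (Y i w) :: real) * iexp (\<Sum>i\<in>J. a i * Y i w))"
    using insert.hyps by (simp add: V_def \<eta>_def mult_ac)
  finally show ?case
    by (simp only: J_def)
qed

lemma measure_distr_PiE_eq_integral:
  fixes X :: "'i \<Rightarrow> 'a \<Rightarrow> real"
  assumes I: "finite I" and A: "\<And>i. i \<in> I \<Longrightarrow> A i \<in> sets borel"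
    and m: "(\<lambda>w. \<lambda>i\<in>I. X i w) \<in> measurable M (\<Pi>\<^sub>M i\<in>I. borel)"
  shows "complex_of_real (measure (distr M (\<Pi>\<^sub>M i\<in>I. borel) (\<lambda>w. \<lambda>i\<in>I. X i w)) (Pi\<^sub>E I A))
    = (CLINT w|M. (\<Prod>i\<in>I. indicator (A i) (X i w) :: real))"
proof -
  have AP: "Pi\<^sub>E I A \<in> sets (\<Pi>\<^sub>M i\<in>I. borel)"
    using A I by (intro sets_PiM_I_finite) auto
  have "measure (distr M (\<Pi>\<^sub>M i\<in>I. borel) (\<lambda>w. \<lambda>i\<in>I. X i w)) (Pi\<^sub>E I A)
      = (LINT x|distr M (\<Pi>\<^sub>M i\<in>I. borel) (\<lambda>w. \<lambda>i\<in>I. X i w). indicator (Pi\<^sub>E I A) x)"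
    using AP sets.sets_into_space[OF AP] by (simp add: Int_absorb2)
  also have "\<dots> = (LINT w|M. indicator (Pi\<^sub>E I A) (\<lambda>i\<in>I. X i w))"
    using m AP by (intro integral_distr) auto
  also have "\<dots> = (LINT w|M. (\<Prod>i\<in>I. indicator (A i) (X i w)))"
  proof (rule Bochner_Integration.integral_cong[OF refl])
    show "indicator (Pi\<^sub>E I A) (\<lambda>i\<in>I. X i w) = (\<Prod>i\<in>I. indicator (A i) (X i w) :: real)" for w
      using I by (auto simp: indicator_def PiE_iff prod_zero_iff)
  qed
  finally show ?thesis
    by (simp only: integral_complex_of_real)
qed

text \<open>With \<open>K = I\<close> the preceding exchange leaves only a product of indicators,
  that is, the measure of a box; boxes determine a finite measure on a finite product.\<close>

theorem Cramer_Wold_char: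
  fixes X :: "'i \<Rightarrow> 'a \<Rightarrow> real" and Y :: "'i \<Rightarrow> 'b \<Rightarrow> real"
  assumes M: "prob_space M" and N: "prob_space N" and I: "finite I"
    and X: "\<And>i. i \<in> I \<Longrightarrow> X i \<in> borel_measurable M"
    and Y: "\<And>i. i \<in> I \<Longrightarrow> Y i \<in> borel_measurable N"
    and char: "\<And>a. (CLINT w|M. iexp (\<Sum>i\<in>I. a i * X i w)) = (CLINT w|N. iexp (\<Sum>i\<in>I. a i * Y i w))"
  shows "distr M (\<Pi>\<^sub>M i\<in>I. borel) (\<lambda>w. \<lambda>i\<in>I. X i w) = distr N (\<Pi>\<^sub>M i\<in>I. borel) (\<lambda>w. \<lambda>i\<in>I. Y i w)"
proof -
  interpret M: prob_space M by (rule M)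
  interpret N: prob_space N by (rule N)
  have [measurable]: "(\<lambda>w. \<lambda>i\<in>I. X i w) \<in> measurable M (\<Pi>\<^sub>M i\<in>I. borel)"
    using X by (intro measurable_restrict) auto
  have [measurable]: "(\<lambda>w. \<lambda>i\<in>I. Y i w) \<in> measurable N (\<Pi>\<^sub>M i\<in>I. borel)"
    using Y by (intro measurable_restrict) auto
  show ?thesis
  proof (rule measure_eqI_PiM_finite[OF I])
    fix A :: "'i \<Rightarrow> real set"
    assume A: "\<And>i. i \<in> I \<Longrightarrow> A i \<in> sets borel"
    have AP: "Pi\<^sub>E I A \<in> sets (\<Pi>\<^sub>M i\<in>I. borel)"
      using A I by (intro sets_PiM_I_finite) auto
    have "measure (distr M (\<Pi>\<^sub>M i\<in>I. borel) (\<lambda>w. \<lambda>i\<in>I. X i w)) (Pi\<^sub>E I A)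
        = measure (distr N (\<Pi>\<^sub>M i\<in>I. borel) (\<lambda>w. \<lambda>i\<in>I. Y i w)) (Pi\<^sub>E I A)"
    proof -
      have "(CLINT w|M. (\<Prod>i\<in>I. indicator (A i) (X i w) :: real)) = (CLINT w|N. (\<Prod>i\<in>I. indicator (A i) (Y i w) :: real))"
        using mixed_char_indicator_eq[where a = "\<lambda>_. 0", OF M N I X Y char subset_refl A] by (simp del: of_real_prod)
      then show ?thesis
        using measure_distr_PiE_eq_integral[where A = A and X = X and M = M, OF I A] measure_distr_PiE_eq_integral[where A = A and X = Y and M = N, OF I A] by (simp del: of_real_prod)
    qed
    then show "emeasure (distr M (\<Pi>\<^sub>M i\<in>I. borel) (\<lambda>w. \<lambda>i\<in>I. X i w)) (Pi\<^sub>E I A)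
        = emeasure (distr N (\<Pi>\<^sub>M i\<in>I. borel) (\<lambda>w. \<lambda>i\<in>I. Y i w)) (Pi\<^sub>E I A)"
      using M.prob_space_distr[of "\<lambda>w. \<lambda>i\<in>I. X i w" "\<Pi>\<^sub>M i\<in>I. borel"]
        N.prob_space_distr[of "\<lambda>w. \<lambda>i\<in>I. Y i w" "\<Pi>\<^sub>M i\<in>I. borel"]
      by (simp add: prob_space_def finite_measure.emeasure_eq_measure)
  next
    show "range (\<lambda>n::nat. \<Pi>\<^sub>E i\<in>I. (UNIV :: real set)) \<subseteq> prod_algebra I (\<lambda>_. borel)"
      using I by (auto intro!: prod_algebraI_finite)
    show "(\<Union>n::nat. \<Pi>\<^sub>E i\<in>I. (UNIV :: real set)) = space (\<Pi>\<^sub>M i\<in>I. borel)"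
      by (simp add: space_PiM)
    show "emeasure (distr M (\<Pi>\<^sub>M i\<in>I. borel) (\<lambda>w. \<lambda>i\<in>I. X i w)) (\<Pi>\<^sub>E i\<in>I. UNIV) \<noteq> \<infinity>" for n :: nat
      using M.prob_space_distr[of "\<lambda>w. \<lambda>i\<in>I. X i w" "\<Pi>\<^sub>M i\<in>I. borel"]
      by (simp add: prob_space_def finite_measure.emeasure_finite)
  qed auto
qed

section \<open>Scalar calculus\<close>

lemma has_vector_derivative_cong_on:
  assumes "\<And>x. x \<in> I \<Longrightarrow> g x = h x" "t \<in> I"
  shows "(g has_vector_derivative d) (at t within I) \<longleftrightarrow> (h has_vector_derivative d) (at t within I)"
  using assms has_vector_derivative_transform[of t I g h d] has_vector_derivative_transform[of t I h g d] by metis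

lemma continuous_on_if_has_vector_derivative:
  assumes "\<And>x. x \<in> I \<Longrightarrow> (g has_vector_derivative g' x) (at x within I)"
  shows "continuous_on I g"
  using assms unfolding continuous_on_eq_continuous_within by (blast intro: has_vector_derivative_continuous)

lemma continuous_on_section:
  assumes "continuous_on (A \<times> B) (\<lambda>(s, t). F s t)" "x \<in> A" "S \<subseteq> B"
  shows "continuous_on S (F x)"
proof -
  have "continuous_on S (\<lambda>t. (x, t))"
    by (rule continuous_on_Pair[OF continuous_on_const continuous_on_id])
  moreover have "(\<lambda>t. (x, t)) ` S \<subseteq> A \<times> B"
    using assms by auto
  ultimately show ?thesis
    using continuous_on_compose2[OF assms(1)] by fastforce
qed

lemma deriv_on_cong:
  assumes "\<And>x. x \<in> I \<Longrightarrow> g x = h x" "t \<in> I"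
  shows "deriv_on I g t = deriv_on I h t"
  unfolding deriv_on_def vector_derivative_def using has_vector_derivative_cong_on[OF assms] by simp

lemma deriv_on_funpow_cong:
  assumes "\<And>x. x \<in> I \<Longrightarrow> g x = h x" "t \<in> I"
  shows "(deriv_on I ^^ k) g t = (deriv_on I ^^ k) h t"
  using assms(2)
proof (induction k arbitrary: t)
  case (Suc k)
  then show ?case
    by (auto intro: deriv_on_cong)
qed (use assms in simp)

text \<open>On a nondegenerate interval one-sided derivatives are unique, endpoints included, so the
  choice hidden in \<open>vector_derivative\<close> is harmless. On a one-point interval every
  number would be a derivative.\<close>

lemma deriv_on_eqI:
  assumes "t0 < t1" "t \<in> {t0..t1}" "(g has_vector_derivative d) (at t within {t0..t1})"
  shows "deriv_on {t0..t1} g t = d"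
  unfolding deriv_on_def by (rule vector_derivative_within_closed_interval) (use assms in auto)

lemma has_vector_derivative_deriv_on:
  assumes "g differentiable (at t within I)"
  shows "(g has_vector_derivative deriv_on I g t) (at t within I)"
  using assms unfolding deriv_on_def vector_derivative_works .

lemma deriv_on_funpow_zero:
  assumes "t0 < t1" "t \<in> {t0..t1}"
  shows "(deriv_on {t0..t1} ^^ k) (\<lambda>_. 0) t = 0"
  using assms(2)
proof (induction k arbitrary: t)
  case (Suc k)
  have "deriv_on {t0..t1} ((deriv_on {t0..t1} ^^ k) (\<lambda>_. 0)) t = deriv_on {t0..t1} (\<lambda>_. 0) t"
    using Suc by (intro deriv_on_cong) auto
  also have "\<dots> = 0"
    by (intro deriv_on_eqI assms Suc.prems) (auto intro: derivative_eq_intros)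
  finally show ?case
    by simp
qed simp

section \<open>Mixed partial derivatives and their order\<close>

lemma C_on_has_vector_derivative:
  assumes "C_on n I g" "k < n" "t \<in> I"
  shows "((deriv_on I ^^ k) g has_vector_derivative (deriv_on I ^^ Suc k) g t) (at t within I)"
  using assms has_vector_derivative_deriv_on[of "(deriv_on I ^^ k) g" t I] by (simp add: C_on_def)

lemma mixed_deriv_eq: "mixed_deriv I u v G s t = (deriv_on I ^^ u) (\<lambda>x. (deriv_on I ^^ v) (\<lambda>y. G x y) t) s"
  by (simp add: mixed_deriv_def in_first_def in_second_def)

lemma mixed_deriv_first:
  assumes "C2_on a b I G" "u < a" "v \<le> b" "s \<in> I" "t \<in> I"
  shows "((\<lambda>x. mixed_deriv I u v G x t) has_vector_derivative mixed_deriv I (Suc u) v G s t) (at s within I)"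
proof -
  have "mixed_deriv I (Suc u) v G s t = deriv_on I (\<lambda>x. mixed_deriv I u v G x t) s"
    by (simp add: mixed_deriv_eq)
  then show ?thesis
    using assms by (auto intro!: has_vector_derivative_deriv_on simp: C2_on_def)
qed

lemma mixed_deriv_continuous_on:
  assumes "C2_on a b I G" "u \<le> a" "v \<le> b"
  shows "continuous_on (I \<times> I) (\<lambda>(s, t). mixed_deriv I u v G s t)"
  using assms by (simp add: C2_on_def)

text \<open>Integrating in the second variable and differentiating under the integral sign.\<close>

lemma mixed_partials_commute:
  fixes F :: "real \<Rightarrow> real \<Rightarrow> real"
  assumes ab: "a < b"
    and F1: "\<And>s t. s \<in> {a..b} \<Longrightarrow> t \<in> {a..b} \<Longrightarrow> ((\<lambda>x. F x t) has_vector_derivative F1 s t) (at s within {a..b})"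
    and F2: "\<And>s t. s \<in> {a..b} \<Longrightarrow> t \<in> {a..b} \<Longrightarrow> ((\<lambda>y. F s y) has_vector_derivative F2 s t) (at t within {a..b})"
    and F12: "\<And>s t. s \<in> {a..b} \<Longrightarrow> t \<in> {a..b} \<Longrightarrow> ((\<lambda>x. F2 x t) has_vector_derivative F12 s t) (at s within {a..b})"
    and cont2: "continuous_on ({a..b} \<times> {a..b}) (\<lambda>(s, t). F2 s t)"
    and cont12: "continuous_on ({a..b} \<times> {a..b}) (\<lambda>(s, t). F12 s t)"
    and s: "s \<in> {a..b}" and t: "t \<in> {a..b}"
  shows "((\<lambda>y. F1 s y) has_vector_derivative F12 s t) (at t within {a..b})"
proof -
  \<comment> \<open>The y-dependence of \<open>F1 s\<close> is exhibited as an indefinite integral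
    of \<open>F12 s\<close>; the conclusion is then the fundamental theorem of calculus.\<close>
  have F1_eq: "F1 s a + integral {a..y} (F12 s) = F1 s y" if y: "y \<in> {a..b}" for y
  proof -
    have sub: "{a..b} \<times> {a..y} \<subseteq> {a..b} \<times> {a..b}" "{a..y} \<subseteq> {a..b}"
      using y by auto
    have cont2x: "continuous_on {a..y} (F2 x)" if "x \<in> {a..b}" for x
      using continuous_on_section[OF cont2 that sub(2)] .
    have "((\<lambda>x. integral (cbox a y) (F2 x)) has_field_derivative integral (cbox a y) (F12 s)) (at s within {a..b})"
    proof (rule leibniz_rule_field_derivative)
      show "((\<lambda>x. F2 x t) has_field_derivative F12 x t) (at x within {a..b})"
        if "x \<in> {a..b}" "t \<in> cbox a y" for x t
        using F12[of x t] that y by (simp add: has_real_derivative_iff_has_vector_derivative)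
      show "F2 x integrable_on cbox a y" if "x \<in> {a..b}" for x
        using cont2x[OF that] by (auto intro: integrable_continuous_real)
      show "continuous_on ({a..b} \<times> cbox a y) (\<lambda>(x, t). F12 x t)"
        using continuous_on_subset[OF cont12 sub(1)] by simp
    qed (use s in auto)
    then have "((\<lambda>x. F x a + integral {a..y} (F2 x)) has_vector_derivative F1 s a + integral {a..y} (F12 s)) (at s within {a..b})"
      using F1[OF s, of a] ab
      by (intro has_vector_derivative_add) (auto simp: has_real_derivative_iff_has_vector_derivative)
    moreover have "F x a + integral {a..y} (F2 x) = F x y" if x: "x \<in> {a..b}" for x
    proof -
      have "(F2 x has_integral F x y - F x a) {a..y}"
      proof (rule fundamental_theorem_of_calculus)
        show "(F x has_vector_derivative F2 x z) (at z within {a..y})" if "z \<in> {a..y}" for z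
          using that sub(2) by (intro has_vector_derivative_within_subset[OF F2[OF x] sub(2)]) auto
      qed (use y in simp)
      then show ?thesis
        by (simp add: integral_unique)
    qed
    ultimately have "((\<lambda>x. F x y) has_vector_derivative F1 s a + integral {a..y} (F12 s)) (at s within {a..b})"
      using has_vector_derivative_cong_on[of "{a..b}" "\<lambda>x. F x a + integral {a..y} (F2 x)" "\<lambda>x. F x y" s] s by blast
    \<comment> \<open>Two derivatives at \<open>s\<close> of the same function \<open>F x y\<close>
      of \<open>x\<close>; uniqueness identifies them.\<close>
    from deriv_on_eqI[OF ab s this] deriv_on_eqI[OF ab s F1[OF s y]] show ?thesis
      by simp
  qed
  have "continuous_on {a..b} (F12 s)"
    by (rule continuous_on_section[OF cont12 s order_refl])
  from integral_has_vector_derivative[OF this t]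
  have "((\<lambda>y. F1 s a + integral {a..y} (F12 s)) has_vector_derivative F12 s t) (at t within {a..b})"
    by (auto intro!: derivative_eq_intros)
  then show ?thesis
    using has_vector_derivative_cong_on[of "{a..b}" "\<lambda>y. F1 s a + integral {a..y} (F12 s)" "\<lambda>y. F1 s y" t] t F1_eq by blast
qed

text \<open>\<open>C2_on\<close> provides differentiability in the second argument only before any
  differentiation in the first (\<open>u = 0\<close>). Induction on \<open>u\<close> carries it past
  each derivative in the first argument by exchanging partials.\<close>

lemma mixed_deriv_second:
  assumes G: "C2_on a b {t0..t1} G" and ab: "t0 < t1" and "u \<le> a" "v < b" "s \<in> {t0..t1}" "t \<in> {t0..t1}"
  shows "((\<lambda>y. mixed_deriv {t0..t1} u v G s y) has_vector_derivative mixed_deriv {t0..t1} u (Suc v) G s t) (at t within {t0..t1})"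
  using assms(3-6)
proof (induction u arbitrary: s t)
  case 0
  have "mixed_deriv {t0..t1} 0 (Suc v) G s t = deriv_on {t0..t1} (\<lambda>y. mixed_deriv {t0..t1} 0 v G s y) t"
    by (simp add: mixed_deriv_eq)
  then show ?case
    using 0 G by (auto intro!: has_vector_derivative_deriv_on simp: C2_on_def)
next
  case (Suc u)
  show ?case
  proof (rule mixed_partials_commute[where F = "mixed_deriv {t0..t1} u v G" and ?F1.0 = "mixed_deriv {t0..t1} (Suc u) v G"
        and ?F2.0 = "mixed_deriv {t0..t1} u (Suc v) G" and ?F12.0 = "mixed_deriv {t0..t1} (Suc u) (Suc v) G", OF ab])
    show "((\<lambda>x. mixed_deriv {t0..t1} u v G x t) has_vector_derivative mixed_deriv {t0..t1} (Suc u) v G s t) (at s within {t0..t1})"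
      if "s \<in> {t0..t1}" "t \<in> {t0..t1}" for s t
      using mixed_deriv_first[OF G] Suc.prems that by simp
    show "((\<lambda>y. mixed_deriv {t0..t1} u v G s y) has_vector_derivative mixed_deriv {t0..t1} u (Suc v) G s t) (at t within {t0..t1})"
      if "s \<in> {t0..t1}" "t \<in> {t0..t1}" for s t
      using Suc.IH Suc.prems that by simp
    show "((\<lambda>x. mixed_deriv {t0..t1} u (Suc v) G x t) has_vector_derivative mixed_deriv {t0..t1} (Suc u) (Suc v) G s t) (at s within {t0..t1})"
      if "s \<in> {t0..t1}" "t \<in> {t0..t1}" for s t
      using mixed_deriv_first[OF G] Suc.prems that by simp
  qed (use Suc.prems in \<open>auto intro!: mixed_deriv_continuous_on[OF G]\<close>)
qed

text \<open>Increments of either sign occur below, hence no order between \<open>s\<close> and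
  \<open>t\<close>; derivatives within the interval are enough also when one of them is an
  endpoint.\<close>

lemma mvt_on_Icc:
  fixes g :: "real \<Rightarrow> real"
  assumes g: "\<And>x. x \<in> {a..b} \<Longrightarrow> (g has_vector_derivative g' x) (at x within {a..b})"
    and s: "s \<in> {a..b}" and t: "t \<in> {a..b}"
  obtains x where "x \<in> closed_segment s t" "x \<in> {a..b}" "g t - g s = g' x * (t - s)"
proof -
  have *: "\<exists>x\<in>{s..t}. g t - g s = g' x * (t - s)" if "s \<le> t" "s \<in> {a..b}" "t \<in> {a..b}" for s t
  proof (rule mvt_very_simple[OF that(1)])
    fix x
    assume "s \<le> x" "x \<le> t"
    with that have x: "x \<in> {a..b}" "{s..t} \<subseteq> {a..b}"
      by auto
    show "(g has_derivative (*) (g' x)) (at x within {s..t})"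
      using has_vector_derivative_within_subset[OF g[OF x(1)] x(2)]
      by (simp add: has_vector_derivative_def mult_commute_abs)
  qed
  show thesis
  proof (cases "s \<le> t")
    case True
    from *[OF True s t] obtain x where x: "x \<in> {s..t}" "g t - g s = g' x * (t - s)"
      by blast
    show thesis
      by (rule that[OF _ _ x(2)]) (use x(1) True s t in \<open>auto simp: closed_segment_eq_real_ivl\<close>)
  next
    case False
    then have ts: "t \<le> s"
      by simp
    from *[OF this t s] obtain x where x: "x \<in> {t..s}" "g s - g t = g' x * (s - t)"
      by blast
    from x(2) have "g t - g s = g' x * (t - s)"
      by (simp add: algebra_simps)
    then show thesis
      by (rule that[rotated 2]) (use x(1) False s t in \<open>auto simp: closed_segment_eq_real_ivl\<close>)
  qed
qed

text \<open>Two mean value theorems, in \<open>y\<close> for the difference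
  \<open>F (t + h) y - F t y\<close> and then in \<open>x\<close> for \<open>F2\<close>, turn the
  quotient into a value of \<open>F12\<close> near the diagonal point. \<open>h\<close> and
  \<open>k\<close> are independent, which is what a Cauchy criterion needs.\<close>

lemma second_difference_quotient:
  fixes F :: "real \<Rightarrow> real \<Rightarrow> real"
  assumes F2: "\<And>s t. s \<in> {a..b} \<Longrightarrow> t \<in> {a..b} \<Longrightarrow> ((\<lambda>y. F s y) has_vector_derivative F2 s t) (at t within {a..b})"
    and F12: "\<And>s t. s \<in> {a..b} \<Longrightarrow> t \<in> {a..b} \<Longrightarrow> ((\<lambda>x. F2 x t) has_vector_derivative F12 s t) (at s within {a..b})"
    and cont12: "continuous_on ({a..b} \<times> {a..b}) (\<lambda>(s, t). F12 s t)"
    and t: "t \<in> {a..b}" and e: "e > 0"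
  obtains d where "d > 0" "\<And>h k. h \<noteq> 0 \<Longrightarrow> k \<noteq> 0 \<Longrightarrow> \<bar>h\<bar> < d \<Longrightarrow> \<bar>k\<bar> < d \<Longrightarrow> t + h \<in> {a..b} \<Longrightarrow> t + k \<in> {a..b} \<Longrightarrow>
    \<bar>(F (t + h) (t + k) - F t (t + k) - (F (t + h) t - F t t)) / (h * k) - F12 t t\<bar> < e"
proof -
  have "(t, t) \<in> {a..b} \<times> {a..b}"
    using t by simp
  with cont12 e obtain d where d: "d > 0"
    and "\<forall>z\<in>{a..b} \<times> {a..b}. dist z (t, t) < d \<longrightarrow> dist (case z of (s, t) \<Rightarrow> F12 s t) (case (t, t) of (s, t) \<Rightarrow> F12 s t) < e"
    unfolding continuous_on_iff by blast
  then have dF: "\<bar>F12 x y - F12 t t\<bar> < e" if "x \<in> {a..b}" "y \<in> {a..b}" "dist (x, y) (t, t) < d" for x y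
    using that by (fastforce simp: dist_real_def)
  show thesis
  \<comment> \<open>The distance in the plane is at most the sum of the two coordinate distances,
    hence the half.\<close>
  proof (rule that[of "d / 2"])
    fix h k
    assume hk: "h \<noteq> 0" "k \<noteq> 0" "\<bar>h\<bar> < d / 2" "\<bar>k\<bar> < d / 2" and th: "t + h \<in> {a..b}" and tk: "t + k \<in> {a..b}"
    have "((\<lambda>y. F (t + h) y - F t y) has_vector_derivative F2 (t + h) y - F2 t y) (at y within {a..b})"
      if "y \<in> {a..b}" for y
      using that t th by (intro has_vector_derivative_diff F2)
    from mvt_on_Icc[OF this t tk] obtain y where y: "y \<in> closed_segment t (t + k)" "y \<in> {a..b}"
      and 1: "(F (t + h) (t + k) - F t (t + k)) - (F (t + h) t - F t t) = (F2 (t + h) y - F2 t y) * (t + k - t)"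
      by blast
    from mvt_on_Icc[OF F12[OF _ y(2)] t th] obtain x where x: "x \<in> closed_segment t (t + h)" "x \<in> {a..b}"
      and 2: "F2 (t + h) y - F2 t y = F12 x y * (t + h - t)"
      by blast
    have "\<bar>x - t\<bar> < d / 2" "\<bar>y - t\<bar> < d / 2"
      using segment_bound1[OF x(1)] segment_bound1[OF y(1)] hk by simp_all
    then have "dist (x, y) (t, t) < d"
      unfolding dist_Pair_Pair dist_real_def
      using sqrt_sum_squares_le_sum_abs[of "\<bar>x - t\<bar>" "\<bar>y - t\<bar>"] by simp
    with dF x(2) y(2) have "\<bar>F12 x y - F12 t t\<bar> < e"
      by blast
    moreover have "(F (t + h) (t + k) - F t (t + k) - (F (t + h) t - F t t)) / (h * k) = F12 x y"
      using hk 1 2 by (simp add: field_simps)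
    ultimately show "\<bar>(F (t + h) (t + k) - F t (t + k) - (F (t + h) t - F t t)) / (h * k) - F12 t t\<bar> < e"
      by simp
  qed (use d in simp)
qed

section \<open>Iterated integrals, Taylor polynomials and Riemann sums\<close>

lemma cauchy_integral_0 [simp]: "cauchy_integral t0 0 g = g"
  by (simp add: cauchy_integral_def fun_eq_iff)

lemma cauchy_integral_Suc: "cauchy_integral t0 (Suc q) g t = integral {t0..t} (\<lambda>u. (t - u) ^ q * g u) / fact q"
  by (simp add: cauchy_integral_def)

lemma cauchy_integral_cong:
  assumes "\<And>x. x \<in> {t0..t} \<Longrightarrow> g x = h x" "t0 \<le> t"
  shows "cauchy_integral t0 q g t = cauchy_integral t0 q h t"
proof (cases q)
  case (Suc q')
  have "integral {t0..t} (\<lambda>u. (t - u) ^ q' * g u) = integral {t0..t} (\<lambda>u. (t - u) ^ q' * h u)"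
    using assms by (intro Henstock_Kurzweil_Integration.integral_cong) auto
  then show ?thesis
    by (simp add: Suc cauchy_integral_Suc)
qed (use assms in simp)

lemma cauchy_integral_1_has_vector_derivative:
  assumes "continuous_on {t0..t1} g" "t \<in> {t0..t1}"
  shows "(cauchy_integral t0 1 g has_vector_derivative g t) (at t within {t0..t1})"
  using integral_has_vector_derivative[OF assms] by (simp add: cauchy_integral_Suc[abs_def])

text \<open>Integration by parts.\<close>

lemma cauchy_integral_Suc_eq:
  assumes g: "continuous_on {t0..t1} g" and t: "t \<in> {t0..t1}"
  shows "cauchy_integral t0 (Suc q) g t = cauchy_integral t0 q (cauchy_integral t0 1 g) t"
proof (cases q)
  case (Suc p)
  define G where "G = cauchy_integral t0 1 g"
  have sub: "{t0..t} \<subseteq> {t0..t1}"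
    using t by auto
  have G': "(G has_vector_derivative g u) (at u within {t0..t})" if "u \<in> {t0..t}" for u
    unfolding G_def using that sub
    by (intro has_vector_derivative_within_subset[OF cauchy_integral_1_has_vector_derivative[OF g] sub]) auto
  have contG: "continuous_on {t0..t} G"
    using G' by (rule continuous_on_if_has_vector_derivative)
  have contg: "continuous_on {t0..t} g"
    by (rule continuous_on_subset[OF g sub])
  have der: "((\<lambda>u. (t - u) ^ Suc p * G u) has_vector_derivative
      (t - u) ^ Suc p * g u - real (Suc p) * ((t - u) ^ p * G u)) (at u within {t0..t})" if "u \<in> {t0..t}" for u
    using G'[OF that] unfolding has_real_derivative_iff_has_vector_derivative[symmetric]
    by (auto intro!: derivative_eq_intros simp: algebra_simps simp del: power_Suc)
  have "((\<lambda>u. (t - u) ^ Suc p * g u - real (Suc p) * ((t - u) ^ p * G u)) has_integral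
      (t - t) ^ Suc p * G t - (t - t0) ^ Suc p * G t0) {t0..t}"
    using t der by (intro fundamental_theorem_of_calculus) auto
  \<comment> \<open>Both boundary terms vanish: at \<open>t\<close> by the factor
    \<open>(t - t) ^ Suc p\<close>, at \<open>t0\<close> because \<open>G t0 = 0\<close>.\<close>
  then have "integral {t0..t} (\<lambda>u. (t - u) ^ Suc p * g u - real (Suc p) * ((t - u) ^ p * G u)) = 0"
    by (simp add: integral_unique G_def cauchy_integral_Suc)
  moreover have "integral {t0..t} (\<lambda>u. (t - u) ^ Suc p * g u - real (Suc p) * ((t - u) ^ p * G u))
     = integral {t0..t} (\<lambda>u. (t - u) ^ Suc p * g u) - real (Suc p) * integral {t0..t} (\<lambda>u. (t - u) ^ p * G u)"
    using contg contG
    by (subst Henstock_Kurzweil_Integration.integral_diff)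
      (auto intro!: integrable_continuous_real continuous_intros)
  ultimately have "integral {t0..t} (\<lambda>u. (t - u) ^ Suc p * g u) = real (Suc p) * integral {t0..t} (\<lambda>u. (t - u) ^ p * G u)"
    by linarith
  moreover have "A / fact (Suc p) = B / fact p" if "A = real (Suc p) * B" for A B :: real
    using that by (simp add: divide_simps del: of_nat_Suc)
  ultimately show ?thesis
    unfolding Suc G_def[symmetric] cauchy_integral_Suc by blast
qed simp

text \<open>Replacing \<open>g\<close> by its primitive lowers the order, so induction reaches the
  fundamental theorem of calculus and never differentiates an integral whose limit and kernel both
  depend on \<open>t\<close>.\<close>

lemma cauchy_integral_has_vector_derivative:
  assumes "continuous_on {t0..t1} g" "t \<in> {t0..t1}"
  shows "(cauchy_integral t0 (Suc q) g has_vector_derivative cauchy_integral t0 q g t) (at t within {t0..t1})"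
  using assms(1)
proof (induction q arbitrary: g)
  case 0
  then show ?case
    using cauchy_integral_1_has_vector_derivative[OF 0 assms(2)] by simp
next
  case (Suc q)
  define G where "G = cauchy_integral t0 1 g"
  have "continuous_on {t0..t1} G"
    unfolding G_def using cauchy_integral_1_has_vector_derivative[OF Suc.prems]
    by (rule continuous_on_if_has_vector_derivative)
  from Suc.IH[OF this] have "(cauchy_integral t0 (Suc q) G has_vector_derivative cauchy_integral t0 (Suc q) g t) (at t within {t0..t1})"
    using cauchy_integral_Suc_eq[OF Suc.prems assms(2)] by (simp add: G_def)
  then show ?case
    using has_vector_derivative_cong_on[of "{t0..t1}" "cauchy_integral t0 (Suc (Suc q)) g" "cauchy_integral t0 (Suc q) G" t]
      cauchy_integral_Suc_eq[OF Suc.prems] assms(2) by (simp add: G_def)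
qed

lemma taylor_polynomial_has_vector_derivative:
  fixes c :: "nat \<Rightarrow> real"
  shows "((\<lambda>t. \<Sum>j = 1..Suc q. (t - t0) ^ (Suc q - j) / fact (Suc q - j) * c j) has_vector_derivative
    (\<Sum>j = 1..q. (t - t0) ^ (q - j) / fact (q - j) * c j)) (at t within S)"
proof -
  have "((\<lambda>t. \<Sum>j = 1..q. (t - t0) ^ (Suc q - j) / fact (Suc q - j) * c j) has_vector_derivative
    (\<Sum>j = 1..q. (t - t0) ^ (q - j) / fact (q - j) * c j)) (at t within S)"
  proof (rule has_vector_derivative_sum)
    fix j
    assume "j \<in> {1..q}"
    then have "Suc q - j = Suc (q - j)"
      by auto
    then show "((\<lambda>t. (t - t0) ^ (Suc q - j) / fact (Suc q - j) * c j) has_vector_derivative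
      (t - t0) ^ (q - j) / fact (q - j) * c j) (at t within S)"
      unfolding has_real_derivative_iff_has_vector_derivative[symmetric]
      by (auto intro!: derivative_eq_intros simp: divide_simps simp del: power_Suc of_nat_Suc)
  qed
  \<comment> \<open>The summand \<open>j = Suc q\<close> has exponent 0: it is the newest
    integration constant, and it drops out.\<close>
  from has_vector_derivative_add[OF this has_vector_derivative_const[of "c (Suc q)"]] show ?thesis
    by simp
qed

text \<open>Each cell lies in the ball of radius \<open>d\<close> about its tag, where
  \<open>g\<close> varies by at most \<open>e\<close>. The bound involves \<open>g\<close> only
  through this oscillation, which matters because \<open>g\<close> will later depend on the
  divisions being compared.\<close>

lemma integral_Riemann_sum_bound:
  fixes g :: "real \<Rightarrow> real"
  assumes g: "continuous_on {a..b} g" and ab: "a \<le> b"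
    and w: "\<And>x y. x \<in> {a..b} \<Longrightarrow> y \<in> {a..b} \<Longrightarrow> \<bar>x - y\<bar> < d \<Longrightarrow> \<bar>g x - g y\<bar> \<le> e"
    and D: "D tagged_division_of {a..b}" and fine: "(\<lambda>x. ball x d) fine D" and e: "0 \<le> e"
  shows "\<bar>(\<Sum>(x, k)\<in>D. measure lborel k * g x) - integral {a..b} g\<bar> \<le> e * (b - a)"
proof -
  have D': "D tagged_division_of cbox a b"
    using D by simp
  have "integral {a..b} g = (\<Sum>(x, k)\<in>D. integral k g)"
    using integral_combine_tagged_division_topdown[of g a b D] D' g by (simp add: integrable_continuous_real)
  then have "\<bar>(\<Sum>(x, k)\<in>D. measure lborel k * g x) - integral {a..b} g\<bar> = \<bar>\<Sum>(x, k)\<in>D. measure lborel k * g x - integral k g\<bar>"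
    by (simp add: sum_subtractf split_beta)
  also have "\<dots> \<le> (\<Sum>(x, k)\<in>D. \<bar>measure lborel k * g x - integral k g\<bar>)"
    using sum_abs[of "\<lambda>(x, k). measure lborel k * g x - integral k g" D] by (simp add: split_beta)
  also have "\<dots> \<le> (\<Sum>(x, k)\<in>D. e * measure lborel k)"
  proof (rule sum_mono, clarify)
    fix x k
    assume xk: "(x, k) \<in> D"
    obtain c d' where k: "k = cbox c d'"
      using tagged_division_ofD(4)[OF D' xk] by blast
    have kI: "k \<subseteq> {a..b}" "x \<in> k"
      using tagged_division_ofD(2,3)[OF D' xk] by auto
    have "k \<subseteq> ball x d"
      using fine xk by (auto simp: fine_def)
    have bnd: "\<bar>g x - g y\<bar> \<le> e" if "y \<in> k" for y
    proof (rule w)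
      show "\<bar>x - y\<bar> < d"
        using \<open>k \<subseteq> ball x d\<close> that by (auto simp: dist_real_def)
    qed (use that kI in auto)
    have "g integrable_on k"
      using continuous_on_subset[OF g kI(1)] unfolding k by (rule integrable_continuous)
    then have "((\<lambda>y. g x - g y) has_integral measure lborel k * g x - integral k g) k"
      using has_integral_diff[OF has_integral_const[of "g x" c d'], of g "integral k g"] unfolding k
      by (simp add: integrable_integral)
    then show "\<bar>measure lborel k * g x - integral k g\<bar> \<le> e * measure lborel k"
      using has_integral_bound[OF e, of "\<lambda>y. g x - g y" _ c d'] bnd unfolding k by simp
  qed
  also have "\<dots> = e * (\<Sum>(x, k)\<in>D. measure lborel k)"
    by (simp add: sum_distrib_left split_beta)
  also have "(\<Sum>(x, k)\<in>D. measure lborel k) = b - a"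
    using additive_content_tagged_division[OF D'] ab by simp
  finally show ?thesis .
qed

section \<open>Mean-square calculus\<close>

lemma tendsto_shift_within:
  fixes g :: "real \<Rightarrow> 'b::topological_space"
  assumes "((\<lambda>h. g (t + h)) \<longlongrightarrow> L) (at 0 within {h. t + h \<in> I})"
  shows "(g \<longlongrightarrow> L) (at t within I)"
proof -
  have "filterlim (\<lambda>x. x - t) (at 0 within {h. t + h \<in> I}) (at t within I)"
    unfolding filterlim_at
    by (auto simp: eventually_at_filter intro!: tendsto_eq_intros)
  from filterlim_compose[OF assms this] show ?thesis
    by simp
qed

lemma has_ms_derivativeD:
  assumes "has_ms_derivative M I X Y t"
  shows "s \<in> I \<Longrightarrow> square_integrable M (X s)" "square_integrable M Y"
    "((\<lambda>h. l2norm M (\<lambda>w. (X (t + h) w - X t w) / h - Y w)) \<longlongrightarrow> 0) (at 0 within {h. t + h \<in> I})"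
  using assms unfolding has_ms_derivative_def l2norm_tendsto_iff by auto

lemma has_ms_integralD:
  assumes "has_ms_integral M a b X Y"
  shows "s \<in> {a..b} \<Longrightarrow> square_integrable M (X s)" "square_integrable M Y"
    "e > 0 \<Longrightarrow> \<exists>d>0. \<forall>D. D tagged_division_of {a..b} \<and> (\<lambda>x. ball x d) fine D \<longrightarrow>
        l2norm M (\<lambda>w. (\<Sum>(x, k)\<in>D. measure lborel k * X x w) - Y w) < e"
proof -
  show "s \<in> {a..b} \<Longrightarrow> square_integrable M (X s)" "square_integrable M Y"
    using assms by (auto simp: has_ms_integral_def)
  assume e: "e > 0"
  then have "e\<^sup>2 > 0"
    by simp
  then show "\<exists>d>0. \<forall>D. D tagged_division_of {a..b} \<and> (\<lambda>x. ball x d) fine D \<longrightarrow>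
        l2norm M (\<lambda>w. (\<Sum>(x, k)\<in>D. measure lborel k * X x w) - Y w) < e"
    using assms unfolding has_ms_integral_def l2norm_less_iff[OF e] by blast
qed

lemma integral_diff_mult:
  assumes "square_integrable M X" "square_integrable M Y" "square_integrable M Z"
  shows "(\<integral>w. (X w - Y w) * Z w \<partial>M) = (\<integral>w. X w * Z w \<partial>M) - (\<integral>w. Y w * Z w \<partial>M)"
  unfolding left_diff_distrib
  using assms by (intro Bochner_Integration.integral_diff square_integrable_mult_integrable)

lemma integral_quotient_diff_mult:
  assumes "square_integrable M X" "square_integrable M X'" "square_integrable M Y" "square_integrable M Z"
  shows "(\<integral>w. ((X' w - X w) / h - Y w) * Z w \<partial>M)
    = ((\<integral>w. X' w * Z w \<partial>M) - (\<integral>w. X w * Z w \<partial>M)) / h - (\<integral>w. Y w * Z w \<partial>M)"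
proof -
  have "(\<integral>w. ((X' w - X w) / h - Y w) * Z w \<partial>M)
      = (\<integral>w. (X' w - X w) / h * Z w \<partial>M) - (\<integral>w. Y w * Z w \<partial>M)"
    using assms by (intro integral_diff_mult square_integrable_divide square_integrable_diff)
  also have "(\<integral>w. (X' w - X w) / h * Z w \<partial>M) = (\<integral>w. (X' w - X w) * Z w \<partial>M) / h"
    by simp
  also have "(\<integral>w. (X' w - X w) * Z w \<partial>M) = (\<integral>w. X' w * Z w \<partial>M) - (\<integral>w. X w * Z w \<partial>M)"
    using assms by (intro integral_diff_mult)
  finally show ?thesis .
qed

text \<open>By Cauchy-Schwarz the pairing with Z is L2-continuous, so it passes through the limit of
  difference quotients.\<close>

lemma ms_derivative_weak:
  assumes X: "has_ms_derivative M I X Y t" and t: "t \<in> I" and Z: "square_integrable M Z"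
  shows "((\<lambda>x. \<integral>w. X x w * Z w \<partial>M) has_vector_derivative (\<integral>w. Y w * Z w \<partial>M)) (at t within I)"
proof -
  note Xd = has_ms_derivativeD[OF X]
  define g where "g x = (\<integral>w. X x w * Z w \<partial>M)" for x
  have "((\<lambda>h. (g (t + h) - g t) / h - (\<integral>w. Y w * Z w \<partial>M)) \<longlongrightarrow> 0) (at 0 within {h. t + h \<in> I})"
  proof (rule Lim_null_comparison)
    show "\<forall>\<^sub>F h in at 0 within {h. t + h \<in> I}. norm ((g (t + h) - g t) / h - (\<integral>w. Y w * Z w \<partial>M))
        \<le> l2norm M (\<lambda>w. (X (t + h) w - X t w) / h - Y w) * l2norm M Z"
      unfolding eventually_at_filter
    proof (intro always_eventually allI impI)
      fix h
      assume "h \<in> {h. t + h \<in> I}"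
      then have th: "square_integrable M (X (t + h))"
        using Xd(1) by simp
      show "norm ((g (t + h) - g t) / h - (\<integral>w. Y w * Z w \<partial>M))
        \<le> l2norm M (\<lambda>w. (X (t + h) w - X t w) / h - Y w) * l2norm M Z"
        unfolding g_def integral_quotient_diff_mult[OF Xd(1)[OF t] th Xd(2) Z, symmetric] real_norm_def
        by (intro Cauchy_Schwarz_l2norm square_integrable_diff square_integrable_divide th Xd t Z)
    qed
    show "((\<lambda>h. l2norm M (\<lambda>w. (X (t + h) w - X t w) / h - Y w) * l2norm M Z) \<longlongrightarrow> 0) (at 0 within {h. t + h \<in> I})"
      using Xd(3) by (rule tendsto_mult_left_zero)
  qed
  then have "((\<lambda>h. (g (t + h) - g t) / (t + h - t)) \<longlongrightarrow> (\<integral>w. Y w * Z w \<partial>M)) (at 0 within {h. t + h \<in> I})"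
    by (simp add: LIM_zero_iff)
  from tendsto_shift_within[OF this] show ?thesis
    by (simp add: has_real_derivative_iff_has_vector_derivative[symmetric] has_field_derivative_iff g_def)
qed

text \<open>The increment is \<open>h\<close> times a quotient of bounded norm. This is the step
  from differentiability of one order to continuity of that order, on which the next order
  relies.\<close>

lemma ms_derivative_imp_l2_continuous:
  assumes X: "has_ms_derivative M I X Y t" and t: "t \<in> I"
  shows "((\<lambda>x. l2norm M (\<lambda>w. X x w - X t w)) \<longlongrightarrow> 0) (at t within I)"
proof (rule tendsto_shift_within)
  note Xd = has_ms_derivativeD[OF X]
  show "((\<lambda>h. l2norm M (\<lambda>w. X (t + h) w - X t w)) \<longlongrightarrow> 0) (at 0 within {h. t + h \<in> I})"
  proof (rule Lim_null_comparison)
    show "\<forall>\<^sub>F h in at 0 within {h. t + h \<in> I}. norm (l2norm M (\<lambda>w. X (t + h) w - X t w))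
        \<le> \<bar>h\<bar> * (l2norm M (\<lambda>w. (X (t + h) w - X t w) / h - Y w) + l2norm M Y)"
      unfolding eventually_at_filter
    proof (intro always_eventually allI impI)
      fix h :: real
      assume h: "h \<noteq> 0" "h \<in> {h. t + h \<in> I}"
      then have "square_integrable M (\<lambda>w. (X (t + h) w - X t w) / h - Y w)"
        using Xd t by (intro square_integrable_diff square_integrable_divide) auto
      from l2norm_triangle[OF this Xd(2)]
      have "\<bar>h\<bar> * l2norm M (\<lambda>w. (X (t + h) w - X t w) / h)
          \<le> \<bar>h\<bar> * (l2norm M (\<lambda>w. (X (t + h) w - X t w) / h - Y w) + l2norm M Y)"
        by (intro mult_left_mono) simp_all
      then show "norm (l2norm M (\<lambda>w. X (t + h) w - X t w))
        \<le> \<bar>h\<bar> * (l2norm M (\<lambda>w. (X (t + h) w - X t w) / h - Y w) + l2norm M Y)"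
        using h(1) unfolding l2norm_scale[symmetric] by simp
    qed
    have "((\<lambda>h. \<bar>h\<bar>) \<longlongrightarrow> \<bar>0::real\<bar>) (at 0 within {h. t + h \<in> I})"
      by (intro tendsto_intros)
    from tendsto_mult[OF this tendsto_add[OF Xd(3) tendsto_const]]
    show "((\<lambda>h. \<bar>h\<bar> * (l2norm M (\<lambda>w. (X (t + h) w - X t w) / h - Y w) + l2norm M Y)) \<longlongrightarrow> 0)
      (at 0 within {h. t + h \<in> I})"
      by simp
  qed
qed

text \<open>Test against the error of the difference quotient itself and apply the mean value theorem to the
  resulting scalar function.\<close>

lemma ms_derivative_if_weak:
  assumes X: "\<And>x. x \<in> {a..b} \<Longrightarrow> square_integrable M (X x)"
    and Y: "\<And>x. x \<in> {a..b} \<Longrightarrow> square_integrable M (Y x)"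
    and weak: "\<And>x Z. x \<in> {a..b} \<Longrightarrow> square_integrable M Z \<Longrightarrow>
      ((\<lambda>x. \<integral>w. X x w * Z w \<partial>M) has_vector_derivative (\<integral>w. Y x w * Z w \<partial>M)) (at x within {a..b})"
    and t: "t \<in> {a..b}"
    and cont: "((\<lambda>x. l2norm M (\<lambda>w. Y x w - Y t w)) \<longlongrightarrow> 0) (at t within {a..b})"
  shows "has_ms_derivative M {a..b} X (Y t) t"
proof -
  have "((\<lambda>h. l2norm M (\<lambda>w. (X (t + h) w - X t w) / h - Y t w)) \<longlongrightarrow> 0) (at 0 within {h. t + h \<in> {a..b}})"
  proof (rule tendstoI)
    fix e :: real
    assume "e > 0"
    then have e: "e / 2 > 0"
      by simp
    have "\<forall>\<^sub>F x in at t within {a..b}. l2norm M (\<lambda>w. Y x w - Y t w) < e / 2"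
      using tendstoD[OF cont e] by simp
    then obtain d where d: "d > 0" and dY: "\<forall>x\<in>{a..b}. x \<noteq> t \<and> dist x t < d \<longrightarrow> l2norm M (\<lambda>w. Y x w - Y t w) < e / 2"
      unfolding eventually_at by blast
    have dY': "l2norm M (\<lambda>w. Y x w - Y t w) < e / 2" if "x \<in> {a..b}" "\<bar>x - t\<bar> < d" for x
    proof (cases "x = t")
      case True
      then show ?thesis
        using e by (simp add: l2norm_def)
    next
      case False
      then show ?thesis
        using that dY by (simp add: dist_real_def)
    qed
    have "dist (l2norm M (\<lambda>w. (X (t + h) w - X t w) / h - Y t w)) 0 < e"
      if h: "h \<noteq> 0" "dist h 0 < d" "h \<in> {h. t + h \<in> {a..b}}" for h
    proof -
      from h have th: "t + h \<in> {a..b}"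
        by simp
      define W where "W w = (X (t + h) w - X t w) / h - Y t w" for w
      have W: "square_integrable M W"
        unfolding W_def using th t by (intro square_integrable_diff square_integrable_divide X Y)
      \<comment> \<open>The point \<open>x\<close> depends on \<open>W\<close>, hence on
        \<open>h\<close>, and nothing is known of it but its distance to \<open>t\<close>; the
        continuity of \<open>Y\<close> in norm covers all such points at once.\<close>
      from mvt_on_Icc[OF weak[OF _ W] t th] obtain x where x: "x \<in> closed_segment t (t + h)" "x \<in> {a..b}"
        and eq: "(\<integral>w. X (t + h) w * W w \<partial>M) - (\<integral>w. X t w * W w \<partial>M) = (\<integral>w. Y x w * W w \<partial>M) * (t + h - t)"
        by blast
      have "(\<integral>w. W w * W w \<partial>M) = ((\<integral>w. X (t + h) w * W w \<partial>M) - (\<integral>w. X t w * W w \<partial>M)) / h - (\<integral>w. Y t w * W w \<partial>M)"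
        using integral_quotient_diff_mult[OF X[OF t] X[OF th] Y[OF t] W, of h] by (simp add: W_def)
      also have "\<dots> = (\<integral>w. Y x w * W w \<partial>M) - (\<integral>w. Y t w * W w \<partial>M)"
        using eq h by simp
      also have "\<dots> = (\<integral>w. (Y x w - Y t w) * W w \<partial>M)"
        by (rule integral_diff_mult[OF Y[OF x(2)] Y[OF t] W, symmetric])
      finally have "\<bar>\<integral>w. W w * W w \<partial>M\<bar> \<le> l2norm M (\<lambda>w. Y x w - Y t w) * l2norm M W"
        using Cauchy_Schwarz_l2norm[OF square_integrable_diff[OF Y[OF x(2)] Y[OF t]] W] by simp
      moreover have "\<bar>x - t\<bar> < d"
        using segment_bound1[OF x(1)] h by simp
      ultimately have "\<bar>\<integral>w. W w * W w \<partial>M\<bar> \<le> e / 2 * l2norm M W"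
        using dY'[OF x(2)] by (meson less_imp_le mult_right_mono l2norm_nonneg order_trans)
      then have "l2norm M W \<le> e / 2"
        using e by (intro l2norm_le_by_duality) auto
      then show ?thesis
        using e by (simp add: W_def[abs_def])
    qed
    with d show "\<forall>\<^sub>F h in at 0 within {h. t + h \<in> {a..b}}.
        dist (l2norm M (\<lambda>w. (X (t + h) w - X t w) / h - Y t w)) 0 < e"
      unfolding eventually_at by blast
  qed
  then show ?thesis
    unfolding has_ms_derivative_def l2norm_tendsto_iff using X Y t by auto
qed

text \<open>Riemann sums commute with the pairing, and Cauchy-Schwarz controls the error. A constant
  gauge is a gauge, so the scalar integral is a Henstock-Kurzweil integral over the same
  divisions.\<close>

lemma ms_integral_weak:
  assumes X: "has_ms_integral M a b X Y" and Z: "square_integrable M Z"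
  shows "((\<lambda>u. \<integral>w. X u w * Z w \<partial>M) has_integral (\<integral>w. Y w * Z w \<partial>M)) {a..b}"
  unfolding has_integral_real
proof (intro allI impI)
  fix e :: real
  assume e: "e > 0"
  note Xd = has_ms_integralD[OF X]
  have "e / (l2norm M Z + 1) > 0"
    using e l2norm_nonneg[of M Z] by (intro divide_pos_pos) linarith+
  from Xd(3)[OF this] obtain d where d: "d > 0" and dX: "\<And>D. D tagged_division_of {a..b} \<Longrightarrow> (\<lambda>x. ball x d) fine D \<Longrightarrow>
        l2norm M (\<lambda>w. (\<Sum>(x, k)\<in>D. measure lborel k * X x w) - Y w) < e / (l2norm M Z + 1)"
    by blast
  have "norm ((\<Sum>(x, k)\<in>D. measure lborel k *\<^sub>R (\<integral>w. X x w * Z w \<partial>M)) - (\<integral>w. Y w * Z w \<partial>M)) < e"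
    if D: "D tagged_division_of {a..b}" "(\<lambda>x. ball x d) fine D" for D
  proof -
    have XD: "square_integrable M (X x)" if "(x, k) \<in> D" for x k
      using tagged_division_ofD(2,3)[OF D(1) that] Xd(1) by blast
    define S where "S w = (\<Sum>(x, k)\<in>D. measure lborel k * X x w)" for w
    have S: "square_integrable M S"
      unfolding S_def split_beta using XD by (intro square_integrable_sum square_integrable_scale) auto
    have "(\<integral>w. S w * Z w \<partial>M) = (\<integral>w. (\<Sum>(x, k)\<in>D. measure lborel k * (X x w * Z w)) \<partial>M)"
      by (simp add: S_def sum_distrib_right split_beta mult.assoc)
    also have "\<dots> = (\<Sum>(x, k)\<in>D. measure lborel k * (\<integral>w. X x w * Z w \<partial>M))"
      unfolding split_beta using XD Z
      by (subst Bochner_Integration.integral_sum) (auto intro!: square_integrable_mult_integrable integrable_mult_right)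
    finally have "(\<Sum>(x, k)\<in>D. measure lborel k *\<^sub>R (\<integral>w. X x w * Z w \<partial>M)) - (\<integral>w. Y w * Z w \<partial>M)
        = (\<integral>w. (S w - Y w) * Z w \<partial>M)"
      using integral_diff_mult[OF S Xd(2) Z] by simp
    then have "norm ((\<Sum>(x, k)\<in>D. measure lborel k *\<^sub>R (\<integral>w. X x w * Z w \<partial>M)) - (\<integral>w. Y w * Z w \<partial>M))
        \<le> l2norm M (\<lambda>w. S w - Y w) * l2norm M Z"
      using Cauchy_Schwarz_l2norm[OF square_integrable_diff[OF S Xd(2)] Z] by simp
    also have "\<dots> \<le> l2norm M (\<lambda>w. S w - Y w) * (l2norm M Z + 1)"
      by (intro mult_left_mono) auto
    also have "\<dots> < e"
      using dX[OF D] l2norm_nonneg[of M Z] by (simp add: S_def pos_less_divide_eq add_nonneg_pos)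
    finally show ?thesis .
  qed
  then show "\<exists>\<gamma>. gauge \<gamma> \<and> (\<forall>\<D>. \<D> tagged_division_of {a..b} \<and> \<gamma> fine \<D> \<longrightarrow>
      norm ((\<Sum>(x, k)\<in>\<D>. measure lborel k *\<^sub>R (\<integral>w. X x w * Z w \<partial>M)) - (\<integral>w. Y w * Z w \<partial>M)) < e)"
    using d gauge_ball[OF d] by blast
qed

text \<open>Pair with \<open>Y\<close> itself: its second moment is then a scalar integral over a
  single point.\<close>

lemma ms_integral_refl:
  assumes "has_ms_integral M a a X Y"
  shows "AE w in M. Y w = 0"
proof (rule l2norm_eq_0_imp_AE)
  show Y: "square_integrable M Y"
    using assms by (rule has_ms_integralD)
  have "((\<lambda>u. \<integral>w. X u w * Y w \<partial>M) has_integral (\<integral>w. Y w * Y w \<partial>M)) (cbox a a)"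
    using ms_integral_weak[OF assms Y] by simp
  from has_integral_unique[OF this has_integral_refl(1)] show "l2norm M Y = 0"
    by (simp add: l2norm_def power2_eq_square)
qed

lemma l2norm_diff_power2:
  assumes "square_integrable M X" "square_integrable M Y"
  shows "(l2norm M (\<lambda>w. X w - Y w))\<^sup>2 = (\<integral>w. X w * X w \<partial>M) - 2 * (\<integral>w. X w * Y w \<partial>M) + (\<integral>w. Y w * Y w \<partial>M)"
proof -
  have "(\<integral>w. (X w - Y w)\<^sup>2 \<partial>M) = (\<integral>w. X w * X w - 2 * (X w * Y w) + Y w * Y w \<partial>M)"
    by (intro Bochner_Integration.integral_cong) (auto simp: power2_eq_square algebra_simps)
  also have "\<dots> = (\<integral>w. X w * X w \<partial>M) - 2 * (\<integral>w. X w * Y w \<partial>M) + (\<integral>w. Y w * Y w \<partial>M)"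
    using square_integrable_mult_integrable[OF assms(1,1)] square_integrable_mult_integrable[OF assms]
      square_integrable_mult_integrable[OF assms(2,2)] by simp
  finally show ?thesis
    by (simp add: l2norm_power2)
qed

text \<open>The squared distance of \<open>X x\<close> and \<open>X y\<close> is a combination
  \<open>G\<close> of second moments, continuous on a compact square and zero on the diagonal;
  compare the point (x, y) with (x, x).\<close>

lemma l2_uniformly_continuous_Icc:
  fixes a b :: real
  assumes X: "\<And>x. x \<in> {a..b} \<Longrightarrow> square_integrable M (X x)"
    and cont: "continuous_on ({a..b} \<times> {a..b}) (\<lambda>(s, t). \<integral>w. X s w * X t w \<partial>M)"
    and e: "e > 0"
  shows "\<exists>d>0. \<forall>x\<in>{a..b}. \<forall>y\<in>{a..b}. \<bar>x - y\<bar> < d \<longrightarrow> l2norm M (\<lambda>w. X x w - X y w) < e"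
proof -
  define F where "F = (\<lambda>(s, t). \<integral>w. X s w * X t w \<partial>M)"
  define G where "G z = F (fst z, fst z) - 2 * F z + F (snd z, snd z)" for z
  have G: "G (x, y) = (l2norm M (\<lambda>w. X x w - X y w))\<^sup>2" if "x \<in> {a..b}" "y \<in> {a..b}" for x y
    using l2norm_diff_power2[OF X[OF that(1)] X[OF that(2)]] by (simp add: G_def F_def)
  have contF: "continuous_on ({a..b} \<times> {a..b}) F"
    using cont by (simp add: F_def)
  have "continuous_on ({a..b} \<times> {a..b}) G"
    unfolding G_def
    by (intro continuous_intros continuous_on_compose2[OF contF]) auto
  then have "uniformly_continuous_on ({a..b} \<times> {a..b}) G"
    by (intro compact_uniformly_continuous compact_Times) auto
  moreover have "e\<^sup>2 > 0"
    using e by simp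
  ultimately obtain d where d: "d > 0" and dG: "\<And>z z'. z \<in> {a..b} \<times> {a..b} \<Longrightarrow> z' \<in> {a..b} \<times> {a..b} \<Longrightarrow> dist z' z < d \<Longrightarrow> dist (G z') (G z) < e\<^sup>2"
    unfolding uniformly_continuous_on_def by meson
  have "l2norm M (\<lambda>w. X x w - X y w) < e" if "x \<in> {a..b}" "y \<in> {a..b}" "\<bar>x - y\<bar> < d" for x y
  proof -
    have "dist (G (x, y)) (G (x, x)) < e\<^sup>2"
      using that by (intro dG) (auto simp: dist_Pair_Pair dist_real_def)
    then have "(l2norm M (\<lambda>w. X x w - X y w))\<^sup>2 < e\<^sup>2"
      using that by (simp add: G dist_real_def l2norm_def)
    then show ?thesis
      using e by (simp add: power2_less_imp_less)
  qed
  with d show ?thesis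
    by blast
qed

section \<open>Existence of mean-square integrals and derivatives, and closed subspaces containing
  them\<close>

context prob_space
begin

text \<open>Riemann sums form a Cauchy net: paired with a test variable Z, the sums of two fine
  divisions are both close to the same scalar integral, with an error proportional to the norm of
  Z.\<close>

lemma ms_integral_exists:
  assumes X: "\<And>x. x \<in> {a..b} \<Longrightarrow> square_integrable M (X x)" and ab: "a \<le> b"
    and cont: "continuous_on ({a..b} \<times> {a..b}) (\<lambda>(s, t). \<integral>w. X s w * X t w \<partial>M)"
  shows "\<exists>Y. has_ms_integral M a b X Y"
proof -
  define S where "S D w = (\<Sum>(x, k)\<in>D. measure lborel k * X x w)" for D :: "(real \<times> real set) set" and w
  define P where "P d D \<longleftrightarrow> D tagged_division_of {a..b} \<and> (\<lambda>x. ball x d) fine D" for d and D :: "(real \<times> real set) set"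
  have XD: "square_integrable M (X x)" if "D tagged_division_of {a..b}" "(x, k) \<in> D" for D x k
    using tagged_division_ofD(2,3)[OF that] X by blast
  have S: "square_integrable M (S D)" if "P d D" for d D
    unfolding S_def split_beta using XD that
    by (intro square_integrable_sum square_integrable_scale) (auto simp: P_def)
  have SZ: "(\<integral>w. S D w * Z w \<partial>M) = (\<Sum>(x, k)\<in>D. measure lborel k * (\<integral>w. X x w * Z w \<partial>M))"
    if "P d D" "square_integrable M Z" for d D Z
  proof -
    have "(\<integral>w. S D w * Z w \<partial>M) = (\<integral>w. (\<Sum>(x, k)\<in>D. measure lborel k * (X x w * Z w)) \<partial>M)"
      by (simp add: S_def sum_distrib_right split_beta mult.assoc)
    also have "\<dots> = (\<Sum>(x, k)\<in>D. measure lborel k * (\<integral>w. X x w * Z w \<partial>M))"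
      unfolding split_beta using XD that
      by (subst Bochner_Integration.integral_sum)
        (auto intro!: square_integrable_mult_integrable integrable_mult_right simp: P_def)
    finally show ?thesis .
  qed
  have "\<exists>Y. square_integrable M Y \<and> (\<forall>e>0. \<exists>d>0. \<forall>D. P d D \<longrightarrow> l2norm M (\<lambda>w. S D w - Y w) < e)"
  proof (rule l2_Cauchy_net_converges[of P S])
    show "P d' D" if "d \<le> d'" "P d D" for d d' D
      using that subset_ball[OF that(1)] unfolding P_def fine_def split_beta by (meson order_trans)
    show "\<exists>D. P d D" if d: "d > 0" for d
    proof -
      obtain D where "D tagged_division_of {a..b}" "(\<lambda>x. ball x d) fine D"
        using fine_division_exists_real[OF gauge_ball[OF d]] by blast
      then show ?thesis
        by (auto simp: P_def)
    qed
    show "\<exists>d>0. \<forall>D D'. P d D \<longrightarrow> P d D' \<longrightarrow> l2norm M (\<lambda>w. S D w - S D' w) < e" if e: "e > 0" for e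
    proof -
      \<comment> \<open>Two comparisons with the integral cost \<open>2 * \<eta> * (b - a)\<close>,
        which is at most \<open>e / 2\<close>; the added 1 covers \<open>a = b\<close>.\<close>
      define \<eta> where "\<eta> = e / 4 / (b - a + 1)"
      have \<eta>: "\<eta> > 0"
        using e ab by (simp add: \<eta>_def)
      from l2_uniformly_continuous_Icc[OF X cont this] obtain d where d: "d > 0"
        and dX: "\<forall>x\<in>{a..b}. \<forall>y\<in>{a..b}. \<bar>x - y\<bar> < d \<longrightarrow> l2norm M (\<lambda>w. X x w - X y w) < \<eta>"
        by blast
      have "l2norm M (\<lambda>w. S D w - S D' w) < e" if DD: "P d D" "P d D'" for D D'
      proof -
        \<comment> \<open>The test variable is the quantity to be estimated. It varies with
          \<open>D\<close> and \<open>D'\<close>, but the oscillation of \<open>g\<close> relative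
          to the norm of \<open>Z\<close> is that of \<open>X\<close> and does not.\<close>
        define Z where "Z w = S D w - S D' w" for w
        have Z: "square_integrable M Z"
          unfolding Z_def using S DD by (intro square_integrable_diff)
        define g where "g x = (\<integral>w. X x w * Z w \<partial>M)" for x
        have g: "\<bar>g x - g y\<bar> \<le> l2norm M (\<lambda>w. X x w - X y w) * l2norm M Z" if "x \<in> {a..b}" "y \<in> {a..b}" for x y
          using Cauchy_Schwarz_l2norm[OF square_integrable_diff[OF X[OF that(1)] X[OF that(2)]] Z]
            integral_diff_mult[OF X[OF that(1)] X[OF that(2)] Z] by (simp add: g_def)
        have contg: "continuous_on {a..b} g"
          unfolding continuous_on_iff
        proof (intro ballI allI impI)
          fix x \<epsilon> :: real
          assume x: "x \<in> {a..b}" and "\<epsilon> > 0"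
          then have "\<epsilon> / (l2norm M Z + 1) > 0"
            using l2norm_nonneg[of M Z] by (intro divide_pos_pos) linarith+
          from l2_uniformly_continuous_Icc[OF X cont this] obtain \<delta> where \<delta>: "\<delta> > 0"
            and \<delta>X: "\<forall>x\<in>{a..b}. \<forall>y\<in>{a..b}. \<bar>x - y\<bar> < \<delta> \<longrightarrow> l2norm M (\<lambda>w. X x w - X y w) < \<epsilon> / (l2norm M Z + 1)"
            by blast
          have "dist (g y) (g x) < \<epsilon>" if "y \<in> {a..b}" "dist y x < \<delta>" for y
          proof -
            have "\<bar>g y - g x\<bar> \<le> l2norm M (\<lambda>w. X y w - X x w) * (l2norm M Z + 1)"
              using g[OF that(1) x] by (simp add: distrib_left add_increasing2)
            also have "\<dots> < \<epsilon>"
              using \<delta>X that x l2norm_nonneg[of M Z] by (simp add: pos_less_divide_eq add_nonneg_pos dist_real_def)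
            finally show ?thesis
              by (simp add: dist_real_def)
          qed
          with \<delta> show "\<exists>\<delta>>0. \<forall>y\<in>{a..b}. dist y x < \<delta> \<longrightarrow> dist (g y) (g x) < \<epsilon>"
            by blast
        qed
        have osc: "\<bar>g x - g y\<bar> \<le> \<eta> * l2norm M Z" if "x \<in> {a..b}" "y \<in> {a..b}" "\<bar>x - y\<bar> < d" for x y
        proof -
          have "l2norm M (\<lambda>w. X x w - X y w) * l2norm M Z \<le> \<eta> * l2norm M Z"
            using dX that by (intro mult_right_mono) (auto simp: less_imp_le)
          with g[OF that(1,2)] show ?thesis
            by linarith
        qed
        have R: "\<bar>(\<integral>w. S D w * Z w \<partial>M) - integral {a..b} g\<bar> \<le> \<eta> * l2norm M Z * (b - a)" if "P d D" for D
        proof -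
          have "0 \<le> \<eta> * l2norm M Z"
            using \<eta> by simp
          with that have "\<bar>(\<Sum>(x, k)\<in>D. measure lborel k * g x) - integral {a..b} g\<bar> \<le> \<eta> * l2norm M Z * (b - a)"
            by (intro integral_Riemann_sum_bound[OF contg ab osc]) (auto simp only: P_def)
          then show ?thesis
            by (simp only: SZ[OF that Z] g_def)
        qed
        have "(\<integral>w. Z w * Z w \<partial>M) = (\<integral>w. S D w * Z w \<partial>M) - (\<integral>w. S D' w * Z w \<partial>M)"
          using integral_diff_mult[OF S[OF DD(1)] S[OF DD(2)] Z] by (simp only: Z_def)
        then have "\<bar>\<integral>w. Z w * Z w \<partial>M\<bar> \<le> (2 * \<eta> * (b - a)) * l2norm M Z"
          using R[OF DD(1)] R[OF DD(2)] by (simp only: mult_ac)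
        then have "l2norm M Z \<le> 2 * \<eta> * (b - a)"
          using \<eta> ab by (intro l2norm_le_by_duality) auto
        also have "\<dots> \<le> 2 * (\<eta> * (b - a + 1))"
          using \<eta> by (simp add: algebra_simps)
        also have "\<eta> * (b - a + 1) = e / 4"
          using ab nonzero_eq_divide_eq[of "b - a + 1" \<eta> "e / 4"] by (simp add: \<eta>_def)
        also have "2 * (e / 4) < e"
          using e by simp
        finally show ?thesis
          by (simp add: Z_def[abs_def])
      qed
      with d show ?thesis
        by blast
    qed
  qed (rule S)
  then obtain Y where Y: "square_integrable M Y"
    and lim: "\<And>e. e > 0 \<Longrightarrow> \<exists>d>0. \<forall>D. P d D \<longrightarrow> l2norm M (\<lambda>w. S D w - Y w) < e"
    by blast
  have "has_ms_integral M a b X Y"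
    unfolding has_ms_integral_def
  proof (intro conjI allI impI ballI)
    fix e :: real
    assume e: "e > 0"
    from lim[of "sqrt e"] e obtain d where d: "d > 0" "\<forall>D. P d D \<longrightarrow> l2norm M (\<lambda>w. S D w - Y w) < sqrt e"
      by auto
    then show "\<exists>d>0. \<forall>D. D tagged_division_of {a..b} \<and> (\<lambda>x. ball x d) fine D \<longrightarrow>
        (\<integral>w. ((\<Sum>(x, k)\<in>D. measure lborel k * X x w) - Y w)\<^sup>2 \<partial>M) < e"
      using e by (intro exI[of _ d]) (auto simp: P_def S_def l2norm_less_iff)
  qed (use X Y in auto)
  then show ?thesis
    by blast
qed

text \<open>Loeve's criterion: the inner product of two difference quotients of \<open>X\<close> is
  a second difference quotient of \<open>F\<close>, which tends to \<open>F12 t t\<close> as both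
  increments vanish independently. Expanding the squared distance, the limits cancel as 1 - 2 +
  1.\<close>

lemma ms_derivative_exists:
  assumes ab: "a < b" and X: "\<And>x. x \<in> {a..b} \<Longrightarrow> square_integrable M (X x)"
    and F: "\<And>s t. s \<in> {a..b} \<Longrightarrow> t \<in> {a..b} \<Longrightarrow> (\<integral>w. X s w * X t w \<partial>M) = F s t"
    and F2: "\<And>s t. s \<in> {a..b} \<Longrightarrow> t \<in> {a..b} \<Longrightarrow> ((\<lambda>y. F s y) has_vector_derivative F2 s t) (at t within {a..b})"
    and F12: "\<And>s t. s \<in> {a..b} \<Longrightarrow> t \<in> {a..b} \<Longrightarrow> ((\<lambda>x. F2 x t) has_vector_derivative F12 s t) (at s within {a..b})"
    and cont12: "continuous_on ({a..b} \<times> {a..b}) (\<lambda>(s, t). F12 s t)"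
    and t: "t \<in> {a..b}"
  shows "\<exists>Y. has_ms_derivative M {a..b} X Y t"
proof -
  define Q where "Q h w = (X (t + h) w - X t w) / h" for h w
  define P where "P d h \<longleftrightarrow> h \<noteq> 0 \<and> \<bar>h\<bar> < d \<and> t + h \<in> {a..b}" for d h
  have Q: "square_integrable M (Q h)" if "P d h" for d h
    unfolding Q_def using that t by (intro square_integrable_divide square_integrable_diff X) (auto simp: P_def)
  have QQ: "(\<integral>w. Q h w * Q k w \<partial>M) = (F (t + h) (t + k) - F t (t + k) - (F (t + h) t - F t t)) / (h * k)"
    if "P d h" "P d k" for d h k
  proof -
    from that have th: "t + h \<in> {a..b}" and tk: "t + k \<in> {a..b}" and hk: "h \<noteq> 0" "k \<noteq> 0"
      by (auto simp: P_def)
    define Z where "Z w = X (t + h) w - X t w" for w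
    have Z: "square_integrable M Z"
      unfolding Z_def using th t by (intro square_integrable_diff X)
    have ZX: "(\<integral>w. X s w * Z w \<partial>M) = F (t + h) s - F t s" if "s \<in> {a..b}" for s
      using integral_diff_mult[OF X[OF th] X[OF t] X[OF that]] F[OF th that] F[OF t that]
      by (simp add: Z_def mult.commute)
    have "(\<integral>w. Q h w * Q k w \<partial>M) = (\<integral>w. (X (t + k) w - X t w) * Z w / (h * k) \<partial>M)"
      unfolding Q_def Z_def by (intro Bochner_Integration.integral_cong) (auto simp: field_simps)
    also have "\<dots> = (\<integral>w. (X (t + k) w - X t w) * Z w \<partial>M) / (h * k)"
      by simp
    also have "(\<integral>w. (X (t + k) w - X t w) * Z w \<partial>M) = F (t + h) (t + k) - F t (t + k) - (F (t + h) t - F t t)"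
      unfolding integral_diff_mult[OF X[OF tk] X[OF t] Z] ZX[OF tk] ZX[OF t] by simp
    finally show ?thesis .
  qed
  have "\<exists>Y. square_integrable M Y \<and> (\<forall>e>0. \<exists>d>0. \<forall>h. P d h \<longrightarrow> l2norm M (\<lambda>w. Q h w - Y w) < e)"
  proof (rule l2_Cauchy_net_converges[of P Q])
    show "P d' h" if "d \<le> d'" "P d h" for d d' h
      using that by (auto simp: P_def)
    show "\<exists>h. P d h" if "d > 0" for d
    \<comment> \<open>Admissible increments of every size bound must exist, also at the endpoint
      \<open>b\<close>, where only negative ones remain in the interval.\<close>
    proof (cases "t < b")
      case True
      then show ?thesis
        using that t by (intro exI[of _ "min (d / 2) (b - t)"]) (auto simp: P_def min_def)
    next
      case False
      then show ?thesis
        using that t ab by (intro exI[of _ "- min (d / 2) (b - a)"]) (auto simp: P_def min_def)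
    qed
    show "\<exists>d>0. \<forall>h k. P d h \<longrightarrow> P d k \<longrightarrow> l2norm M (\<lambda>w. Q h w - Q k w) < e" if e: "e > 0" for e
    proof -
      \<comment> \<open>The expansion of the squared distance contains three inner products with
        weights 1, 2 and 1, hence four errors.\<close>
      have "e\<^sup>2 / 4 > 0"
        using e by simp
      from second_difference_quotient[where F = F and ?F2.0 = F2 and ?F12.0 = F12, OF F2 F12 cont12 t this] obtain d where d: "d > 0"
        and dF: "\<And>h k. h \<noteq> 0 \<Longrightarrow> k \<noteq> 0 \<Longrightarrow> \<bar>h\<bar> < d \<Longrightarrow> \<bar>k\<bar> < d \<Longrightarrow> t + h \<in> {a..b} \<Longrightarrow> t + k \<in> {a..b} \<Longrightarrow>
          \<bar>(F (t + h) (t + k) - F t (t + k) - (F (t + h) t - F t t)) / (h * k) - F12 t t\<bar> < e\<^sup>2 / 4"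
        by blast
      have QF: "\<bar>(\<integral>w. Q h w * Q k w \<partial>M) - F12 t t\<bar> < e\<^sup>2 / 4" if "P d h" "P d k" for h k
        unfolding QQ[OF that] using that by (intro dF) (auto simp: P_def)
      have "l2norm M (\<lambda>w. Q h w - Q k w) < e" if hk: "P d h" "P d k" for h k
      proof -
        have "(l2norm M (\<lambda>w. Q h w - Q k w))\<^sup>2 < e\<^sup>2"
          unfolding l2norm_diff_power2[OF Q[OF hk(1)] Q[OF hk(2)]]
          using QF[OF hk(1,1)] QF[OF hk] QF[OF hk(2,2)] unfolding abs_less_iff by linarith
        then show ?thesis
          using e by (simp add: power2_less_imp_less)
      qed
      with d show ?thesis
        by blast
    qed
  qed (rule Q)
  then obtain Y where Y: "square_integrable M Y"
    and lim: "\<And>e. e > 0 \<Longrightarrow> \<exists>d>0. \<forall>h. P d h \<longrightarrow> l2norm M (\<lambda>w. Q h w - Y w) < e"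
    by blast
  have "((\<lambda>h. l2norm M (\<lambda>w. (X (t + h) w - X t w) / h - Y w)) \<longlongrightarrow> 0) (at 0 within {h. t + h \<in> {a..b}})"
  proof (rule tendstoI)
    fix e :: real
    assume "e > 0"
    from lim[OF this] obtain d where d: "d > 0" and dl: "\<And>h. P d h \<Longrightarrow> l2norm M (\<lambda>w. Q h w - Y w) < e"
      by blast
    have "dist (l2norm M (\<lambda>w. (X (t + h) w - X t w) / h - Y w)) 0 < e"
      if "h \<noteq> 0" "dist h 0 < d" "h \<in> {h. t + h \<in> {a..b}}" for h
    proof -
      have "P d h"
        using that by (simp add: P_def)
      from dl[OF this] show ?thesis
        by (simp add: Q_def)
    qed
    with d show "\<forall>\<^sub>F h in at 0 within {h. t + h \<in> {a..b}}.
        dist (l2norm M (\<lambda>w. (X (t + h) w - X t w) / h - Y w)) 0 < e"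
      unfolding eventually_at by blast
  qed
  then have "has_ms_derivative M {a..b} X Y t"
    unfolding has_ms_derivative_def l2norm_tendsto_iff using X Y by auto
  then show ?thesis
    by blast
qed

lemma l2_closed_ms_derivative:
  assumes scale: "\<And>W c. W \<in> H \<Longrightarrow> (\<lambda>w. c * W w) \<in> H"
    and add: "\<And>U W. U \<in> H \<Longrightarrow> W \<in> H \<Longrightarrow> (\<lambda>w. U w + W w) \<in> H"
    and closed: "\<And>Z. Z \<in> l2_closure H \<Longrightarrow> Z \<in> H"
    and ab: "a < b" and t: "t \<in> {a..b}" and X: "\<And>x. x \<in> {a..b} \<Longrightarrow> X x \<in> H"
    and D: "has_ms_derivative M {a..b} X Y t"
  shows "Y \<in> H"
proof (rule closed, rule l2_closureI)
  note Xd = has_ms_derivativeD[OF D]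
  show Y: "square_integrable M Y"
    by (rule Xd)
  fix e :: real
  assume "e > 0"
  from tendstoD[OF Xd(3) this] obtain d where d: "d > 0"
    and dX: "\<forall>h\<in>{h. t + h \<in> {a..b}}. h \<noteq> 0 \<and> dist h 0 < d \<longrightarrow> dist (l2norm M (\<lambda>w. (X (t + h) w - X t w) / h - Y w)) 0 < e"
    unfolding eventually_at by blast
  obtain h where h: "t + h \<in> {a..b}" "h \<noteq> 0" "\<bar>h\<bar> < d"
  proof (cases "t < b")
    case True
    then show thesis
      using d t by (intro that[of "min (d / 2) (b - t)"]) (auto simp: min_def)
  next
    case False
    then show thesis
      using d t ab by (intro that[of "- min (d / 2) (b - a)"]) (auto simp: min_def)
  qed
  have "(\<lambda>w. (1 / h) * X (t + h) w + (- 1 / h) * X t w) \<in> H"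
    using h t by (intro add scale X)
  also have "(\<lambda>w. (1 / h) * X (t + h) w + (- 1 / h) * X t w) = (\<lambda>w. (X (t + h) w - X t w) / h)"
    by (simp add: diff_divide_distrib)
  finally show "\<exists>W\<in>H. square_integrable M W \<and> l2norm M (\<lambda>w. Y w - W w) < e"
    using dX h t square_integrable_divide[OF square_integrable_diff[OF Xd(1)[OF h(1)] Xd(1)[OF t]]]
    by (intro bexI[of _ "\<lambda>w. (X (t + h) w - X t w) / h"]) (auto simp: l2norm_minus_commute[of M Y])
qed

lemma closed_sum:
  assumes zero: "(\<lambda>_. 0) \<in> H" and add: "\<And>U W. U \<in> H \<Longrightarrow> W \<in> H \<Longrightarrow> (\<lambda>w. U w + W w) \<in> H"
    and X: "\<And>i. i \<in> I \<Longrightarrow> X i \<in> H"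
  shows "(\<lambda>w. \<Sum>i\<in>I. X i w :: real) \<in> H"
  using X
proof (induction I rule: infinite_finite_induct)
  case (insert i I)
  then show ?case
    using add[of "X i" "\<lambda>w. \<Sum>i\<in>I. X i w"] by simp
qed (use zero in auto)

text \<open>Fine divisions exist for every mesh (Cousin's lemma), and their Riemann sums are finite
  linear combinations of members of \<open>H\<close> close to \<open>Y\<close>.\<close>

lemma l2_closed_ms_integral:
  assumes scale: "\<And>W c. W \<in> H \<Longrightarrow> (\<lambda>w. c * W w) \<in> H"
    and zero: "(\<lambda>_. 0) \<in> H" and add: "\<And>U W. U \<in> H \<Longrightarrow> W \<in> H \<Longrightarrow> (\<lambda>w. U w + W w) \<in> H"
    and closed: "\<And>Z. Z \<in> l2_closure H \<Longrightarrow> Z \<in> H"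
    and X: "\<And>x. x \<in> {a..b} \<Longrightarrow> X x \<in> H"
    and I: "has_ms_integral M a b X Y"
  shows "Y \<in> H"
proof (rule closed, rule l2_closureI)
  note Xd = has_ms_integralD[OF I]
  show Y: "square_integrable M Y"
    by (rule Xd)
  fix e :: real
  assume "e > 0"
  from Xd(3)[OF this] obtain d where d: "d > 0"
    and dX: "\<forall>D. D tagged_division_of {a..b} \<and> (\<lambda>x. ball x d) fine D \<longrightarrow>
        l2norm M (\<lambda>w. (\<Sum>(x, k)\<in>D. measure lborel k * X x w) - Y w) < e"
    by blast
  obtain D where D: "D tagged_division_of {a..b}" "(\<lambda>x. ball x d) fine D"
    using fine_division_exists_real[OF gauge_ball[OF d], of a b] by blast
  have tags: "x \<in> {a..b}" if "(x, k) \<in> D" for x k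
    using tagged_division_ofD(2,3)[OF D(1) that] by blast
  have "(\<lambda>w. \<Sum>(x, k)\<in>D. measure lborel k * X x w) \<in> H"
    unfolding split_beta using tags by (intro closed_sum zero add scale X) auto
  moreover have "square_integrable M (\<lambda>w. \<Sum>(x, k)\<in>D. measure lborel k * X x w)"
    unfolding split_beta using tags by (intro square_integrable_sum square_integrable_scale Xd(1)) auto
  ultimately show "\<exists>W\<in>H. square_integrable M W \<and> l2norm M (\<lambda>w. Y w - W w) < e"
    using dX D l2norm_minus_commute[of M Y] by (intro bexI[of _ "\<lambda>w. \<Sum>(x, k)\<in>D. measure lborel k * X x w"]) auto
qed

end

section \<open>Gaussian vectors and processes\<close>

context prob_space
begin

text \<open>Centering one factor suffices. A covariance thus becomes the pairing of one variable
  with a fixed centered one, on either side as convenient, so linear results on pairings apply to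
  it.\<close>

lemma covariance_eq:
  assumes X: "square_integrable M X" and Y: "square_integrable M Y"
  shows "covariance M X Y = expectation (\<lambda>w. X w * (Y w - expectation Y))"
    and "covariance M X Y = expectation (\<lambda>w. Y w * (X w - expectation X))"
    and "covariance M X Y = expectation (\<lambda>w. X w * Y w) - expectation X * expectation Y"
proof -
  have *: "covariance M X Y = expectation (\<lambda>w. X w * (Y w - expectation Y))"
    if X: "square_integrable M X" and Y: "square_integrable M Y" for X Y
  proof -
    have Yc: "square_integrable M (\<lambda>w. Y w - expectation Y)"
      by (intro square_integrable_diff square_integrable_const Y)
    have "covariance M X Y = expectation (\<lambda>w. X w * (Y w - expectation Y)) - expectation (\<lambda>w. expectation X * (Y w - expectation Y))"
      unfolding covariance_def by (rule integral_diff_mult[OF X square_integrable_const Yc])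
    also have "expectation (\<lambda>w. expectation X * (Y w - expectation Y)) = expectation X * (expectation Y - expectation Y)"
      using square_integrable_integrable[OF Y] by (simp add: prob_space)
    finally show ?thesis
      by simp
  qed
  show "covariance M X Y = expectation (\<lambda>w. X w * (Y w - expectation Y))"
    by (rule *[OF X Y])
  then have "covariance M X Y = expectation (\<lambda>w. X w * Y w - X w * expectation Y)"
    by (simp add: right_diff_distrib)
  then show "covariance M X Y = expectation (\<lambda>w. X w * Y w) - expectation X * expectation Y"
    using square_integrable_mult_integrable[OF X Y] square_integrable_integrable[OF X] by simp
  have "covariance M X Y = covariance M Y X"
    by (simp add: covariance_def mult.commute)
  then show "covariance M X Y = expectation (\<lambda>w. Y w * (X w - expectation X))"
    using *[OF Y X] by simp
qed

lemma gaussian_vector_component: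
  assumes "gaussian_vector M J X" "j \<in> J"
  shows "square_integrable M (X j)"
proof -
  have J: "finite J"
    using assms by (simp add: gaussian_vector_def)
  have "(\<Sum>i\<in>J. (if i = j then 1 else 0) * X i w) = X j w" for w
    using J assms(2) by (simp add: if_distrib[of "\<lambda>x. x * _"] cong: if_cong)
  moreover obtain m v where "normal_rv M (\<lambda>w. \<Sum>i\<in>J. (if i = j then 1 else 0) * X i w) m v"
    using assms unfolding gaussian_vector_def by meson
  ultimately show ?thesis
    using normal_rv_moments(2) by simp
qed

text \<open>\<open>\<phi>\<close> may repeat indices: coefficients with the same image are added,
  and the linear combination stays one of the original vector.\<close>

lemma gaussian_vector_reindex:
  assumes X: "gaussian_vector M K X" and L: "finite L" and \<phi>: "\<And>i. i \<in> L \<Longrightarrow> \<phi> i \<in> K"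
  shows "gaussian_vector M L (\<lambda>i. X (\<phi> i))"
  unfolding gaussian_vector_def
proof (intro conjI ballI allI)
  fix a
  have K: "finite K"
    using X by (simp add: gaussian_vector_def)
  have "(\<Sum>k\<in>K. (\<Sum>i\<in>{i \<in> L. \<phi> i = k}. a i) * X k w) = (\<Sum>i\<in>L. a i * X (\<phi> i) w)" for w
  proof -
    have "(\<Sum>k\<in>K. (\<Sum>i\<in>{i \<in> L. \<phi> i = k}. a i) * X k w) = (\<Sum>k\<in>K. \<Sum>i\<in>{i \<in> L. \<phi> i = k}. a i * X (\<phi> i) w)"
      unfolding sum_distrib_right by (intro sum.cong) auto
    also have "\<dots> = (\<Sum>i\<in>L. a i * X (\<phi> i) w)"
      using \<phi> by (intro sum.group L K) auto
    finally show ?thesis .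
  qed
  moreover obtain m v where "normal_rv M (\<lambda>w. \<Sum>k\<in>K. (\<Sum>i\<in>{i \<in> L. \<phi> i = k}. a i) * X k w) m v"
    using X unfolding gaussian_vector_def by meson
  ultimately show "\<exists>m v. normal_rv M (\<lambda>w. \<Sum>i\<in>L. a i * X (\<phi> i) w) m v"
    by auto
qed (use X L \<phi> in \<open>auto simp: gaussian_vector_def\<close>)

lemma multivariate_normal_reindex:
  assumes "multivariate_normal M K X m S" and "finite L" and "\<And>i. i \<in> L \<Longrightarrow> \<phi> i \<in> K"
  shows "multivariate_normal M L (\<lambda>i. X (\<phi> i)) (\<lambda>i. m (\<phi> i)) (\<lambda>i j. S (\<phi> i) (\<phi> j))"
  using assms gaussian_vector_reindex[of K X L \<phi>] by (simp add: multivariate_normal_def)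

text \<open>The joint characteristic function at \<open>a\<close> is that of a scalar normal
  variable at 1, whose mean and variance follow bilinearly from \<open>m\<close> and
  \<open>S\<close>. Hence it depends on these alone.\<close>

lemma multivariate_normal_char:
  assumes X: "multivariate_normal M J X m S"
  shows "(CLINT w|M. iexp (\<Sum>j\<in>J. a j * X j w)) = normal_char (\<Sum>j\<in>J. a j * m j) (\<Sum>i\<in>J. \<Sum>j\<in>J. a i * a j * S i j) 1"
proof -
  have gv: "gaussian_vector M J X" and mean: "\<And>j. j \<in> J \<Longrightarrow> expectation (X j) = m j"
    and cov: "\<And>i j. i \<in> J \<Longrightarrow> j \<in> J \<Longrightarrow> covariance M (X i) (X j) = S i j"
    using X by (auto simp: multivariate_normal_def)
  have sq: "square_integrable M (X j)" if "j \<in> J" for j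
    by (rule gaussian_vector_component[OF gv that])
  obtain m' v where N: "normal_rv M (\<lambda>w. \<Sum>j\<in>J. a j * X j w) m' v"
    using gv unfolding gaussian_vector_def by meson
  have m': "m' = (\<Sum>j\<in>J. a j * m j)"
    unfolding normal_rv_moments(3)[OF N, symmetric]
    using sq mean by (subst Bochner_Integration.integral_sum) (auto simp: square_integrable_integrable)
  have sqc: "square_integrable M (\<lambda>w. X j w - m j)" if "j \<in> J" for j
    by (intro square_integrable_diff square_integrable_const sq that)
  have "v = expectation (\<lambda>w. ((\<Sum>j\<in>J. a j * X j w) - (\<Sum>j\<in>J. a j * m j))\<^sup>2)"
    using normal_rv_moments(4)[OF N] normal_rv_moments(3)[OF N] m' by simp
  also have "\<dots> = expectation (\<lambda>w. \<Sum>i\<in>J. \<Sum>j\<in>J. a i * a j * ((X i w - m i) * (X j w - m j)))"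
    unfolding sum_subtractf[symmetric] right_diff_distrib[symmetric] power2_eq_square sum_product
    by (simp add: mult_ac)
  also have "\<dots> = (\<Sum>i\<in>J. \<Sum>j\<in>J. a i * a j * expectation (\<lambda>w. (X i w - m i) * (X j w - m j)))"
    using square_integrable_mult_integrable[OF sqc sqc]
    by (subst Bochner_Integration.integral_sum) (auto simp: Bochner_Integration.integral_sum)
  also have "\<dots> = (\<Sum>i\<in>J. \<Sum>j\<in>J. a i * a j * S i j)"
    using cov mean by (intro sum.cong refl) (simp add: covariance_def)
  finally have v: "v = (\<Sum>i\<in>J. \<Sum>j\<in>J. a i * a j * S i j)" .
  have [measurable]: "(\<lambda>w. \<Sum>j\<in>J. a j * X j w) \<in> borel_measurable M"
    using N by (simp add: normal_rv_def)
  show ?thesis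
    using normal_rv_char[OF N, of 1] unfolding m' v by (simp add: char_def integral_distr)
qed

end

text \<open>The definition speaks of full blocks \<open>P \<times> J\<close>; reindexing selects the
  finitely many requested pairs, possibly repeated, and equal joint characteristic functions give
  equal laws.\<close>

lemma vector_gaussian_process_law_unique:
  fixes M :: "'a measure" and N :: "'b measure" and p :: "'i \<Rightarrow> 'p" and \<tau> :: "'i \<Rightarrow> 't"
  assumes M: "prob_space M" and N: "prob_space N" and P: "finite P"
    and f: "vector_gaussian_process M P T f m K" and g: "vector_gaussian_process N P T g m K"
    and L: "finite L" and p: "\<And>i. i \<in> L \<Longrightarrow> p i \<in> P \<and> \<tau> i \<in> T"
  shows "distr M (\<Pi>\<^sub>M i\<in>L. borel) (\<lambda>w. \<lambda>i\<in>L. f (p i) (\<tau> i) w) = distr N (\<Pi>\<^sub>M i\<in>L. borel) (\<lambda>w. \<lambda>i\<in>L. g (p i) (\<tau> i) w)"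
proof -
  interpret M: prob_space M by (rule M)
  interpret N: prob_space N by (rule N)
  have J: "finite (\<tau> ` L)" "\<tau> ` L \<subseteq> T"
    using L p by auto
  have "multivariate_normal M (P \<times> \<tau> ` L) (\<lambda>(p, t). f p t) (\<lambda>(p, t). m p t) (\<lambda>(p, s) (q, t). K p q s t)"
    using f J by (simp add: vector_gaussian_process_def)
  from M.multivariate_normal_reindex[OF this L, of "\<lambda>i. (p i, \<tau> i)"] p
  have f: "multivariate_normal M L (\<lambda>i. f (p i) (\<tau> i)) (\<lambda>i. m (p i) (\<tau> i)) (\<lambda>i j. K (p i) (p j) (\<tau> i) (\<tau> j))"
    by simp
  have "multivariate_normal N (P \<times> \<tau> ` L) (\<lambda>(p, t). g p t) (\<lambda>(p, t). m p t) (\<lambda>(p, s) (q, t). K p q s t)"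
    using g J by (simp add: vector_gaussian_process_def)
  from N.multivariate_normal_reindex[OF this L, of "\<lambda>i. (p i, \<tau> i)"] p
  have g: "multivariate_normal N L (\<lambda>i. g (p i) (\<tau> i)) (\<lambda>i. m (p i) (\<tau> i)) (\<lambda>i j. K (p i) (p j) (\<tau> i) (\<tau> j))"
    by simp
  show ?thesis
  proof (rule Cramer_Wold_char[OF M N L])
    show "(CLINT w|M. iexp (\<Sum>i\<in>L. a i * f (p i) (\<tau> i) w)) = (CLINT w|N. iexp (\<Sum>i\<in>L. a i * g (p i) (\<tau> i) w))" for a
      unfolding M.multivariate_normal_char[OF f] N.multivariate_normal_char[OF g] ..
  qed (use f g in \<open>auto simp: multivariate_normal_def gaussian_vector_def\<close>)
qed

section \<open>Independence of linear combinations\<close>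

lemma sets_vimage_algebra_superset:
  assumes "A \<in> borel_measurable (vimage_algebra \<Omega> X N)"
  shows "sigma_sets \<Omega> {A -` B \<inter> \<Omega> | B. B \<in> sets borel} \<subseteq> sets (vimage_algebra \<Omega> X N)"
proof -
  have "{A -` B \<inter> \<Omega> | B. B \<in> sets borel} \<subseteq> sets (vimage_algebra \<Omega> X N)"
    using measurable_sets[OF assms] by auto
  from sets.sigma_sets_subset[OF this] show ?thesis
    by simp
qed

lemma linear_combination_measurable_vimage_algebra:
  fixes X :: "'s \<Rightarrow> 'a \<Rightarrow> real"
  assumes "S \<subseteq> T"
  shows "(\<lambda>w. \<Sum>s\<in>S. c s * X s w) \<in> borel_measurable (vimage_algebra \<Omega> (\<lambda>w. \<lambda>s\<in>T. X s w) (\<Pi>\<^sub>M s\<in>T. borel))"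
proof -
  have m: "(\<lambda>w. \<lambda>s\<in>T. X s w) \<in> measurable (vimage_algebra \<Omega> (\<lambda>w. \<lambda>s\<in>T. X s w) (\<Pi>\<^sub>M s\<in>T. borel)) (\<Pi>\<^sub>M s\<in>T. borel)"
    by (rule measurable_vimage_algebra1) (auto simp: space_PiM)
  have "X s \<in> borel_measurable (vimage_algebra \<Omega> (\<lambda>w. \<lambda>s\<in>T. X s w) (\<Pi>\<^sub>M s\<in>T. borel))" if "s \<in> T" for s
    using measurable_compose[OF m measurable_component_singleton[OF that]] that by simp
  then show ?thesis
    using assms by (intro borel_measurable_sum borel_measurable_times) auto
qed

text \<open>A linear combination is measurable for the sigma-algebra generated by its process, so
  its own sigma-algebra is a smaller one, and independence is inherited.\<close>

lemma (in prob_space) indep_processes_linear_combinations: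
  assumes ind: "indep_processes M T X T' X'"
    and meas: "\<And>s. s \<in> T \<Longrightarrow> X s \<in> borel_measurable M" "\<And>s. s \<in> T' \<Longrightarrow> X' s \<in> borel_measurable M"
    and S: "S \<subseteq> T" "S' \<subseteq> T'"
  shows "indep_var borel (\<lambda>w. \<Sum>s\<in>S. c s * X s w) borel (\<lambda>w. \<Sum>s\<in>S'. c' s * X' s w)"
  unfolding indep_var_eq
proof (intro conjI)
  show "indep_set
     (sigma_sets (space M) {(\<lambda>w. \<Sum>s\<in>S. c s * X s w) -` A \<inter> space M |A. A \<in> sets borel})
     (sigma_sets (space M) {(\<lambda>w. \<Sum>s\<in>S'. c' s * X' s w) -` A \<inter> space M |A. A \<in> sets borel})"
    using ind[unfolded indep_processes_def indep_set_def] unfolding indep_set_def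
    by (rule indep_sets_mono_sets)
      (auto split: bool.split dest!: subsetD[OF sets_vimage_algebra_superset[OF linear_combination_measurable_vimage_algebra[OF S(1)]]]
        subsetD[OF sets_vimage_algebra_superset[OF linear_combination_measurable_vimage_algebra[OF S(2)]]])
qed (use meas S in \<open>auto intro!: borel_measurable_sum\<close>)

section \<open>The deterministic counterpart of the construction\<close>

lemma signed_op_cong:
  assumes "\<And>x. x \<in> {t0..t1} \<Longrightarrow> g x = h x" "t \<in> {t0..t1}"
  shows "signed_op t0 t1 p g t = signed_op t0 t1 p h t"
  using assms deriv_on_funpow_cong[OF assms] cauchy_integral_cong[of t0 t g h] by (auto simp: signed_op_def)

lemma signed_op_zero:
  assumes "t0 < t1" "t \<in> {t0..t1}"
  shows "signed_op t0 t1 p (\<lambda>_. 0) t = 0"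
  using deriv_on_funpow_zero[OF assms] by (simp add: signed_op_def cauchy_integral_def)

text \<open>\<open>ensemble_mean\<close> serves below as a linear operator on arbitrary scalar data,
  not only on means: its arguments will be the pairings of \<open>f0\<close> and
  \<open>\<kappa>\<close> with a test variable. These are known only on the interval and for the
  indices up to \<open>p\<close>.\<close>

lemma ensemble_mean_cong:
  assumes "\<And>x. x \<in> {t0..t1} \<Longrightarrow> g x = h x" "\<And>j. j \<in> {1..nat p} \<Longrightarrow> c j = d j" "t \<in> {t0..t1}"
  shows "ensemble_mean t0 t1 g c p t = ensemble_mean t0 t1 h d p t"
  using signed_op_cong[OF assms(1,3)] assms(2) by (auto simp: ensemble_mean_def intro!: sum.cong)

lemma ensemble_mean_zero:
  assumes "t0 < t1" "t \<in> {t0..t1}"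
  shows "ensemble_mean t0 t1 (\<lambda>_. 0) (\<lambda>_. 0) p t = 0"
  using signed_op_zero[OF assms] by (simp add: ensemble_mean_def)

lemma ensemble_mean_of_nat:
  "ensemble_mean t0 t1 g c (int q) t = cauchy_integral t0 q g t + (\<Sum>j = 1..q. (t - t0) ^ (q - j) / fact (q - j) * c j)"
  by (simp add: ensemble_mean_def signed_op_def)

lemma ensemble_mean_of_neg_nat:
  "ensemble_mean t0 t1 g c (- int k) t = (deriv_on {t0..t1} ^^ k) g t"
  by (cases "k = 0") (simp_all add: ensemble_mean_def signed_op_def)

section \<open>The Gaussian space of the ensemble\<close>

lemma at_0_within_shifted_interior:
  fixes t :: real
  assumes "t \<in> {a<..<b}"
  shows "at 0 within {h. t + h \<in> {a..b}} = at 0"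
proof (rule at_within_nhd)
  show "(0::real) \<in> {a - t<..<b - t}" "open {a - t<..<b - t}"
    using assms by auto
qed auto

locale gaussian_ensemble = prob_space M for M :: "'a measure" +
  fixes r :: nat and t0 t1 :: real and f0 :: "real \<Rightarrow> 'a \<Rightarrow> real" and \<mu> :: "real \<Rightarrow> real"
    and C :: "real \<Rightarrow> real \<Rightarrow> real" and \<kappa> :: "nat \<Rightarrow> 'a \<Rightarrow> real" and m\<^sub>\<kappa> :: "nat \<Rightarrow> real"
    and S\<^sub>\<kappa> :: "nat \<Rightarrow> nat \<Rightarrow> real"
  assumes t01: "t0 < t1"
    and gp: "gaussian_process M {t0..t1} f0 \<mu> C"
    and \<mu>: "C_on r {t0..t1} \<mu>"
    and C: "C2_on r r {t0..t1} C"
    and mn: "multivariate_normal M {1..r} \<kappa> m\<^sub>\<kappa> S\<^sub>\<kappa>"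
    and ind: "indep_processes M {t0..t1} f0 {1..r} \<kappa>"
begin

lemma f0_pair:
  assumes "s \<in> {t0..t1}" "t \<in> {t0..t1}"
  shows "multivariate_normal M {s, t} f0 \<mu> C"
  using gp assms by (simp add: gaussian_process_def)

lemma f0_square_integrable: "t \<in> {t0..t1} \<Longrightarrow> square_integrable M (f0 t)"
  using f0_pair[of t t] gaussian_vector_component[of "{t}" f0 t] by (auto simp: multivariate_normal_def)

lemma f0_mean: "t \<in> {t0..t1} \<Longrightarrow> expectation (f0 t) = \<mu> t"
  using f0_pair[of t t] by (auto simp: multivariate_normal_def)

lemma f0_cov: "s \<in> {t0..t1} \<Longrightarrow> t \<in> {t0..t1} \<Longrightarrow> covariance M (f0 s) (f0 t) = C s t"
  using f0_pair[of s t] by (auto simp: multivariate_normal_def)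

lemma kappa_square_integrable: "j \<in> {1..r} \<Longrightarrow> square_integrable M (\<kappa> j)"
  using mn gaussian_vector_component[of "{1..r}" \<kappa> j] by (auto simp: multivariate_normal_def)

lemma kappa_mean: "j \<in> {1..r} \<Longrightarrow> expectation (\<kappa> j) = m\<^sub>\<kappa> j"
  using mn by (auto simp: multivariate_normal_def)

lemma kappa_cov: "i \<in> {1..r} \<Longrightarrow> j \<in> {1..r} \<Longrightarrow> covariance M (\<kappa> i) (\<kappa> j) = S\<^sub>\<kappa> i j"
  using mn by (auto simp: multivariate_normal_def)

lemma indep_f0_kappa:
  assumes "S \<subseteq> {t0..t1}" "S' \<subseteq> {1..r}"
  shows "indep_var borel (\<lambda>w. \<Sum>s\<in>S. c s * f0 s w) borel (\<lambda>w. \<Sum>j\<in>S'. d j * \<kappa> j w)"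
  using ind f0_square_integrable kappa_square_integrable assms
  by (intro indep_processes_linear_combinations[where T = "{t0..t1}" and T' = "{1..r}"]) (auto dest: square_integrableD)

lemma f0_kappa_cov:
  assumes "x \<in> {t0..t1}" "j \<in> {1..r}"
  shows "covariance M (f0 x) (\<kappa> j) = 0"
proof -
  have "indep_var borel (f0 x) borel (\<kappa> j)"
    using indep_f0_kappa[of "{x}" "{j}" "\<lambda>_. 1" "\<lambda>_. 1"] assms by simp
  from indep_var_lebesgue_integral[OF this] show ?thesis
    using covariance_eq(3)[OF f0_square_integrable[OF assms(1)] kappa_square_integrable[OF assms(2)]]
      square_integrable_integrable[OF f0_square_integrable[OF assms(1)]]
      square_integrable_integrable[OF kappa_square_integrable[OF assms(2)]] by simp
qed

definition finite_combinations :: "('a \<Rightarrow> real) set" where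
  "finite_combinations = {Z. \<exists>S c d. finite S \<and> S \<subseteq> {t0..t1} \<and>
     Z = (\<lambda>w. (\<Sum>s\<in>S. c s * f0 s w) + (\<Sum>j\<in>{1..r}. d j * \<kappa> j w))}"

text \<open>The Gaussian Hilbert space generated by \<open>f0\<close> and \<open>\<kappa>\<close>.
  Being closed, it absorbs repeated mean-square limits without further completion.\<close>

definition gaussian_space :: "('a \<Rightarrow> real) set" where
  "gaussian_space = l2_closure finite_combinations"

lemma finite_combinationsI:
  "finite S \<Longrightarrow> S \<subseteq> {t0..t1} \<Longrightarrow> (\<lambda>w. (\<Sum>s\<in>S. c s * f0 s w) + (\<Sum>j\<in>{1..r}. d j * \<kappa> j w)) \<in> finite_combinations"
  by (auto simp: finite_combinations_def)

lemma finite_combinations_scale: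
  assumes "W \<in> finite_combinations"
  shows "(\<lambda>w. a * W w) \<in> finite_combinations"
proof -
  obtain S c d where S: "finite S" "S \<subseteq> {t0..t1}"
    and W: "W = (\<lambda>w. (\<Sum>s\<in>S. c s * f0 s w) + (\<Sum>j\<in>{1..r}. d j * \<kappa> j w))"
    using assms by (auto simp: finite_combinations_def)
  have "(\<lambda>w. a * W w) = (\<lambda>w. (\<Sum>s\<in>S. (a * c s) * f0 s w) + (\<Sum>j\<in>{1..r}. (a * d j) * \<kappa> j w))"
    by (simp add: W distrib_left sum_distrib_left mult.assoc)
  then show ?thesis
    using finite_combinationsI[OF S] by simp
qed

lemma finite_combinations_add:
  assumes "U \<in> finite_combinations" "W \<in> finite_combinations"
  shows "(\<lambda>w. U w + W w) \<in> finite_combinations"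
proof -
  obtain S c d where S: "finite S" "S \<subseteq> {t0..t1}"
    and U: "U = (\<lambda>w. (\<Sum>s\<in>S. c s * f0 s w) + (\<Sum>j\<in>{1..r}. d j * \<kappa> j w))"
    using assms(1) by (auto simp: finite_combinations_def)
  obtain S' c' d' where S': "finite S'" "S' \<subseteq> {t0..t1}"
    and W: "W = (\<lambda>w. (\<Sum>s\<in>S'. c' s * f0 s w) + (\<Sum>j\<in>{1..r}. d' j * \<kappa> j w))"
    using assms(2) by (auto simp: finite_combinations_def)
  \<comment> \<open>Two combinations may use different time points; zero coefficients bring both to
    the union.\<close>
  have ext: "(\<Sum>s\<in>S. c s * f0 s w) = (\<Sum>s\<in>S \<union> S'. (if s \<in> S then c s else 0) * f0 s w)"
    if "finite S" "finite S'" for S S' c w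
    using that by (intro sum.mono_neutral_cong_left) auto
  have "(\<lambda>w. U w + W w) = (\<lambda>w. (\<Sum>s\<in>S \<union> S'. ((if s \<in> S then c s else 0) + (if s \<in> S' then c' s else 0)) * f0 s w)
      + (\<Sum>j\<in>{1..r}. (d j + d' j) * \<kappa> j w))"
    unfolding U W ext[OF S(1) S'(1)] ext[OF S'(1) S(1)] Un_commute[of S' S]
    by (simp add: distrib_right sum.distrib add_ac)
  then show ?thesis
    using finite_combinationsI[of "S \<union> S'"] S S' by simp
qed

text \<open>Each of the two sums is normal by hypothesis; independence makes their sum normal. The
  other use of independence is the vanishing cross covariance \<open>f0_kappa_cov\<close>.\<close>

lemma finite_combinations_normal:
  assumes "W \<in> finite_combinations"
  shows "\<exists>m v. normal_rv M W m v"
proof -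
  obtain S c d where S: "finite S" "S \<subseteq> {t0..t1}"
    and W: "W = (\<lambda>w. (\<Sum>s\<in>S. c s * f0 s w) + (\<Sum>j\<in>{1..r}. d j * \<kappa> j w))"
    using assms by (auto simp: finite_combinations_def)
  have "gaussian_vector M S f0" "gaussian_vector M {1..r} \<kappa>"
    using gp mn S by (auto simp: gaussian_process_def multivariate_normal_def)
  then obtain m v m' v' where "normal_rv M (\<lambda>w. \<Sum>s\<in>S. c s * f0 s w) m v"
    "normal_rv M (\<lambda>w. \<Sum>j\<in>{1..r}. d j * \<kappa> j w) m' v'"
    unfolding gaussian_vector_def by meson
  from normal_rv_add_indep[OF indep_f0_kappa[OF S(2) order_refl] this] show ?thesis
    unfolding W by blast
qed

lemma finite_combinations_subset: "W \<in> finite_combinations \<Longrightarrow> W \<in> gaussian_space"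
  unfolding gaussian_space_def using finite_combinations_normal normal_rv_moments(2) by (blast intro: l2_closure_subset)

lemma gaussian_space_square_integrable: "Z \<in> gaussian_space \<Longrightarrow> square_integrable M Z"
  unfolding gaussian_space_def by (rule l2_closureD)

lemma gaussian_space_scale: "Z \<in> gaussian_space \<Longrightarrow> (\<lambda>w. c * Z w) \<in> gaussian_space"
  unfolding gaussian_space_def by (rule l2_closure_scale[OF finite_combinations_scale])

lemma gaussian_space_add: "Y \<in> gaussian_space \<Longrightarrow> Z \<in> gaussian_space \<Longrightarrow> (\<lambda>w. Y w + Z w) \<in> gaussian_space"
  unfolding gaussian_space_def by (rule l2_closure_add[OF finite_combinations_add])

lemma gaussian_space_closed: "Z \<in> l2_closure gaussian_space \<Longrightarrow> Z \<in> gaussian_space"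
  unfolding gaussian_space_def by (rule l2_closure_closed)

lemma gaussian_space_normal: "Z \<in> gaussian_space \<Longrightarrow> normal_rv M Z (expectation Z) (variance Z)"
  unfolding gaussian_space_def using finite_combinations_normal by (intro l2_closure_normal)

lemma gaussian_space_f0: "t \<in> {t0..t1} \<Longrightarrow> f0 t \<in> gaussian_space"
  using finite_combinationsI[of "{t}" "\<lambda>_. 1" "\<lambda>_. 0"] by (intro finite_combinations_subset) simp

lemma gaussian_space_kappa:
  assumes "j \<in> {1..r}"
  shows "\<kappa> j \<in> gaussian_space"
proof -
  have "(\<Sum>i\<in>{1..r}. (if i = j then 1 else 0) * \<kappa> i w) = \<kappa> j w" for w
    using assms by (simp add: if_distrib[of "\<lambda>x. x * _"] cong: if_cong)
  then show ?thesis
    using finite_combinationsI[of "{}" "\<lambda>_. 0" "\<lambda>i. if i = j then 1 else 0"] finite_combinations_subset[of "\<kappa> j"] by simp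
qed

lemma gaussian_space_zero: "(\<lambda>_. 0) \<in> gaussian_space"
  using finite_combinationsI[of "{}" "\<lambda>_. 0" "\<lambda>i. 0"] by (intro finite_combinations_subset) simp

lemma gaussian_space_sum: "(\<And>i. i \<in> J \<Longrightarrow> X i \<in> gaussian_space) \<Longrightarrow> (\<lambda>w. \<Sum>i\<in>J. X i w) \<in> gaussian_space"
  using gaussian_space_zero gaussian_space_add by (rule closed_sum)

text \<open>\<open>generated_by\<close> identifies functions on \<open>space M\<close> only; outside
  it they may differ. Such functions have distance 0, so closedness identifies them for
  membership.\<close>

lemma gaussian_space_cong:
  assumes "Z \<in> gaussian_space" "\<And>w. w \<in> space M \<Longrightarrow> Z' w = Z w"
  shows "Z' \<in> gaussian_space"
proof (rule gaussian_space_closed, rule l2_closureI)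
  show "square_integrable M Z'"
    using gaussian_space_square_integrable[OF assms(1)] square_integrable_cong[of M Z' Z] assms(2) by simp
  have "l2norm M (\<lambda>w. Z' w - Z w) = 0"
    unfolding l2norm_def using assms(2) by (simp cong: Bochner_Integration.integral_cong)
  then show "\<exists>W\<in>gaussian_space. square_integrable M W \<and> l2norm M (\<lambda>w. Z' w - W w) < e" if "e > 0" for e
    using assms(1) gaussian_space_square_integrable that by (intro bexI[of _ Z]) auto
qed

lemma gaussian_vector_if_gaussian_space:
  fixes X :: "'i \<Rightarrow> 'a \<Rightarrow> real"
  assumes "finite J" "\<And>j. j \<in> J \<Longrightarrow> X j \<in> gaussian_space"
  shows "gaussian_vector M J X"
  unfolding gaussian_vector_def
proof (intro conjI ballI allI)
  fix a :: "'i \<Rightarrow> real"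
  have "(\<lambda>w. \<Sum>j\<in>J. a j * X j w) \<in> gaussian_space"
    by (intro gaussian_space_sum gaussian_space_scale assms(2))
  from gaussian_space_normal[OF this] show "\<exists>m v. normal_rv M (\<lambda>w. \<Sum>j\<in>J. a j * X j w) m v"
    by (intro exI)
next
  show "X j \<in> borel_measurable M" if "j \<in> J" for j
    using square_integrableD(1)[OF gaussian_space_square_integrable[OF assms(2)[OF that]]] .
qed (rule assms)

text \<open>Describes both the negative part of a given ensemble and the sequence constructed for
  existence. The length \<open>n\<close> is a parameter because existence of one more derivative is
  deduced from the second moments of a chain of length \<open>n\<close>.\<close>

definition derivative_chain :: "nat \<Rightarrow> (nat \<Rightarrow> real \<Rightarrow> 'a \<Rightarrow> real) \<Rightarrow> bool" where
  "derivative_chain n F \<longleftrightarrow> (\<forall>t\<in>{t0..t1}. \<forall>w\<in>space M. F 0 t w = f0 t w) \<and>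
     (\<forall>k<n. \<forall>t\<in>{t0..t1}. has_ms_derivative M {t0..t1} (F k) (F (Suc k) t) t)"

lemma derivative_chainD:
  assumes "derivative_chain n F"
  shows "t \<in> {t0..t1} \<Longrightarrow> w \<in> space M \<Longrightarrow> F 0 t w = f0 t w"
    and "k < n \<Longrightarrow> t \<in> {t0..t1} \<Longrightarrow> has_ms_derivative M {t0..t1} (F k) (F (Suc k) t) t"
  using assms by (auto simp: derivative_chain_def)

lemma derivative_chain_gaussian_space:
  assumes F: "derivative_chain n F" and "k \<le> n" "t \<in> {t0..t1}"
  shows "F k t \<in> gaussian_space"
  using assms(2,3)
proof (induction k arbitrary: t)
  case 0
  then show ?case
    using derivative_chainD(1)[OF F] by (intro gaussian_space_cong[OF gaussian_space_f0]) auto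
next
  case (Suc k)
  then have D: "has_ms_derivative M {t0..t1} (F k) (F (Suc k) t) t"
    by (intro derivative_chainD(2)[OF F]) auto
  show ?case
  proof (rule l2_closed_ms_derivative[OF gaussian_space_scale gaussian_space_add gaussian_space_closed t01 Suc.prems(2) _ D])
    show "F k x \<in> gaussian_space" if "x \<in> {t0..t1}" for x
      using Suc that by simp
  qed
qed

text \<open>Iterated \<open>ms_derivative_weak\<close>: the scalar function is differentiated as
  often as the process, with Z kept fixed.\<close>

lemma derivative_chain_moment:
  assumes F: "derivative_chain n F" and Z: "square_integrable M Z" and "k \<le> n" "t \<in> {t0..t1}"
  shows "expectation (\<lambda>w. F k t w * Z w) = (deriv_on {t0..t1} ^^ k) (\<lambda>x. expectation (\<lambda>w. f0 x w * Z w)) t"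
  using assms(3,4)
proof (induction k arbitrary: t)
  case 0
  then show ?case
    using derivative_chainD(1)[OF F] by (auto intro!: Bochner_Integration.integral_cong)
next
  case (Suc k)
  have "deriv_on {t0..t1} ((deriv_on {t0..t1} ^^ k) (\<lambda>x. expectation (\<lambda>w. f0 x w * Z w))) t
      = deriv_on {t0..t1} (\<lambda>x. expectation (\<lambda>w. F k x w * Z w)) t"
    using Suc by (intro deriv_on_cong) auto
  also have "\<dots> = expectation (\<lambda>w. F (Suc k) t w * Z w)"
    using Suc.prems derivative_chainD(2)[OF F, of k t]
    by (intro deriv_on_eqI[OF t01] ms_derivative_weak[OF _ _ Z]) auto
  finally show ?case
    by simp
qed

lemma derivative_chain_mean:
  assumes F: "derivative_chain n F" and "k \<le> n" "t \<in> {t0..t1}"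
  shows "expectation (F k t) = (deriv_on {t0..t1} ^^ k) \<mu> t"
proof -
  have "expectation (F k t) = (deriv_on {t0..t1} ^^ k) (\<lambda>x. expectation (\<lambda>w. f0 x w * 1)) t"
    using derivative_chain_moment[OF F square_integrable_const[of 1] assms(2,3)] by simp
  also have "\<dots> = (deriv_on {t0..t1} ^^ k) \<mu> t"
    using assms(3) f0_mean by (intro deriv_on_funpow_cong) auto
  finally show ?thesis .
qed

text \<open>The moment formula is used twice: with \<open>F k t\<close> centered as test variable,
  and then, after exchanging the factors, with \<open>f0 x\<close> centered. The second argument is
  thereby differentiated innermost, as in \<open>mixed_deriv\<close>; the product of means accounts
  for the missing centering.\<close>

lemma derivative_chain_second_moment:
  assumes F: "derivative_chain n F" and k: "k \<le> n" and s: "s \<in> {t0..t1}" and t: "t \<in> {t0..t1}"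
  shows "expectation (\<lambda>w. F k s w * F k t w)
    = mixed_deriv {t0..t1} k k C s t + (deriv_on {t0..t1} ^^ k) \<mu> s * (deriv_on {t0..t1} ^^ k) \<mu> t"
proof -
  have sq: "square_integrable M (F k x)" if "x \<in> {t0..t1}" for x
    using derivative_chain_gaussian_space[OF F k that] by (rule gaussian_space_square_integrable)
  have sqc: "square_integrable M (\<lambda>w. X w - c)" if "square_integrable M X" for X c
    by (intro square_integrable_diff square_integrable_const that)
  have "covariance M (F k s) (F k t) = (deriv_on {t0..t1} ^^ k) (\<lambda>x. expectation (\<lambda>w. f0 x w * (F k t w - expectation (F k t)))) s"
    unfolding covariance_eq(1)[OF sq[OF s] sq[OF t]]
    by (rule derivative_chain_moment[OF F sqc[OF sq[OF t]] k s])
  also have "\<dots> = (deriv_on {t0..t1} ^^ k) (\<lambda>x. (deriv_on {t0..t1} ^^ k) (C x) t) s"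
  proof (rule deriv_on_funpow_cong[OF _ s])
    fix x
    assume x: "x \<in> {t0..t1}"
    have "expectation (\<lambda>w. f0 x w * (F k t w - expectation (F k t))) = expectation (\<lambda>w. F k t w * (f0 x w - expectation (f0 x)))"
      using covariance_eq(1,2)[OF f0_square_integrable[OF x] sq[OF t]] by simp
    also have "\<dots> = (deriv_on {t0..t1} ^^ k) (\<lambda>y. expectation (\<lambda>w. f0 y w * (f0 x w - expectation (f0 x)))) t"
      by (rule derivative_chain_moment[OF F sqc[OF f0_square_integrable[OF x]] k t])
    also have "\<dots> = (deriv_on {t0..t1} ^^ k) (C x) t"
      using covariance_eq(2)[OF f0_square_integrable[OF x] f0_square_integrable] f0_cov[OF x]
      by (intro deriv_on_funpow_cong[OF _ t]) simp
    finally show "expectation (\<lambda>w. f0 x w * (F k t w - expectation (F k t))) = (deriv_on {t0..t1} ^^ k) (C x) t" .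
  qed
  finally show ?thesis
    using covariance_eq(3)[OF sq[OF s] sq[OF t]] derivative_chain_mean[OF F k s] derivative_chain_mean[OF F k t]
    by (simp add: mixed_deriv_eq)
qed

text \<open>Both parts of the second moment of \<open>F n\<close>, the mixed derivative of
  \<open>C\<close> and the product of derivatives of \<open>\<mu>\<close>, admit one more derivative
  in each argument since \<open>n < r\<close>; this is the hypothesis of Loeve's criterion.\<close>

lemma derivative_chain_extend:
  assumes F: "derivative_chain n F" and n: "n < r" and t: "t \<in> {t0..t1}"
  shows "\<exists>Y. has_ms_derivative M {t0..t1} (F n) Y t"
proof -
  let ?I = "{t0..t1}"
  define m where "m k = (deriv_on ?I ^^ k) \<mu>" for k
  have m': "(m n has_vector_derivative m (Suc n) x) (at x within ?I)" if "x \<in> ?I" for x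
    unfolding m_def by (rule C_on_has_vector_derivative[OF \<mu> n that])
  have contm: "continuous_on ?I (m (Suc n))"
    using \<mu> n unfolding m_def C_on_def by (meson Suc_leI)
  show ?thesis
  proof (rule ms_derivative_exists[where F = "\<lambda>x y. mixed_deriv ?I n n C x y + m n x * m n y"
        and ?F2.0 = "\<lambda>x y. mixed_deriv ?I n (Suc n) C x y + m n x * m (Suc n) y"
        and ?F12.0 = "\<lambda>x y. mixed_deriv ?I (Suc n) (Suc n) C x y + m (Suc n) x * m (Suc n) y", OF t01])
    show "square_integrable M (F n x)" if "x \<in> ?I" for x
      using derivative_chain_gaussian_space[OF F order_refl that] by (rule gaussian_space_square_integrable)
    show "expectation (\<lambda>w. F n x w * F n y w) = mixed_deriv ?I n n C x y + m n x * m n y"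
      if "x \<in> ?I" "y \<in> ?I" for x y
      unfolding m_def by (rule derivative_chain_second_moment[OF F order_refl that])
    show "((\<lambda>y. mixed_deriv ?I n n C x y + m n x * m n y) has_vector_derivative
        mixed_deriv ?I n (Suc n) C x y + m n x * m (Suc n) y) (at y within ?I)"
      if "x \<in> ?I" "y \<in> ?I" for x y
      using mixed_deriv_second[OF C t01, of n n x y] m'[OF that(2)] n that
      by (auto intro!: has_vector_derivative_add has_vector_derivative_mult_right)
    show "((\<lambda>x. mixed_deriv ?I n (Suc n) C x y + m n x * m (Suc n) y) has_vector_derivative
        mixed_deriv ?I (Suc n) (Suc n) C x y + m (Suc n) x * m (Suc n) y) (at x within ?I)"
      if "x \<in> ?I" "y \<in> ?I" for x y
      using mixed_deriv_first[OF C, of n "Suc n" x y] m'[OF that(1)] n that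
      by (auto intro!: has_vector_derivative_add has_vector_derivative_mult_left)
    have "continuous_on (?I \<times> ?I) (\<lambda>z. (case z of (x, y) \<Rightarrow> mixed_deriv ?I (Suc n) (Suc n) C x y) + m (Suc n) (fst z) * m (Suc n) (snd z))"
      using n by (intro continuous_intros mixed_deriv_continuous_on[OF C] continuous_on_compose2[OF contm]) auto
    then show "continuous_on (?I \<times> ?I) (\<lambda>(x, y). mixed_deriv ?I (Suc n) (Suc n) C x y + m (Suc n) x * m (Suc n) y)"
      by (simp add: split_beta)
  qed (rule t)
qed

lemma f0_second_moment:
  assumes "s \<in> {t0..t1}" "t \<in> {t0..t1}"
  shows "expectation (\<lambda>w. f0 s w * f0 t w) = C s t + \<mu> s * \<mu> t"
  using covariance_eq(3)[OF f0_square_integrable[OF assms(1)] f0_square_integrable[OF assms(2)]] f0_cov[OF assms]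
    f0_mean[OF assms(1)] f0_mean[OF assms(2)] by simp

lemma second_moment_continuous:
  "continuous_on ({t0..t1} \<times> {t0..t1}) (\<lambda>(s, t). expectation (\<lambda>w. f0 s w * f0 t w))"
proof -
  have contC: "continuous_on ({t0..t1} \<times> {t0..t1}) (\<lambda>(s, t). C s t)"
    using mixed_deriv_continuous_on[OF C, of 0 0] by (simp add: mixed_deriv_eq)
  have cont\<mu>: "continuous_on {t0..t1} \<mu>"
    using \<mu> by (auto simp: C_on_def dest: spec[of _ 0])
  have "continuous_on ({t0..t1} \<times> {t0..t1}) (\<lambda>z. (case z of (s, t) \<Rightarrow> C s t) + \<mu> (fst z) * \<mu> (snd z))"
    by (intro continuous_intros contC continuous_on_compose2[OF cont\<mu>]) auto
  then show ?thesis
    by (rule continuous_on_eq) (auto simp: f0_second_moment)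
qed

text \<open>The kernel is deterministic, so it leaves the expectation, and the second moments of the
  integrand stay continuous.\<close>

lemma weighted_f0_ms_integral_exists:
  assumes t: "t \<in> {t0..t1}"
  shows "\<exists>Y. has_ms_integral M t0 t (\<lambda>u w. (t - u) ^ q * f0 u w) Y"
proof (rule ms_integral_exists)
  show "square_integrable M (\<lambda>w. (t - u) ^ q * f0 u w)" if "u \<in> {t0..t}" for u
    using that t by (intro square_integrable_scale f0_square_integrable) auto
  have "{t0..t} \<times> {t0..t} \<subseteq> {t0..t1} \<times> {t0..t1}"
    using t by auto
  from continuous_on_subset[OF second_moment_continuous this]
  have "continuous_on ({t0..t} \<times> {t0..t}) (\<lambda>z. (t - fst z) ^ q * (t - snd z) ^ q * (case z of (s, t) \<Rightarrow> expectation (\<lambda>w. f0 s w * f0 t w)))"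
    by (intro continuous_intros)
  moreover have "expectation (\<lambda>w. ((t - s) ^ q * f0 s w) * ((t - u) ^ q * f0 u w))
      = (t - s) ^ q * (t - u) ^ q * expectation (\<lambda>w. f0 s w * f0 u w)" for s u
  proof -
    have "((t - s) ^ q * f0 s w) * ((t - u) ^ q * f0 u w) = ((t - s) ^ q * (t - u) ^ q) * (f0 s w * f0 u w)" for w
      by (simp only: mult_ac)
    then show ?thesis
      by (simp only: integral_mult_right_zero)
  qed
  ultimately show "continuous_on ({t0..t} \<times> {t0..t}) (\<lambda>(s, u). expectation (\<lambda>w. ((t - s) ^ q * f0 s w) * ((t - u) ^ q * f0 u w)))"
    by (simp add: split_beta)
qed (use t in simp)

text \<open>Versions of the derivatives are chosen recursively, separately at each time. A choice is
  justified only once the earlier ones are known to form a chain, hence the induction on the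
  length.\<close>

theorem ensemble_exists: "\<exists>f. generated_by M r t0 t1 f0 \<kappa> f"
proof -
  define F where "F = rec_nat f0 (\<lambda>k G t. SOME Y. has_ms_derivative M {t0..t1} G Y t)"
  have F0: "F 0 = f0" and FSuc: "F (Suc k) = (\<lambda>t. SOME Y. has_ms_derivative M {t0..t1} (F k) Y t)" for k
    by (simp_all add: F_def)
  have chain: "derivative_chain n F" if "n \<le> r" for n
    using that
  proof (induction n)
    case (Suc n)
    then have n: "derivative_chain n F" "n < r"
      by auto
    have "has_ms_derivative M {t0..t1} (F n) (F (Suc n) t) t" if "t \<in> {t0..t1}" for t
      unfolding FSuc using derivative_chain_extend[OF n that] by (rule someI_ex)
    with n(1) show ?case
      by (auto simp: derivative_chain_def less_Suc_eq)
  qed (simp add: derivative_chain_def F0)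
  have "\<forall>q. \<exists>Y. \<forall>t\<in>{t0..t1}. has_ms_integral M t0 t (\<lambda>u w. (t - u) ^ q * f0 u w) (Y t)"
    using weighted_f0_ms_integral_exists by (intro allI bchoice) auto
  from choice[OF this] obtain Y where Y: "\<forall>q. \<forall>t\<in>{t0..t1}. has_ms_integral M t0 t (\<lambda>u w. (t - u) ^ q * f0 u w) (Y q t)"
    by blast
  \<comment> \<open>\<open>Y\<close> is indexed by the exponent of the kernel, which is one less
    than the order of integration.\<close>
  define f :: "int \<Rightarrow> real \<Rightarrow> 'a \<Rightarrow> real" where
    "f p = (if p \<le> 0 then F (nat (- p)) else (\<lambda>t w. Y (nat p - 1) t w / fact (nat p - 1)
      + (\<Sum>j = 1..nat p. (t - t0) ^ (nat p - j) / fact (nat p - j) * \<kappa> j w)))" for p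
  have "generated_by M r t0 t1 f0 \<kappa> f"
    unfolding generated_by_def
  proof (intro conjI ballI)
    show "f 0 t w = f0 t w" for t w
      by (simp add: f_def F0)
  next
    fix p t
    assume p: "p \<in> {- int r..- 1}" and t: "t \<in> {t0..t1}"
    define k where "k = nat (- p) - 1"
    have k: "p = - int (Suc k)" "k < r"
      using p by (auto simp: k_def)
    then have "nat (- (p + 1)) = k" "nat (- p) = Suc k" "p \<le> 0" "p + 1 \<le> 0"
      by auto
    then have "f (p + 1) = F k" "f p = F (Suc k)"
      by (simp_all only: f_def if_True)
    then show "has_ms_derivative M {t0..t1} (f (p + 1)) (f p t) t"
      using derivative_chainD(2)[OF chain[OF order_refl] k(2) t] by simp
  next
    fix p t
    assume "p \<in> {1..r}" and t: "t \<in> {t0..t1}"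
    then obtain q where q: "p = Suc q"
      by (cases p) auto
    show "\<exists>Y. has_ms_integral M t0 t (\<lambda>u w. (t - u) ^ (p - 1) * f0 u w) Y \<and>
        (\<forall>w\<in>space M. f (int p) t w =
           Y w / fact (p - 1) + (\<Sum>j = 1..p. (t - t0) ^ (p - j) / fact (p - j) * \<kappa> j w))"
    proof (intro exI conjI ballI)
      show "has_ms_integral M t0 t (\<lambda>u w. (t - u) ^ (p - 1) * f0 u w) (Y q t)"
        using Y t by (simp add: q)
      show "f (int p) t w = Y q t w / fact (p - 1) + (\<Sum>j = 1..p. (t - t0) ^ (p - j) / fact (p - j) * \<kappa> j w)" for w
        unfolding f_def nat_int by (simp add: q)
    qed
  qed
  then show ?thesis
    by blast
qed

end

section \<open>The generated ensemble\<close>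

locale generated_ensemble = gaussian_ensemble M r t0 t1 f0 \<mu> C \<kappa> m\<^sub>\<kappa> S\<^sub>\<kappa>
  for M :: "'a measure" and r t0 t1 f0 \<mu> C \<kappa> m\<^sub>\<kappa> S\<^sub>\<kappa> +
  fixes f :: "int \<Rightarrow> real \<Rightarrow> 'a \<Rightarrow> real"
  assumes gen: "generated_by M r t0 t1 f0 \<kappa> f"
begin

lemma negative_chain: "derivative_chain r (\<lambda>k. f (- int k))"
  unfolding derivative_chain_def
proof (intro conjI ballI allI impI)
  show "f (- int 0) t w = f0 t w" if "t \<in> {t0..t1}" "w \<in> space M" for t w
    using gen that by (simp add: generated_by_def)
  fix k t
  assume k: "k < r" and t: "t \<in> {t0..t1}"
  from k have p: "- int (Suc k) \<in> {- int r..- 1}"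
    by auto
  have "\<forall>p\<in>{- int r..- 1}. \<forall>t\<in>{t0..t1}. has_ms_derivative M {t0..t1} (f (p + 1)) (f p t) t"
    using gen by (simp add: generated_by_def)
  from bspec[OF bspec[OF this p] t] show "has_ms_derivative M {t0..t1} (f (- int k)) (f (- int (Suc k)) t) t"
    by simp
qed

lemma positive_part:
  assumes "q < r" "t \<in> {t0..t1}"
  obtains Y where "has_ms_integral M t0 t (\<lambda>u w. (t - u) ^ q * f0 u w) Y"
    "\<And>w. w \<in> space M \<Longrightarrow> f (int (Suc q)) t w = Y w / fact q + (\<Sum>j = 1..Suc q. (t - t0) ^ (Suc q - j) / fact (Suc q - j) * \<kappa> j w)"
proof -
  have p: "Suc q \<in> {1..r}"
    using assms by simp
  have "\<forall>p\<in>{1..r}. \<forall>t\<in>{t0..t1}. \<exists>Y.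
        has_ms_integral M t0 t (\<lambda>u w. (t - u) ^ (p - 1) * f0 u w) Y \<and>
        (\<forall>w\<in>space M. f (int p) t w =
           Y w / fact (p - 1) + (\<Sum>j = 1..p. (t - t0) ^ (p - j) / fact (p - j) * \<kappa> j w))"
    using gen by (simp add: generated_by_def)
  from bspec[OF bspec[OF this p] assms(2)] show thesis
    using that unfolding diff_Suc_1 by blast
qed

lemma index_cases:
  assumes "p \<in> {- int r..int r}"
  obtains (neg) k where "p = - int k" "k \<le> r" | (pos) q where "p = int (Suc q)" "q < r"
proof (cases "p \<le> 0")
  case True
  then show thesis
    using assms by (intro neg[of "nat (- p)"]) auto
next
  case False
  then show thesis
    using assms by (intro pos[of "nat p - 1"]) auto
qed

lemma f_gaussian_space:
  assumes "p \<in> {- int r..int r}" "t \<in> {t0..t1}"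
  shows "f p t \<in> gaussian_space"
  using assms(1)
proof (cases rule: index_cases)
  case (neg k)
  then show ?thesis
    using derivative_chain_gaussian_space[OF negative_chain neg(2) assms(2)] by simp
next
  case (pos q)
  from positive_part[OF pos(2) assms(2)] obtain Y where Y: "has_ms_integral M t0 t (\<lambda>u w. (t - u) ^ q * f0 u w) Y"
    and eq: "\<And>w. w \<in> space M \<Longrightarrow> f (int (Suc q)) t w = Y w / fact q + (\<Sum>j = 1..Suc q. (t - t0) ^ (Suc q - j) / fact (Suc q - j) * \<kappa> j w)"
    by blast
  have "Y \<in> gaussian_space"
  proof (rule l2_closed_ms_integral[OF gaussian_space_scale gaussian_space_zero gaussian_space_add gaussian_space_closed _ Y])
    show "(\<lambda>w. (t - u) ^ q * f0 u w) \<in> gaussian_space" if "u \<in> {t0..t}" for u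
      using that assms(2) by (intro gaussian_space_scale gaussian_space_f0) auto
  qed
  then have "(\<lambda>w. (1 / fact q) * Y w + (\<Sum>j = 1..Suc q. (t - t0) ^ (Suc q - j) / fact (Suc q - j) * \<kappa> j w)) \<in> gaussian_space"
    using pos by (intro gaussian_space_add gaussian_space_scale gaussian_space_sum gaussian_space_kappa) auto
  then show ?thesis
    unfolding pos(1) by (rule gaussian_space_cong) (simp add: eq del: of_nat_Suc)
qed

lemma f_square_integrable:
  assumes "p \<in> {- int r..int r}" "t \<in> {t0..t1}"
  shows "square_integrable M (f p t)"
  using f_gaussian_space[OF assms] by (rule gaussian_space_square_integrable)

text \<open>Since derivatives and integrals are limits in \<open>L\<^sup>2\<close>, pairing with any fixed \<open>Z\<close> commutes with the
  construction of the ensemble. Means and covariances are the cases \<open>Z = 1\<close> and \<open>Z\<close> a centered member.\<close>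

lemma f_moment:
  assumes Z: "square_integrable M Z" and p: "p \<in> {- int r..int r}" and t: "t \<in> {t0..t1}"
  shows "expectation (\<lambda>w. f p t w * Z w)
    = ensemble_mean t0 t1 (\<lambda>x. expectation (\<lambda>w. f0 x w * Z w)) (\<lambda>j. expectation (\<lambda>w. \<kappa> j w * Z w)) p t"
  using p
proof (cases rule: index_cases)
  case (neg k)
  then show ?thesis
    using derivative_chain_moment[OF negative_chain Z neg(2) t] by (simp add: ensemble_mean_of_neg_nat)
next
  case (pos q)
  from positive_part[OF pos(2) t] obtain Y where Y: "has_ms_integral M t0 t (\<lambda>u w. (t - u) ^ q * f0 u w) Y"
    and eq: "\<And>w. w \<in> space M \<Longrightarrow> f (int (Suc q)) t w = Y w / fact q + (\<Sum>j = 1..Suc q. (t - t0) ^ (Suc q - j) / fact (Suc q - j) * \<kappa> j w)"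
    by blast
  note Ysq = has_ms_integralD(2)[OF Y]
  define wt where "wt j = (t - t0) ^ (Suc q - j) / fact (Suc q - j)" for j
  have \<kappa>Z: "integrable M (\<lambda>w. \<kappa> j w * Z w)" if "j \<in> {1..Suc q}" for j
    using that pos by (intro square_integrable_mult_integrable kappa_square_integrable Z) auto
  have YZ: "integrable M (\<lambda>w. Y w * Z w)"
    by (rule square_integrable_mult_integrable[OF Ysq Z])
  have "expectation (\<lambda>w. f p t w * Z w) = expectation (\<lambda>w. (Y w * Z w) / fact q + (\<Sum>j = 1..Suc q. wt j * (\<kappa> j w * Z w)))"
    unfolding pos(1) wt_def
    by (intro Bochner_Integration.integral_cong refl) (simp add: eq distrib_right sum_distrib_right mult.assoc del: of_nat_Suc sum.cl_ivl_Suc)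
  also have "\<dots> = expectation (\<lambda>w. (Y w * Z w) / fact q) + expectation (\<lambda>w. \<Sum>j = 1..Suc q. wt j * (\<kappa> j w * Z w))"
    by (intro Bochner_Integration.integral_add integrable_divide YZ Bochner_Integration.integrable_sum integrable_mult_right \<kappa>Z)
  also have "expectation (\<lambda>w. \<Sum>j = 1..Suc q. wt j * (\<kappa> j w * Z w)) = (\<Sum>j = 1..Suc q. wt j * expectation (\<lambda>w. \<kappa> j w * Z w))"
    by (subst Bochner_Integration.integral_sum) (auto intro!: \<kappa>Z simp del: sum.cl_ivl_Suc)
  also have "expectation (\<lambda>w. (Y w * Z w) / fact q) = integral {t0..t} (\<lambda>u. (t - u) ^ q * expectation (\<lambda>w. f0 u w * Z w)) / fact q"
    using integral_unique[OF ms_integral_weak[OF Y Z]] by (simp add: mult.assoc)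
  finally show ?thesis
    unfolding pos(1) ensemble_mean_of_nat cauchy_integral_Suc wt_def .
qed

lemma f_mean:
  assumes "p \<in> {- int r..int r}" "t \<in> {t0..t1}"
  shows "expectation (f p t) = ensemble_mean t0 t1 \<mu> m\<^sub>\<kappa> p t"
proof -
  have "expectation (f p t) = ensemble_mean t0 t1 (\<lambda>x. expectation (f0 x)) (\<lambda>j. expectation (\<kappa> j)) p t"
    using f_moment[OF square_integrable_const[of 1] assms] by simp
  also have "\<dots> = ensemble_mean t0 t1 \<mu> m\<^sub>\<kappa> p t"
    using assms by (intro ensemble_mean_cong f0_mean kappa_mean) auto
  finally show ?thesis .
qed

text \<open>\<open>f_moment\<close> in the first argument needs the pairings of \<open>f0 x\<close>
  and \<open>\<kappa> i\<close> with the centered \<open>f q t\<close>; these are again instances of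
  \<open>f_moment\<close>, now with \<open>f0 x\<close> or \<open>\<kappa> i\<close> centered as
  test variable.\<close>

lemma f_cov:
  assumes p: "p \<in> {- int r..int r}" and q: "q \<in> {- int r..int r}" and s: "s \<in> {t0..t1}" and t: "t \<in> {t0..t1}"
  shows "covariance M (f p s) (f q t) = ensemble_cov t0 t1 C S\<^sub>\<kappa> p q s t"
proof -
  have sqc: "square_integrable M (\<lambda>w. X w - c)" if "square_integrable M X" for X c
    by (intro square_integrable_diff square_integrable_const that)
  note fq = f_square_integrable[OF q t]
  have f0_part: "expectation (\<lambda>w. f0 x w * (f q t w - expectation (f q t))) = signed_op t0 t1 q (C x) t"
    if x: "x \<in> {t0..t1}" for x
  proof -
    note fx = f0_square_integrable[OF x]
    have "expectation (\<lambda>w. f0 x w * (f q t w - expectation (f q t))) = expectation (\<lambda>w. f q t w * (f0 x w - expectation (f0 x)))"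
      using covariance_eq(1,2)[OF fx fq] by simp
    also have "\<dots> = ensemble_mean t0 t1 (\<lambda>y. expectation (\<lambda>w. f0 y w * (f0 x w - expectation (f0 x))))
        (\<lambda>j. expectation (\<lambda>w. \<kappa> j w * (f0 x w - expectation (f0 x)))) q t"
      by (rule f_moment[OF sqc[OF fx] q t])
    \<comment> \<open>The polynomial part has zero coefficients because \<open>f0\<close> and
      \<open>\<kappa>\<close> are uncorrelated.\<close>
    also have "\<dots> = ensemble_mean t0 t1 (C x) (\<lambda>_. 0) q t"
      using covariance_eq(2)[OF fx f0_square_integrable] f0_cov[OF x]
        covariance_eq(2)[OF fx kappa_square_integrable] f0_kappa_cov[OF x] q t
      by (intro ensemble_mean_cong) auto
    finally show ?thesis
      by (simp add: ensemble_mean_def)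
  qed
  have kappa_part: "expectation (\<lambda>w. \<kappa> i w * (f q t w - expectation (f q t)))
      = (if q > 0 then \<Sum>j = 1..nat q. (t - t0) ^ (nat q - j) / fact (nat q - j) * S\<^sub>\<kappa> i j else 0)"
    if i: "i \<in> {1..r}" for i
  proof -
    note ki = kappa_square_integrable[OF i]
    have "expectation (\<lambda>w. \<kappa> i w * (f q t w - expectation (f q t))) = expectation (\<lambda>w. f q t w * (\<kappa> i w - expectation (\<kappa> i)))"
      using covariance_eq(1,2)[OF ki fq] by simp
    also have "\<dots> = ensemble_mean t0 t1 (\<lambda>y. expectation (\<lambda>w. f0 y w * (\<kappa> i w - expectation (\<kappa> i))))
        (\<lambda>j. expectation (\<lambda>w. \<kappa> j w * (\<kappa> i w - expectation (\<kappa> i)))) q t"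
      by (rule f_moment[OF sqc[OF ki] q t])
    \<comment> \<open>For the same reason only the polynomial part survives here, and
      \<open>signed_op\<close> of the zero function vanishes.\<close>
    also have "\<dots> = ensemble_mean t0 t1 (\<lambda>_. 0) (S\<^sub>\<kappa> i) q t"
      using covariance_eq(1)[OF f0_square_integrable ki] f0_kappa_cov[OF _ i]
        covariance_eq(2)[OF ki kappa_square_integrable] kappa_cov[OF i] q t
      by (intro ensemble_mean_cong) auto
    finally show ?thesis
      using signed_op_zero[OF t01 t] by (simp add: ensemble_mean_def)
  qed
  have "covariance M (f p s) (f q t) = ensemble_mean t0 t1 (\<lambda>x. expectation (\<lambda>w. f0 x w * (f q t w - expectation (f q t))))
      (\<lambda>i. expectation (\<lambda>w. \<kappa> i w * (f q t w - expectation (f q t)))) p s"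
    unfolding covariance_eq(1)[OF f_square_integrable[OF p s] fq] by (rule f_moment[OF sqc[OF fq] p s])
  also have "\<dots> = ensemble_mean t0 t1 (\<lambda>x. signed_op t0 t1 q (C x) t)
      (\<lambda>i. if q > 0 then \<Sum>j = 1..nat q. (t - t0) ^ (nat q - j) / fact (nat q - j) * S\<^sub>\<kappa> i j else 0) p s"
    using p s by (intro ensemble_mean_cong f0_part kappa_part) auto
  also have "\<dots> = ensemble_cov t0 t1 C S\<^sub>\<kappa> p q s t"
    by (simp add: ensemble_mean_def ensemble_cov_def cov_anc_def cov_const_def in_first_def in_second_def
        sum_distrib_left mult.assoc)
  finally show ?thesis .
qed

lemma f_vector_gaussian_process:
  "vector_gaussian_process M {- int r..int r} {t0..t1} f (ensemble_mean t0 t1 \<mu> m\<^sub>\<kappa>) (ensemble_cov t0 t1 C S\<^sub>\<kappa>)"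
  unfolding vector_gaussian_process_def multivariate_normal_def
proof (intro allI impI conjI ballI)
  fix J
  assume J: "finite J \<and> J \<subseteq> {t0..t1}"
  show "gaussian_vector M ({- int r..int r} \<times> J) (\<lambda>(p, t). f p t)"
    using J by (intro gaussian_vector_if_gaussian_space) (auto intro!: f_gaussian_space)
  fix i
  assume i: "i \<in> {- int r..int r} \<times> J"
  then show "expectation (case i of (p, t) \<Rightarrow> f p t) = (case i of (p, t) \<Rightarrow> ensemble_mean t0 t1 \<mu> m\<^sub>\<kappa> p t)"
    using J by (cases i) (auto intro!: f_mean)
  fix j
  assume j: "j \<in> {- int r..int r} \<times> J"
  obtain p s q t where ij: "i = (p, s)" "j = (q, t)"
    by (cases i, cases j)
  have "covariance M (f p s) (f q t) = ensemble_cov t0 t1 C S\<^sub>\<kappa> p q s t"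
    using i j J ij by (intro f_cov) auto
  then show "covariance M (case i of (p, t) \<Rightarrow> f p t) (case j of (p, t) \<Rightarrow> f p t)
      = (case i of (p, s) \<Rightarrow> \<lambda>(q, t). ensemble_cov t0 t1 C S\<^sub>\<kappa> p q s t) j"
    by (simp add: ij)
qed

text \<open>The integral over one point vanishes almost surely, and in the polynomial only
  \<open>j = p\<close> survives, its power having exponent 0.\<close>

lemma f_initial_value:
  assumes "p \<in> {1..r}"
  shows "AE w in M. f (int p) t0 w = \<kappa> p w"
proof -
  obtain q where q: "p = Suc q" "q < r"
    using assms by (cases p) auto
  obtain Y where Y: "has_ms_integral M t0 t0 (\<lambda>u w. (t0 - u) ^ q * f0 u w) Y"
    and eq: "\<And>w. w \<in> space M \<Longrightarrow> f (int (Suc q)) t0 w = Y w / fact q + (\<Sum>j = 1..Suc q. (t0 - t0) ^ (Suc q - j) / fact (Suc q - j) * \<kappa> j w)"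
    using positive_part[OF q(2), of t0] t01 by auto
  have "(\<Sum>j = 1..q. (t0 - t0) ^ (Suc q - j) / fact (Suc q - j) * \<kappa> j w) = 0" for w
    by (intro sum.neutral) auto
  then have "f (int p) t0 w = Y w / fact q + \<kappa> p w" if "w \<in> space M" for w
    using eq[OF that] by (simp add: q del: of_nat_Suc)
  then have "AE w in M. Y w = 0 \<longrightarrow> f (int p) t0 w = \<kappa> p w"
    by (intro AE_I2) simp
  with ms_integral_refl[OF Y] show ?thesis
    by (rule AE_mp)
qed

text \<open>The two claims support each other: the strong derivative of order q + 1 needs L2
  continuity of order q, which for positive q comes from the strong derivative of order q and for q
  = 0 from the continuous second moments of \<open>f0\<close>.\<close>

lemma f_l2_continuous_and_derivative:
  assumes "q \<le> r" "t \<in> {t0..t1}"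
  shows "((\<lambda>x. l2norm M (\<lambda>w. f (int q) x w - f (int q) t w)) \<longlongrightarrow> 0) (at t within {t0..t1})"
    and "q < r \<Longrightarrow> has_ms_derivative M {t0..t1} (f (int (Suc q))) (f (int q) t) t"
proof -
  have f0_cont: "((\<lambda>x. l2norm M (\<lambda>w. f0 x w - f0 t w)) \<longlongrightarrow> 0) (at t within {t0..t1})" if "t \<in> {t0..t1}" for t
  proof (rule tendstoI)
    fix e :: real
    assume "e > 0"
    from l2_uniformly_continuous_Icc[OF f0_square_integrable second_moment_continuous this]
    obtain d where d: "d > 0"
      and "\<forall>x\<in>{t0..t1}. \<forall>y\<in>{t0..t1}. \<bar>x - y\<bar> < d \<longrightarrow> l2norm M (\<lambda>w. f0 x w - f0 y w) < e"
      by blast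
    then have "\<forall>x\<in>{t0..t1}. x \<noteq> t \<and> dist x t < d \<longrightarrow> dist (l2norm M (\<lambda>w. f0 x w - f0 t w)) 0 < e"
      using \<open>t \<in> {t0..t1}\<close> by (simp add: dist_real_def)
    with d show "\<forall>\<^sub>F x in at t within {t0..t1}. dist (l2norm M (\<lambda>w. f0 x w - f0 t w)) 0 < e"
      unfolding eventually_at by blast
  qed
  have moment_cont: "continuous_on {t0..t1} (\<lambda>x. expectation (\<lambda>w. f0 x w * Z w))" if Z: "square_integrable M Z" for Z
    unfolding continuous_on_def
  proof
    fix t
    assume t: "t \<in> {t0..t1}"
    have "((\<lambda>x. expectation (\<lambda>w. f0 x w * Z w) - expectation (\<lambda>w. f0 t w * Z w)) \<longlongrightarrow> 0) (at t within {t0..t1})"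
    proof (rule Lim_null_comparison[OF _ tendsto_mult_left_zero[OF f0_cont[OF t]]])
      show "\<forall>\<^sub>F x in at t within {t0..t1}. norm (expectation (\<lambda>w. f0 x w * Z w) - expectation (\<lambda>w. f0 t w * Z w))
          \<le> l2norm M (\<lambda>w. f0 x w - f0 t w) * l2norm M Z"
        unfolding eventually_at_filter
      proof (intro always_eventually allI impI)
        fix x
        assume "x \<in> {t0..t1}"
        then show "norm (expectation (\<lambda>w. f0 x w * Z w) - expectation (\<lambda>w. f0 t w * Z w))
          \<le> l2norm M (\<lambda>w. f0 x w - f0 t w) * l2norm M Z"
          using Cauchy_Schwarz_l2norm[OF square_integrable_diff[OF f0_square_integrable f0_square_integrable[OF t]] Z]
            integral_diff_mult[OF f0_square_integrable f0_square_integrable[OF t] Z] by simp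
      qed
    qed
    then show "((\<lambda>x. expectation (\<lambda>w. f0 x w * Z w)) \<longlongrightarrow> expectation (\<lambda>w. f0 t w * Z w)) (at t within {t0..t1})"
      by (simp add: LIM_zero_iff)
  qed
  have derivative: "has_ms_derivative M {t0..t1} (f (int (Suc q))) (f (int q) t) t"
    if q: "q < r" and t: "t \<in> {t0..t1}"
      and cont: "((\<lambda>x. l2norm M (\<lambda>w. f (int q) x w - f (int q) t w)) \<longlongrightarrow> 0) (at t within {t0..t1})" for q t
  proof (rule ms_derivative_if_weak[OF _ _ _ t cont])
    show "square_integrable M (f (int (Suc q)) x)" "square_integrable M (f (int q) x)" if "x \<in> {t0..t1}" for x
      using q that by (auto intro!: f_square_integrable)
    fix x Z
    assume x: "x \<in> {t0..t1}" and Z: "square_integrable M Z"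
    let ?g = "\<lambda>x. expectation (\<lambda>w. f0 x w * Z w)" and ?c = "\<lambda>j. expectation (\<lambda>w. \<kappa> j w * Z w)"
    \<comment> \<open>Paired with Z, the process is an iterated integral plus a Taylor polynomial;
      both lose one order under differentiation.\<close>
    have "((\<lambda>x. cauchy_integral t0 (Suc q) ?g x + (\<Sum>j = 1..Suc q. (x - t0) ^ (Suc q - j) / fact (Suc q - j) * ?c j)) has_vector_derivative
        cauchy_integral t0 q ?g x + (\<Sum>j = 1..q. (x - t0) ^ (q - j) / fact (q - j) * ?c j)) (at x within {t0..t1})"
      by (rule has_vector_derivative_add[OF cauchy_integral_has_vector_derivative[OF moment_cont[OF Z] x] taylor_polynomial_has_vector_derivative])
    moreover have "ensemble_mean t0 t1 ?g ?c (int k) = (\<lambda>x. cauchy_integral t0 k ?g x + (\<Sum>j = 1..k. (x - t0) ^ (k - j) / fact (k - j) * ?c j))" for k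
      by (rule ext) (rule ensemble_mean_of_nat)
    ultimately have "(ensemble_mean t0 t1 ?g ?c (int (Suc q)) has_vector_derivative ensemble_mean t0 t1 ?g ?c (int q) x) (at x within {t0..t1})"
      by (simp only:)
    moreover have "expectation (\<lambda>w. f (int (Suc q)) y w * Z w) = ensemble_mean t0 t1 ?g ?c (int (Suc q)) y" if "y \<in> {t0..t1}" for y
      using q by (intro f_moment[OF Z _ that]) auto
    moreover have "expectation (\<lambda>w. f (int q) x w * Z w) = ensemble_mean t0 t1 ?g ?c (int q) x"
      using q by (intro f_moment[OF Z _ x]) auto
    ultimately show "((\<lambda>x. expectation (\<lambda>w. f (int (Suc q)) x w * Z w)) has_vector_derivative expectation (\<lambda>w. f (int q) x w * Z w)) (at x within {t0..t1})"
      using has_vector_derivative_cong_on[of "{t0..t1}" "\<lambda>x. expectation (\<lambda>w. f (int (Suc q)) x w * Z w)"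
          "ensemble_mean t0 t1 ?g ?c (int (Suc q))" x] x by simp
  qed
  have cont: "((\<lambda>x. l2norm M (\<lambda>w. f (int q) x w - f (int q) t w)) \<longlongrightarrow> 0) (at t within {t0..t1})"
    if "q \<le> r" "t \<in> {t0..t1}" for q t
    using that
  proof (induction q arbitrary: t)
    case 0
    have eq: "l2norm M (\<lambda>w. f (int 0) x w - f (int 0) t w) = l2norm M (\<lambda>w. f0 x w - f0 t w)" if "x \<in> {t0..t1}" for x
      unfolding l2norm_def using derivative_chainD(1)[OF negative_chain] that 0
      by (intro arg_cong[where f = sqrt] Bochner_Integration.integral_cong) auto
    show ?case
      by (rule Lim_transform_eventually[OF f0_cont[OF 0(2)]])
        (auto simp: eventually_at_filter eq[symmetric] intro!: always_eventually)
  next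
    case (Suc q)
    then have "has_ms_derivative M {t0..t1} (f (int (Suc q))) (f (int q) t) t"
      by (intro derivative) auto
    then show ?case
      using Suc.prems by (intro ms_derivative_imp_l2_continuous)
  qed
  show "((\<lambda>x. l2norm M (\<lambda>w. f (int q) x w - f (int q) t w)) \<longlongrightarrow> 0) (at t within {t0..t1})"
    by (rule cont[OF assms])
  show "has_ms_derivative M {t0..t1} (f (int (Suc q))) (f (int q) t) t" if "q < r"
    by (rule derivative[OF that assms(2) cont[OF assms]])
qed

text \<open>For orders up to 0 the derivative is part of \<open>generated_by\<close>; positive
  orders require the preceding lemma.\<close>

lemma f_has_ms_derivative:
  assumes p: "p \<in> {- int r + 1..int r}" and t: "t \<in> {t0..t1}"
  shows "has_ms_derivative M {t0..t1} (f p) (f (p - 1) t) t"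
proof -
  have "p \<in> {- int r..int r}"
    using p by auto
  then show ?thesis
  proof (cases rule: index_cases)
    case (neg k)
    then have k: "k < r" and p1: "p - 1 = - int (Suc k)"
      using p by auto
    show ?thesis
      unfolding p1 unfolding neg(1) by (rule derivative_chainD(2)[OF negative_chain k t])
  next
    case (pos q)
    then show ?thesis
      using f_l2_continuous_and_derivative(2)[of q t] t by simp
  qed
qed

lemma f_derivative_interior:
  assumes p: "p \<in> {- int r + 1..int r}" and t: "t \<in> {t0<..<t1}"
  shows "((\<lambda>h. \<integral>w. ((f p (t + h) w - f p t w) / h - f (p - 1) t w)\<^sup>2 \<partial>M) \<longlongrightarrow> 0) (at 0)"
  using f_has_ms_derivative[OF p, of t] t unfolding has_ms_derivative_def at_0_within_shifted_interior[OF t] by auto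

end

text \<open>The existence conjunct keeps the claims about every \<open>f\<close> from being vacuous.
  The comparison with an arbitrary \<open>g\<close> having the same mean and covariance functions
  makes precise that these determine the finite-dimensional laws.\<close>

theorem theorem1:
  fixes M :: "'a measure"
    and r :: nat
    and t0 t1 :: real
    and f0 :: "real \<Rightarrow> 'a \<Rightarrow> real"
    and \<mu> :: "real \<Rightarrow> real"
    and C :: "real \<Rightarrow> real \<Rightarrow> real"
    and \<kappa> :: "nat \<Rightarrow> 'a \<Rightarrow> real"
    and m\<^sub>\<kappa> :: "nat \<Rightarrow> real"
    and S\<^sub>\<kappa> :: "nat \<Rightarrow> nat \<Rightarrow> real"
  assumes "prob_space M"
    and "t0 < t1"
    and "gaussian_process M {t0..t1} f0 \<mu> C"
    and "C_on r {t0..t1} \<mu>"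
    and "C2_on r r {t0..t1} C"
    and "multivariate_normal M {1..r} \<kappa> m\<^sub>\<kappa> S\<^sub>\<kappa>"
    and "indep_processes M {t0..t1} f0 {1..r} \<kappa>"
  shows "(\<exists>f. generated_by M r t0 t1 f0 \<kappa> f) \<and>
    (\<forall>f. generated_by M r t0 t1 f0 \<kappa> f \<longrightarrow>
      \<comment> \<open>(1)\<close>
      ((\<forall>p\<in>{- int r..int r}. \<forall>t\<in>{t0..t1}. square_integrable M (f p t)) \<and>
       (\<forall>p\<in>{- int r + 1..int r}. \<forall>t\<in>{t0<..<t1}.
          ((\<lambda>h. \<integral>\<omega>. ((f p (t + h) \<omega> - f p t \<omega>) / h - f (p - 1) t \<omega>)\<^sup>2 \<partial>M) \<longlongrightarrow> 0) (at 0)) \<and>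
       (\<forall>p\<in>{1..r}. AE \<omega> in M. f (int p) t0 \<omega> = \<kappa> p \<omega>)) \<and>
      \<comment> \<open>(2)\<close>
      ((\<forall>t\<in>{t0..t1}. \<mu> t = 0) \<and> (\<forall>j\<in>{1..r}. m\<^sub>\<kappa> j = 0) \<longrightarrow> centered_ensemble M r t0 t1 f) \<and>
      \<comment> \<open>(3)\<close>
      ((\<forall>(n::nat) (p :: nat \<Rightarrow> int) (\<tau> :: nat \<Rightarrow> real).
          (\<forall>i<n. p i \<in> {- int r..int r} \<and> \<tau> i \<in> {t0..t1}) \<longrightarrow>
          gaussian_vector M {..<n} (\<lambda>i. f (p i) (\<tau> i))) \<and>
       vector_gaussian_process M {- int r..int r} {t0..t1} f
         (ensemble_mean t0 t1 \<mu> m\<^sub>\<kappa>) (ensemble_cov t0 t1 C S\<^sub>\<kappa>) \<and>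
       (\<forall>(N :: 'b measure) g.
          prob_space N \<and>
          vector_gaussian_process N {- int r..int r} {t0..t1} g
            (ensemble_mean t0 t1 \<mu> m\<^sub>\<kappa>) (ensemble_cov t0 t1 C S\<^sub>\<kappa>) \<longrightarrow>
          (\<forall>(n::nat) (p :: nat \<Rightarrow> int) (\<tau> :: nat \<Rightarrow> real).
             (\<forall>i<n. p i \<in> {- int r..int r} \<and> \<tau> i \<in> {t0..t1}) \<longrightarrow>
             distr M (\<Pi>\<^sub>M i\<in>{..<n}. borel) (\<lambda>\<omega>. \<lambda>i\<in>{..<n}. f (p i) (\<tau> i) \<omega>) =
             distr N (\<Pi>\<^sub>M i\<in>{..<n}. borel) (\<lambda>\<omega>. \<lambda>i\<in>{..<n}. g (p i) (\<tau> i) \<omega>)))))"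
proof -
  interpret gaussian_ensemble M r t0 t1 f0 \<mu> C \<kappa> m\<^sub>\<kappa> S\<^sub>\<kappa>
    using assms by (intro gaussian_ensemble.intro gaussian_ensemble_axioms.intro)
  show ?thesis
  proof (intro conjI allI impI)
    show "\<exists>f. generated_by M r t0 t1 f0 \<kappa> f"
      by (rule ensemble_exists)
  next
    fix f
    assume "generated_by M r t0 t1 f0 \<kappa> f"
    then interpret generated_ensemble M r t0 t1 f0 \<mu> C \<kappa> m\<^sub>\<kappa> S\<^sub>\<kappa> f
      by unfold_locales
    show "\<forall>p\<in>{- int r..int r}. \<forall>t\<in>{t0..t1}. square_integrable M (f p t)"
      using f_square_integrable by blast
    show "\<forall>p\<in>{- int r + 1..int r}. \<forall>t\<in>{t0<..<t1}.
        ((\<lambda>h. \<integral>w. ((f p (t + h) w - f p t w) / h - f (p - 1) t w)\<^sup>2 \<partial>M) \<longlongrightarrow> 0) (at 0)"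
      using f_derivative_interior by blast
    show "\<forall>p\<in>{1..r}. AE w in M. f (int p) t0 w = \<kappa> p w"
      using f_initial_value by blast
    show "vector_gaussian_process M {- int r..int r} {t0..t1} f
        (ensemble_mean t0 t1 \<mu> m\<^sub>\<kappa>) (ensemble_cov t0 t1 C S\<^sub>\<kappa>)"
      by (rule f_vector_gaussian_process)
    show "gaussian_vector M {..<n} (\<lambda>i. f (p i) (\<tau> i))"
      if "\<forall>i<n. p i \<in> {- int r..int r} \<and> \<tau> i \<in> {t0..t1}" for n :: nat and p \<tau>
      using that by (intro gaussian_vector_if_gaussian_space f_gaussian_space) auto
    show "centered_ensemble M r t0 t1 f"
      if zero: "(\<forall>t\<in>{t0..t1}. \<mu> t = 0) \<and> (\<forall>j\<in>{1..r}. m\<^sub>\<kappa> j = 0)"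
    proof -
      have "expectation (f p t) = 0" if "p \<in> {- int r..int r}" "t \<in> {t0..t1}" for p t
      proof -
        have "ensemble_mean t0 t1 \<mu> m\<^sub>\<kappa> p t = ensemble_mean t0 t1 (\<lambda>_. 0) (\<lambda>_. 0) p t"
          using zero that by (intro ensemble_mean_cong) auto
        then show ?thesis
          using f_mean[OF that] ensemble_mean_zero[OF t01 that(2)] by simp
      qed
      then show ?thesis
        unfolding centered_ensemble_def using f_square_integrable f_derivative_interior by blast
    qed
    show "distr M (\<Pi>\<^sub>M i\<in>{..<n}. borel) (\<lambda>w. \<lambda>i\<in>{..<n}. f (p i) (\<tau> i) w) =
        distr N (\<Pi>\<^sub>M i\<in>{..<n}. borel) (\<lambda>w. \<lambda>i\<in>{..<n}. g (p i) (\<tau> i) w)"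
      if "prob_space N \<and> vector_gaussian_process N {- int r..int r} {t0..t1} g
            (ensemble_mean t0 t1 \<mu> m\<^sub>\<kappa>) (ensemble_cov t0 t1 C S\<^sub>\<kappa>)"
        and "\<forall>i<n. p i \<in> {- int r..int r} \<and> \<tau> i \<in> {t0..t1}"
      for N :: "'b measure" and g and n :: nat and p \<tau>
      using that f_vector_gaussian_process
      by (intro vector_gaussian_process_law_unique[OF assms(1), where P = "{- int r..int r}" and T = "{t0..t1}"]) auto
  qed
qed

end
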